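(* Let $a\colon\mathbb{R}_+\to\mathbb{R}$ be a Hardy field function such that $t^d\log t\prec a(t)\prec t^{d+1}$ for some $d\in\mathbb{Z}_+$. Let $\phi\colon\mathbb{T}\to\mathbb{C}$ be Riemann-integrable, let $\alpha\in\mathbb{R}\setminus\mathbb{Q}$, and let $b(n):=\phi([a(n)]\alpha)$, $n\in\mathbb{N}$. Let $S_d\colon\mathbb{T}^{d+1}\to\mathbb{T}^{d+1}$ be given by $S_d(y_0,\ldots,y_d):=(y_0,y_1+y_0,\ldots,y_d+y_{d-1})$. Then the sequence $(b(n))$ has a unique Furstenberg system and it is a factor of the system $(\mathbb{T}^{2(d+1)},m_{\mathbb{T}^{2(d+1)}},S_d\times S_d)$.
   Context: Notation: $\mathbb{N}$ is the set of positive integers, $\mathbb{Z}_+$ the non-negative integers, $\mathbb{T}=\mathbb{R}/\mathbb{Z}$, $m_{\mathbb{T}^k}$ is the Haar probability measure on $\mathbb{T}^k$, $[t]$ denotes the integer part of $t\in\mathbb{R}$; real numbers such as $[a(n)]\alpha$ are viewed in $\mathbb{T}$ by reducing mod $1$. For functions on $\mathbb{R}_+$, $a(t)\prec b(t)$ means $\lim_{t\to+\infty}a(t)/b(t)=0$. Riemann-integrability (with respect to $m_{\mathbb{T}}$): $\phi\colon\mathbb{T}\to\mathbb{R}$ is Riemann-integrable if it is Borel measurable and for every $\varepsilon>0$ there exist $\phi^-,\phi^+\in C(\mathbb{T})$ with $\phi^-\le\phi\le\phi^+$ pointwise and $\int(\phi^+-\phi^-)\,dm_{\mathbb{T}}\le\varepsilon$;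 a complex valued function is Riemann-integrable if its real and imaginary parts are. Hardy fields: let $B$ be the ring of germs at $+\infty$ of real valued functions defined on half lines $[c,+\infty)$. A Hardy field is a subfield of $B$ closed under differentiation. All Hardy fields are assumed translation invariant: if $a(t)$ belongs to the field, so does $a(t+h)$ for every $h\in\mathbb{R}$. A Hardy field function is a function whose germ belongs to some Hardy field. Furstenberg systems: for a bounded sequence $b\colon\mathbb{N}\to\mathbb{C}$ with values in a closed disc $Y$, extended to $\mathbb{Z}$ arbitrarily with values in $Y$ (the extension does not matter), let $X:=Y^{\mathbb{Z}}$ and let $T$ be the shift, $(Tx)(n):=x(n+1)$. The sequence $b$ has a unique Furstenberg system if the weak-star limit $\mu:=\lim_{M\to\infty}\frac1M\sum_{m=1}^M\delta_{T^mb}$ exists, and then $(X,\mu,T)$ is its Furstenberg system. *)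

theory Defs
  imports "HOL-Probability.Probability"
begin

section \<open>Germs at infinity and Hardy fields\<close>

text \<open>A function on a half line \<open>[c, \<infinity>)\<close> is represented by any extension of it to the reals;
  the germ at \<open>+\<infinity>\<close> does not depend on the extension.\<close>

quotient_type germ = "real \<Rightarrow> real" / "\<lambda>f g. \<forall>\<^sub>F t in at_top. f t = g t"
  morphisms rep_germ germ_of
proof (rule equivpI)
  show "reflp (\<lambda>f g :: real \<Rightarrow> real. \<forall>\<^sub>F t in at_top. f t = g t)"
    by (simp add: reflp_def)
  show "symp (\<lambda>f g :: real \<Rightarrow> real. \<forall>\<^sub>F t in at_top. f t = g t)"
    by (simp add: symp_def eq_commute)
  show "transp (\<lambda>f g :: real \<Rightarrow> real. \<forall>\<^sub>F t in at_top. f t = g t)"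
    by (rule transpI) (auto elim: eventually_elim2)
qed

instantiation germ :: comm_ring_1
begin

lift_definition zero_germ :: germ is "\<lambda>_. 0" .
lift_definition one_germ :: germ is "\<lambda>_. 1" .
lift_definition plus_germ :: "germ \<Rightarrow> germ \<Rightarrow> germ" is "\<lambda>f g t. f t + g t"
  by (auto elim: eventually_elim2)
lift_definition minus_germ :: "germ \<Rightarrow> germ \<Rightarrow> germ" is "\<lambda>f g t. f t - g t"
  by (auto elim: eventually_elim2)
lift_definition uminus_germ :: "germ \<Rightarrow> germ" is "\<lambda>f t. - f t"
  by (auto elim: eventually_mono)
lift_definition times_germ :: "germ \<Rightarrow> germ \<Rightarrow> germ" is "\<lambda>f g t. f t * g t"
  by (auto elim: eventually_elim2)

instance
  by standard (transfer; simp add: algebra_simps)+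

end

definition hardy_field :: "germ set \<Rightarrow> bool" where
  "hardy_field H \<longleftrightarrow>
     0 \<in> H \<and> 1 \<in> H \<and>
     (\<forall>u\<in>H. \<forall>v\<in>H. u + v \<in> H \<and> u - v \<in> H \<and> u * v \<in> H) \<and>
     (\<forall>u\<in>H. u \<noteq> 0 \<longrightarrow> (\<exists>v\<in>H. u * v = 1)) \<and>
     (\<forall>f. germ_of f \<in> H \<longrightarrow>
        (\<exists>f'. (\<forall>\<^sub>F t in at_top. (f has_real_derivative f' t) (at t)) \<and> germ_of f' \<in> H)) \<and>
     (\<forall>f h. germ_of f \<in> H \<longrightarrow> germ_of (\<lambda>t. f (t + h)) \<in> H)"

definition hardy_field_function :: "(real \<Rightarrow> real) \<Rightarrow> bool" where
  "hardy_field_function a \<longleftrightarrow> (\<exists>H. hardy_field H \<and> germ_of a \<in> H)"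

text \<open>The first conjunct makes the quotient meaningful: since \<open>x / 0 = 0\<close>, without it everything
  would be of smaller growth than the zero function.\<close>

definition growth_less :: "(real \<Rightarrow> real) \<Rightarrow> (real \<Rightarrow> real) \<Rightarrow> bool" where
  "growth_less a b \<longleftrightarrow>
     (\<forall>\<^sub>F t in at_top. b t \<noteq> 0) \<and> ((\<lambda>t. a t / b t) \<longlongrightarrow> 0) at_top"

section \<open>The circle and tori\<close>

text \<open>As a measure space, the circle \<open>\<real>/\<int>\<close> is represented by its fundamental domain \<open>[0,1)\<close>, with
  addition modulo 1. Functions on the circle are represented by 1-periodic functions on the
  reals, the continuous ones by continuous 1-periodic functions.\<close>

definition circle_haar :: "real measure" where
  "circle_haar = restrict_space lborel {0..<1}"

definition torus_haar :: "nat \<Rightarrow> (nat \<Rightarrow> real) measure" where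
  "torus_haar k = PiM {..<k} (\<lambda>_. circle_haar)"

definition torus_skew :: "nat \<Rightarrow> (nat \<Rightarrow> real) \<Rightarrow> nat \<Rightarrow> real" where
  "torus_skew d y = (\<lambda>i\<in>{..<d + 1}. if i = 0 then y 0 else frac (y i + y (i - 1)))"

definition periodic1 :: "(real \<Rightarrow> 'a) \<Rightarrow> bool" where
  "periodic1 f \<longleftrightarrow> (\<forall>x. f (x + 1) = f x)"

definition riemann_integrable_real :: "(real \<Rightarrow> real) \<Rightarrow> bool" where
  "riemann_integrable_real \<phi> \<longleftrightarrow>
     periodic1 \<phi> \<and> \<phi> \<in> borel_measurable borel \<and>
     (\<forall>\<epsilon>>0. \<exists>\<phi>m \<phi>p.
        continuous_on UNIV \<phi>m \<and> periodic1 \<phi>m \<and> continuous_on UNIV \<phi>p \<and> periodic1 \<phi>p \<and>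
        (\<forall>x. \<phi>m x \<le> \<phi> x \<and> \<phi> x \<le> \<phi>p x) \<and>
        (\<integral>x. (\<phi>p x - \<phi>m x) \<partial>circle_haar) \<le> \<epsilon>)"

definition riemann_integrable_circle :: "(real \<Rightarrow> complex) \<Rightarrow> bool" where
  "riemann_integrable_circle \<phi> \<longleftrightarrow>
     riemann_integrable_real (\<lambda>x. Re (\<phi> x)) \<and> riemann_integrable_real (\<lambda>x. Im (\<phi> x))"

section \<open>Measure preserving systems and factors\<close>

definition mp_system :: "'a measure \<Rightarrow> ('a \<Rightarrow> 'a) \<Rightarrow> bool" where
  "mp_system M T \<longleftrightarrow> prob_space M \<and> T \<in> measurable M M \<and> distr M M T = M"

text \<open>\<open>is_factor N R M T\<close>: the system \<open>(N, R)\<close> is a factor of the system \<open>(M, T)\<close>.\<close>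

definition is_factor ::
  "'b measure \<Rightarrow> ('b \<Rightarrow> 'b) \<Rightarrow> 'a measure \<Rightarrow> ('a \<Rightarrow> 'a) \<Rightarrow> bool" where
  "is_factor N R M T \<longleftrightarrow>
     mp_system N R \<and> mp_system M T \<and>
     (\<exists>\<pi>\<in>measurable M N. distr M N \<pi> = N \<and> (AE x in M. \<pi> (T x) = R (\<pi> x)))"

section \<open>Furstenberg systems\<close>

definition seq_space :: "complex set \<Rightarrow> (int \<Rightarrow> complex) set" where
  "seq_space Y = {x. \<forall>k. x k \<in> Y}"

definition seq_shift :: "(int \<Rightarrow> complex) \<Rightarrow> int \<Rightarrow> complex" where
  "seq_shift x = (\<lambda>k. x (k + 1))"

text \<open>\<open>\<mu>\<close> is the weak-star limit of the measures \<open>1/M \<Sum>\<^sub>m\<^sub>\<le>\<^sub>M \<delta>(T\<^sup>m b)\<close>. Function spaces carry the product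
  topology. Entries of \<open>b\<close> at index 0 are ignored, and the limit is required for every extension
  \<open>\<beta>\<close> of \<open>b\<close> from the positive integers to the integers.\<close>

definition unique_furstenberg_system ::
  "complex set \<Rightarrow> (nat \<Rightarrow> complex) \<Rightarrow> (int \<Rightarrow> complex) measure \<Rightarrow> bool" where
  "unique_furstenberg_system Y b \<mu> \<longleftrightarrow>
     sets \<mu> = sets (restrict_space borel (seq_space Y)) \<and> prob_space \<mu> \<and>
     (\<forall>\<beta>\<in>seq_space Y. (\<forall>n\<ge>1. \<beta> (int n) = b n) \<longrightarrow>
        (\<forall>f :: (int \<Rightarrow> complex) \<Rightarrow> real. continuous_on (seq_space Y) f \<longrightarrow>
           (\<lambda>M. (\<Sum>m=1..M. f ((seq_shift ^^ m) \<beta>)) / real M) \<longlonglongrightarrow> (\<integral>x. f x \<partial>\<mu>)))"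

end

theory Submission
  imports Defs "HOL-Real_Asymp.Real_Asymp"
begin

text \<open>Let \<open>D f t = f (t + 1) - f t\<close>. Since \<open>D\<^sup>d\<^sup>+\<^sup>1 a\<close> tends to 0, Newton's formula gives
  \<open>a (m + k) = (\<Sum>j\<le>d. (k choose j) D\<^sup>j a (m)) + o(1)\<close> for every fixed integer \<open>k\<close>. Hence the
  sequence seen from time \<open>m\<close> is, up to small errors, a fixed function of the orbit under the skew map
  of the point of the torus with coordinates \<open>D\<^sup>j a (m)\<close> and \<open>\<alpha> D\<^sup>j a (m)\<close>, \<open>j \<le> d\<close>, and it suffices
  that these points equidistribute. By Weyl's criterion this concerns the exponential sums of
  \<open>\<Sum>j\<le>d. c\<^sub>j D\<^sup>j a\<close> with real coefficients that are not all 0, where \<open>\<alpha>\<close> irrational is used.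
  Repeated van der Corput differencing reduces them to \<open>c D\<^sup>d a\<close> with \<open>c \<noteq> 0\<close>, to which Fejer's theorem
  applies: a Hardy field that is translation invariant contains \<open>W = D\<^sup>d\<^sup>+\<^sup>1 a\<close>, so \<open>W\<close> is eventually
  monotone, and the growth conditions on \<open>a\<close> give \<open>W \<longrightarrow> 0\<close> and \<open>t |W t| \<longrightarrow> \<infinity>\<close>.\<close>

section \<open>Averages\<close>

text \<open>The obstacle is that \<open>of_int \<lfloor>t\<rfloor> * \<alpha>\<close> equals
  \<open>\<alpha> * t - \<alpha> * frac t\<close>. Reading the sequence off a torus point with
  blocks \<open>x\<close> and \<open>y\<close> therefore means evaluating \<phi> at
  \<open>y - \<alpha> * frac x\<close>. This can jump where \<open>x\<close> is an integer, besides
  wherever \<phi> does, while equidistribution only tests continuous functions. So \<phi> is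
  replaced by a continuous \<open>F\<close> with values in the same disc, with an error bounded at
  every point, not just almost everywhere, by a continuous \<open>H\<close> of small integral: only
  a pointwise bound survives averaging along a sequence of points, which is itself a null set.
  Differences take the place of derivatives because they act on values at integers, and Newton's
  coefficients are integers, so the formula descends to the torus. The field is only known to
  contain the rational constants. Growth statements are therefore obtained indirectly: an eventual
  bound on a difference is summed to a bound on \<open>a\<close> that contradicts the hypotheses,
  and monotonicity in the field excludes oscillation.\<close>

definition avg :: "(nat \<Rightarrow> 'a::real_normed_vector) \<Rightarrow> nat \<Rightarrow> 'a" where
  "avg z M = (\<Sum>m=1..M. z m) /\<^sub>R real M"

lemma avg_real: "avg z M = (\<Sum>m=1..M. z m) / real M"
  by (simp add: avg_def field_simps)

lemma avg_add: "avg (\<lambda>m. y m + z m) M = avg y M + avg z M"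
  by (simp add: avg_def sum.distrib scaleR_add_right)

lemma avg_diff: "avg (\<lambda>m. y m - z m) M = avg y M - avg z M"
  by (simp add: avg_def sum_subtractf scaleR_diff_right)

lemma avg_sum: "avg (\<lambda>m. \<Sum>i\<in>I. z i m) M = (\<Sum>i\<in>I. avg (z i) M)"
  by (simp add: avg_def scaleR_sum_right sum.swap[of _ I])

lemma avg_mult_left:
  fixes c :: "'a::real_normed_algebra"
  shows "avg (\<lambda>m. c * z m) M = c * avg z M"
  by (simp add: avg_def sum_distrib_left)

lemma avg_const: "M \<ge> 1 \<Longrightarrow> avg (\<lambda>_. c) M = c"
  by (simp add: avg_def sum_constant_scaleR)

lemma avg_linear:
  assumes "bounded_linear F"
  shows "avg (\<lambda>m. F (z m)) M = F (avg z M)"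
  unfolding avg_def
  by (simp add: linear_sum[OF bounded_linear.linear[OF assms]]
      linear_scale[OF bounded_linear.linear[OF assms]])

lemma norm_avg_le: "norm (avg z M) \<le> avg (\<lambda>m. norm (z m)) M"
  by (simp add: avg_def norm_sum mult_left_mono)

lemma avg_mono:
  fixes y z :: "nat \<Rightarrow> real"
  assumes "\<And>m. y m \<le> z m"
  shows "avg y M \<le> avg z M"
  by (simp add: avg_def assms sum_mono mult_left_mono)

lemma tendsto_avg_const: "avg (\<lambda>_. c) \<longlonglongrightarrow> c"
  by (rule tendsto_eventually) (auto simp: eventually_sequentially avg_const intro!: exI[of _ 1])

lemma tendsto_avg_null:
  fixes z :: "nat \<Rightarrow> 'a::real_normed_vector"
  assumes "z \<longlonglongrightarrow> 0"
  shows "avg z \<longlonglongrightarrow> 0"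
proof (rule LIMSEQ_I)
  fix e :: real assume e: "e > 0"
  then obtain N where N: "\<And>m. m \<ge> N \<Longrightarrow> norm (z m) < e/2"
    using LIMSEQ_D[OF assms, of "e/2"] by auto
  define C where "C = (\<Sum>m=1..N. norm (z m))"
  have "(\<lambda>M. C / real M) \<longlonglongrightarrow> 0" by real_asymp
  then obtain M0 where M0: "\<And>M. M \<ge> M0 \<Longrightarrow> norm (C / real M) < e/2"
    using LIMSEQ_D[of "\<lambda>M. C / real M" 0 "e/2"] e by auto
  show "\<exists>no. \<forall>n\<ge>no. norm (avg z n - 0) < e"
  proof (intro exI allI impI)
    fix M assume M: "M \<ge> max (Suc N) M0"
    have "(\<Sum>m=1..M. norm (z m)) = C + (\<Sum>m=Suc N..M. norm (z m))"
      unfolding C_def using M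
      using sum.ub_add_nat[of 1 N "\<lambda>m. norm (z m)" "M - N"] by simp
    also have "(\<Sum>m=Suc N..M. norm (z m)) \<le> (\<Sum>m=Suc N..M. e/2)"
      by (intro sum_mono less_imp_le N) auto
    also have "\<dots> \<le> real M * (e/2)" using M e by (simp add: mult_right_mono)
    finally have *: "(\<Sum>m=1..M. norm (z m)) \<le> C + real M * (e/2)" by simp
    have "norm (avg z M) \<le> (\<Sum>m=1..M. norm (z m)) / real M"
      using norm_avg_le[of z M] by (simp add: avg_real)
    also have "\<dots> \<le> (C + real M * (e/2)) / real M"
      using * by (intro divide_right_mono) auto
    also have "\<dots> = C / real M + e/2" using M by (simp add: field_simps)
    also have "\<dots> < e" using abs_less_iff[THEN iffD1, OF M0[of M, unfolded real_norm_def]] M by linarith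
    finally show "norm (avg z M - 0) < e" by simp
  qed
qed

lemma avg_cong_tendsto:
  fixes y z :: "nat \<Rightarrow> 'a::real_normed_vector"
  assumes "(\<lambda>m. y m - z m) \<longlonglongrightarrow> 0" "avg y \<longlonglongrightarrow> L"
  shows "avg z \<longlonglongrightarrow> L"
  using tendsto_diff[OF assms(2) tendsto_avg_null[OF assms(1)]]
  by (simp add: avg_diff)

text \<open>Moving the window by one changes the sum by two end terms only, so a shift by
  \<open>h\<close> costs at most \<open>2 * h * B / M\<close>.\<close>

lemma avg_shift_tendsto:
  fixes z :: "nat \<Rightarrow> 'a::real_normed_vector"
  assumes "\<And>m. norm (z m) \<le> B"
  shows "(\<lambda>M. avg (\<lambda>m. z (m + h)) M - avg z M) \<longlonglongrightarrow> 0"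
proof -
  have B: "B \<ge> 0" using assms[of 0] norm_ge_zero order_trans by blast
  have bd: "norm (avg (\<lambda>m. z (m + h)) M - avg z M) \<le> (2 * real h * B) / real M" for M
  proof (induction h)
    case 0 then show ?case by simp
  next
    case (Suc h)
    have "(\<Sum>m=1..M. z (m + Suc h)) - (\<Sum>m=1..M. z (m + h)) = z (M + Suc h) - z (Suc h)"
      by (induction M) (auto simp: algebra_simps)
    then have "avg (\<lambda>m. z (m + Suc h)) M - avg (\<lambda>m. z (m + h)) M
        = (z (M + Suc h) - z (Suc h)) /\<^sub>R real M"
      by (simp add: avg_def scaleR_diff_right[symmetric])
    also have "norm \<dots> \<le> 2 * B / real M"
    proof -
      have "norm (z (M + Suc h) - z (Suc h)) \<le> 2 * B"
        using norm_triangle_ineq4[of "z (M + Suc h)" "z (Suc h)"] assms[of "M + Suc h"] assms[of "Suc h"]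
        by linarith
      then have "norm (z (M + Suc h) - z (Suc h)) / real M \<le> 2 * B / real M"
        by (rule divide_right_mono) simp
      then show ?thesis by (simp add: divide_inverse mult.commute del: add_Suc_right)
    qed
    finally have "norm (avg (\<lambda>m. z (m + Suc h)) M - avg (\<lambda>m. z (m + h)) M) \<le> 2 * B / real M" .
    then have "norm (avg (\<lambda>m. z (m + Suc h)) M - avg z M) \<le> 2 * B / real M + (2 * real h * B) / real M"
      using Suc norm_triangle_ineq[of "avg (\<lambda>m. z (m + Suc h)) M - avg (\<lambda>m. z (m + h)) M"
          "avg (\<lambda>m. z (m + h)) M - avg z M"] by simp
    also have "\<dots> = (2 * real (Suc h) * B) / real M" by (simp add: algebra_simps add_divide_distrib)
    finally show ?case .
  qed
  have "(\<lambda>M. (2 * real h * B) / real M) \<longlonglongrightarrow> 0" by real_asymp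
  then show ?thesis
    by (rule tendsto_0_le[where K = 1]) (use bd B in \<open>auto intro!: always_eventually\<close>)
qed

lemma avg_shift:
  fixes z :: "nat \<Rightarrow> 'a::real_normed_vector"
  assumes "\<And>m. norm (z m) \<le> B" "avg z \<longlonglongrightarrow> L"
  shows "avg (\<lambda>m. z (m + h)) \<longlonglongrightarrow> L"
  using tendsto_add[OF avg_shift_tendsto[of z B h, OF assms(1)] assms(2)] by simp

section \<open>Van der Corput's difference theorem\<close>

text \<open>Up to a vanishing shift error, the average of \<open>z\<close> is \<open>1/H\<close>
  times the average of the window sums \<open>y m\<close> of length \<open>H\<close>. By
  Cauchy-Schwarz the latter is at most the root of the mean square of \<open>y\<close>, to which the
  diagonal terms contribute at most \<open>H\<close>, while the others are correlations that vanish
  in the limit. This leaves a bound of order \<open>1 / sqrt H\<close>.\<close>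

lemma van_der_corput:
  fixes z :: "nat \<Rightarrow> complex"
  assumes z1: "\<And>m. cmod (z m) \<le> 1"
    and corr: "\<And>h. h \<ge> 1 \<Longrightarrow> avg (\<lambda>m. z (m + h) * cnj (z m)) \<longlonglongrightarrow> 0"
  shows "avg z \<longlonglongrightarrow> 0"
proof (rule LIMSEQ_I)
  fix e :: real assume e: "e > 0"
  \<comment> \<open>The final bound: \<open>H\<close> under the root is the diagonal, the
    \<open>1\<close> next to it absorbs the averaged correlations, and the last \<open>1\<close>
    absorbs the shift error.\<close>
  have "(\<lambda>H. (sqrt (real H + 1) + 1) / real H) \<longlonglongrightarrow> 0" by real_asymp
  then have "eventually (\<lambda>H. (sqrt (real H + 1) + 1) / real H < e) sequentially"
    using e by (rule order_tendstoD)
  then obtain H where H: "H \<ge> 1" "(sqrt (real H + 1) + 1) / real H < e"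
    using eventually_conj[OF eventually_ge_at_top[of "1::nat"]] by (metis (mono_tags, lifting) eventually_sequentially le_refl)
  define y where "y m = (\<Sum>h<H. z (m + h))" for m
  define R where "R m = (\<Sum>h<H. \<Sum>h'\<in>{..<H} - {h}. z (m + h) * cnj (z (m + h')))" for m
  have bd2: "norm (z i * cnj (z j)) \<le> 1" for i j
    using mult_mono[OF z1[of i] z1[of j]] by (simp add: norm_mult)
  \<comment> \<open>For \<open>h' < h\<close> this is the correlation with lag
    \<open>h - h'\<close>, seen \<open>h'\<close> steps later; the opposite order is its
    conjugate.\<close>
  have off: "avg (\<lambda>m. z (m + h) * cnj (z (m + h'))) \<longlonglongrightarrow> 0" if "h' \<noteq> h" for h h'
  proof -
    have gt: "avg (\<lambda>m. z (m + h) * cnj (z (m + h'))) \<longlonglongrightarrow> 0" if "h' < h" for h h'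
    proof -
      have "avg (\<lambda>m. z (m + h' + (h - h')) * cnj (z (m + h'))) \<longlonglongrightarrow> 0"
        by (rule avg_shift[of "\<lambda>m. z (m + (h - h')) * cnj (z m)" 1]) (use that bd2 corr[of "h - h'"] in auto)
      then show ?thesis using that by simp
    qed
    show ?thesis
    proof (cases "h' < h")
      case False
      then have "h < h'" using that by simp
      from tendsto_cnj[OF gt[OF this]] have "(\<lambda>M. cnj (avg (\<lambda>m. z (m + h') * cnj (z (m + h))) M)) \<longlonglongrightarrow> 0" by simp
      then show ?thesis
        by (simp add: avg_linear[OF bounded_linear_cnj, symmetric] mult.commute)
    qed (rule gt)
  qed
  have "(\<lambda>M. avg R M) \<longlonglongrightarrow> (\<Sum>h<H. \<Sum>h'\<in>{..<H} - {h}. 0)"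
    unfolding R_def avg_sum by (intro tendsto_sum off) auto
  then have R0: "avg R \<longlonglongrightarrow> 0" by simp
  have ysq: "(cmod (y m))\<^sup>2 \<le> real H + Re (R m)" for m
  proof -
    have "complex_of_real ((cmod (y m))\<^sup>2) = (\<Sum>h<H. \<Sum>h'<H. z (m + h) * cnj (z (m + h')))"
      by (subst complex_norm_square) (simp add: y_def sum_product)
    also have "\<dots> = (\<Sum>h<H. z (m + h) * cnj (z (m + h)) + (\<Sum>h'\<in>{..<H} - {h}. z (m + h) * cnj (z (m + h'))))"
      by (intro sum.cong refl) (simp add: sum.remove)
    also have "\<dots> = (\<Sum>h<H. z (m + h) * cnj (z (m + h))) + R m"
      by (simp add: sum.distrib R_def)
    finally have "(cmod (y m))\<^sup>2 = (\<Sum>h<H. Re (z (m + h) * cnj (z (m + h)))) + Re (R m)"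
      by (metis Re_complex_of_real Re_sum plus_complex.simps(1))
    also have "(\<Sum>h<H. Re (z (m + h) * cnj (z (m + h)))) \<le> (\<Sum>h<H. 1)"
      using complex_Re_le_cmod bd2 order_trans by (intro sum_mono) blast
    finally show ?thesis by simp
  qed
  have avgy: "(norm (avg y M))\<^sup>2 \<le> real H + norm (avg R M)" if M: "M \<ge> 1" for M
  proof -
    have "(norm (\<Sum>m=1..M. y m))\<^sup>2 \<le> (\<Sum>m=1..M. norm (y m))\<^sup>2"
      by (intro power_mono norm_sum) simp
    also have "\<dots> = (\<Sum>m=1..M. norm (y m) * 1)\<^sup>2" by simp
    also have "\<dots> \<le> (\<Sum>m=1..M. (norm (y m))\<^sup>2) * (\<Sum>m=1..M. 1\<^sup>2)"
      by (rule Cauchy_Schwarz_ineq_sum)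
    also have "\<dots> \<le> (\<Sum>m=1..M. real H + Re (R m)) * real M"
      using sum_mono[of "{1..M}" "\<lambda>m. (cmod (y m))\<^sup>2" "\<lambda>m. real H + Re (R m)"] ysq by (auto intro!: mult_right_mono)
    also have "\<dots> = (real M * real H + Re (\<Sum>m=1..M. R m)) * real M"
      by (simp add: sum.distrib)
    finally have *: "(norm (\<Sum>m=1..M. y m))\<^sup>2 / (real M)\<^sup>2 \<le> (real M * real H + Re (\<Sum>m=1..M. R m)) * real M / (real M)\<^sup>2"
      by (intro divide_right_mono) auto
    have "(norm (avg y M))\<^sup>2 = (norm (\<Sum>m=1..M. y m))\<^sup>2 / (real M)\<^sup>2"
      by (simp add: avg_def power_mult_distrib power_inverse field_simps)
    also note *
    also have "(real M * real H + Re (\<Sum>m=1..M. R m)) * real M / (real M)\<^sup>2 = real H + Re (avg R M)"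
      using M by (simp add: avg_def power2_eq_square field_simps)
    also have "\<dots> \<le> real H + norm (avg R M)" using complex_Re_le_cmod by simp
    finally show ?thesis .
  qed
  have yz: "(\<lambda>M. avg y M - of_nat H * avg z M) \<longlonglongrightarrow> 0"
  proof -
    have "(\<lambda>M. \<Sum>h<H. (avg (\<lambda>m. z (m + h)) M - avg z M)) \<longlonglongrightarrow> (\<Sum>h<H. 0)"
      by (intro tendsto_sum avg_shift_tendsto[of _ 1] z1)
    then show ?thesis by (simp add: y_def[abs_def] avg_sum sum_subtractf)
  qed
  obtain M1 where M1: "\<And>M. M \<ge> M1 \<Longrightarrow> norm (avg R M) < 1"
    using LIMSEQ_D[OF R0, of 1] by auto
  obtain M2 where M2: "\<And>M. M \<ge> M2 \<Longrightarrow> norm (avg y M - of_nat H * avg z M) < 1"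
    using LIMSEQ_D[OF yz, of 1] by auto
  show "\<exists>no. \<forall>n\<ge>no. norm (avg z n - 0) < e"
  proof (intro exI allI impI)
    fix M assume M: "M \<ge> Max {1, M1, M2}"
    have "norm (avg y M) \<le> sqrt (real H + 1)"
      using avgy[of M] M1[of M] M by (intro real_le_rsqrt) auto
    moreover have "real H * norm (avg z M) \<le> norm (avg y M) + 1"
      using M2[of M] M norm_triangle_ineq3[of "avg y M" "of_nat H * avg z M"] by (auto simp: norm_mult)
    ultimately have "norm (avg z M) \<le> (sqrt (real H + 1) + 1) / real H"
      using H(1) by (simp add: field_simps)
    then show "norm (avg z M - 0) < e" using H(2) by simp
  qed
qed

section \<open>Exponential sums with slowly varying increments\<close>

lemma inverse_cis_minus_one:
  assumes "sin x \<noteq> 0"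
  shows "1 / (cis (2 * x) - 1) = Complex (- 1/2) (- cot x / 2)"
proof -
  \<comment> \<open>This is \<open>2 * \<i> * sin x * cis x\<close>, which is why the real part of
    the reciprocal does not depend on \<open>x\<close>.\<close>
  have "cis (2 * x) - 1 = Complex (- 2 * (sin x)\<^sup>2) (2 * sin x * cos x)"
    by (simp add: complex_eq_iff cos_double_sin sin_double)
  moreover have "Complex (- 2 * (sin x)\<^sup>2) (2 * sin x * cos x) * Complex (- 1/2) (- cot x / 2) = 1"
    using assms sin_cos_squared_add[of x]
    by (simp add: complex_eq_iff cot_def field_simps power2_eq_square)
  ultimately show ?thesis
    by (metis divide_eq_eq mult.commute mult_zero_left zero_neq_one)
qed

text \<open>Turns the variation of the cotangent into \<open>1 / (pi * w M)\<close>, which is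
  negligible after division by \<open>M\<close> because \<open>n * w n\<close> tends to
  infinity.\<close>

lemma cot_le_inverse:
  assumes "0 < x" "x < pi/2"
  shows "cot x \<le> 1 / x"
proof -
  have c: "cos x > 0" using assms by (intro cos_gt_zero) auto
  have "x \<le> tan x" using abs_tan_ge[of x] tan_gt_zero[of x] assms by simp
  then have "1 / tan x \<le> 1 / x"
    using assms by (intro divide_left_mono) (auto intro!: mult_pos_pos)
  then show ?thesis by (simp add: cot_def tan_def)
qed

lemma cot_antimono:
  assumes "0 < x" "x \<le> y" "y < pi"
  shows "cot y \<le> cot x"
proof -
  have "sin x > 0" "sin y > 0" using assms by (auto intro!: sin_gt_zero)
  moreover have "sin (y - x) \<ge> 0" using assms by (intro sin_ge_zero) auto
  ultimately show ?thesis by (simp add: cot_def field_simps sin_diff)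
qed

text \<open>Fejer's theorem, by Abel summation: \<open>cis (2 \<pi> V n)\<close> is \<open>1 / (cis (2 \<pi> (V (n+1) - V n)) - 1)\<close>
  times a difference, and that factor has constant real part and monotone imaginary part.\<close>

lemma avg_cis_fejer:
  fixes V :: "nat \<Rightarrow> real"
  defines "w \<equiv> \<lambda>n. V (Suc n) - V n"
  assumes pos: "\<forall>\<^sub>F n in sequentially. 0 < w n"
    and dec: "\<forall>\<^sub>F n in sequentially. w (Suc n) \<le> w n"
    and w0: "w \<longlonglongrightarrow> 0"
    and winf: "filterlim (\<lambda>n. real n * w n) at_top sequentially"
  shows "avg (\<lambda>n. cis (2 * pi * V n)) \<longlonglongrightarrow> 0"
proof -
  \<comment> \<open>Increments below \<open>1/2\<close> keep \<open>pi * w n\<close> inside the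
    interval from 0 to \<open>pi/2\<close>, where the cotangent is positive and decreasing.\<close>
  have "\<forall>\<^sub>F n in sequentially. 0 < w n \<and> w (Suc n) \<le> w n \<and> w n < 1/2"
    using pos dec order_tendstoD(2)[OF w0, of "1/2", simplified] by eventually_elim auto
  then obtain N where N: "\<And>n. n \<ge> N \<Longrightarrow> 0 < w n \<and> w (Suc n) \<le> w n \<and> w n < 1/2"
    by (auto simp: eventually_sequentially)
  define E where "E n = cis (2 * pi * V n)" for n
  define ct where "ct n = cot (pi * w n)" for n
  define q where "q n = 1 / (cis (2 * (pi * w n)) - 1)" for n
  have sinw: "sin (pi * w n) > 0" if "n \<ge> N" for n
    using N[OF that] by (intro sin_gt_zero) auto
  have q: "q n = Complex (- 1/2) (- ct n / 2)" if "n \<ge> N" for n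
    unfolding q_def ct_def using sinw[OF that] by (intro inverse_cis_minus_one) auto
  have ctmono: "ct n \<le> ct (Suc n)" if "n \<ge> N" for n
    unfolding ct_def using N[OF that] N[of "Suc n"] that by (intro cot_antimono) auto
  have ctle: "ct n \<le> 1 / (pi * w n)" if "n \<ge> N" for n
    unfolding ct_def using N[OF that] by (intro cot_le_inverse) auto
  have ct0: "ct n \<ge> 0" if "n \<ge> N" for n
    using N[OF that] sinw[OF that] unfolding ct_def cot_def
    by (intro divide_nonneg_pos cos_ge_zero) (auto intro: order_trans[of _ 0])
  have Eq: "E n = q n * (E (Suc n) - E n)" if "n \<ge> N" for n
  proof -
    have "E (Suc n) = E n * cis (2 * (pi * w n))"
      by (simp add: E_def w_def cis_mult algebra_simps)
    then have "E (Suc n) - E n = E n * (cis (2 * (pi * w n)) - 1)" by (simp add: algebra_simps)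
    moreover have "cis (2 * (pi * w n)) - 1 \<noteq> 0"
    proof
      assume "cis (2 * (pi * w n)) - 1 = 0"
      then have "q n = 0" unfolding q_def by simp
      then show False using q[OF that] by (simp add: complex_eq_iff)
    qed
    ultimately show ?thesis by (simp add: q_def)
  qed
  have abel: "(\<Sum>n=N..<N+k. E n) = q (N+k) * E (N+k) - q N * E N - (\<Sum>n=N..<N+k. (q (Suc n) - q n) * E (Suc n))" for k
  proof (induction k)
    case (Suc k)
    have "(\<Sum>n=N..<N+Suc k. E n) = (\<Sum>n=N..<N+k. E n) + q (N+k) * (E (Suc (N+k)) - E (N+k))"
      using Eq[of "N+k"] by simp
    then show ?case using Suc by (simp add: algebra_simps)
  qed simp
  have nE: "norm (E n) = 1" for n by (simp add: E_def)
  have nq: "norm (q n) \<le> 1 + ct n" if "n \<ge> N" for n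
    using q[OF that] cmod_le[of "q n"] ct0[OF that] by simp
  \<comment> \<open>Only the imaginary part of \<open>q\<close> varies, and it does so
    monotonically, so the total variation telescopes and is controlled by the end value of
    \<open>ct\<close>.\<close>
  have var: "norm (\<Sum>n=N..<N+k. (q (Suc n) - q n) * E (Suc n)) \<le> ct (N+k)" for k
  proof -
    have "norm (\<Sum>n=N..<N+k. (q (Suc n) - q n) * E (Suc n)) \<le> (\<Sum>n=N..<N+k. norm ((q (Suc n) - q n) * E (Suc n)))"
      by (rule norm_sum)
    also have "\<dots> \<le> (\<Sum>n=N..<N+k. ct (Suc n) - ct n)"
    proof (rule sum_mono)
      fix n assume "n \<in> {N..<N+k}"
      then have n: "n \<ge> N" by simp
      have "q (Suc n) - q n = Complex 0 (- (ct (Suc n) - ct n) / 2)"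
        using q[OF n] q[of "Suc n"] n by (simp add: complex_eq_iff field_simps)
      then show "norm ((q (Suc n) - q n) * E (Suc n)) \<le> ct (Suc n) - ct n"
        using ctmono[OF n] by (simp add: norm_mult nE complex_norm)
    qed
    also have "\<dots> = ct (N+k) - ct N" by (induction k) auto
    finally show ?thesis using ct0[of N] by simp
  qed
  \<comment> \<open>Collects the initial segment, \<open>2\<close> for the terms \<open>E M\<close>
    and \<open>E 0\<close>, and the share \<open>1 + 1 + ct N\<close> of the two boundary terms of
    the Abel summation; what remains is \<open>ct M\<close> twice.\<close>
  define C where "C = norm (\<Sum>n=1..<N. E n) + 3 + ct N + 1"
  have bound: "norm (\<Sum>n=1..M. E n) \<le> C + 2 * (1 / (pi * w M))" if M: "M \<ge> Suc N" for M
  proof -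
    obtain k where k: "M = N + k" using M le_Suc_ex[of N M] by auto
    have "(\<Sum>n=1..M. E n) = (\<Sum>n=1..<N. E n) + (\<Sum>n=max 1 N..<N+k. E n) + E M"
    proof -
      have "{1..M} = insert M ({1..<N} \<union> {max 1 N..<N+k})" using M k by auto
      then show ?thesis using M k
        by (simp add: sum.union_disjoint)
    qed
    \<comment> \<open>Averages start at 1, so for \<open>N = 0\<close> the Abel sum has the
      additional term \<open>E 0\<close>.\<close>
    moreover have "(\<Sum>n=N..<N+k. E n) = (\<Sum>n=max 1 N..<N+k. E n) + (if N = 0 then E 0 else 0)"
    proof (cases "N = 0")
      case True
      then show ?thesis using M k sum.atLeast_Suc_lessThan[of 0 k E] by (simp add: add.commute)
    qed (auto simp: max_def)
    ultimately have "(\<Sum>n=1..M. E n) = (\<Sum>n=1..<N. E n) + (\<Sum>n=N..<N+k. E n) + (E M - (if N = 0 then E 0 else 0))"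
      by simp
    then have "norm (\<Sum>n=1..M. E n) \<le> norm (\<Sum>n=1..<N. E n) + norm (\<Sum>n=N..<N+k. E n) + 2"
      using nE[of M] nE[of 0] norm_triangle_ineq4[of "E M" "if N = 0 then E 0 else 0"]
        norm_triangle_ineq[of "(\<Sum>n=1..<N. E n) + (\<Sum>n=N..<N+k. E n)" "E M - (if N = 0 then E 0 else 0)"]
        norm_triangle_ineq[of "\<Sum>n=1..<N. E n" "\<Sum>n=N..<N+k. E n"]
      by (auto split: if_splits)
    moreover have "norm (\<Sum>n=N..<N+k. E n) \<le> norm (q (N+k) * E (N+k)) + norm (q N * E N) + ct (N+k)"
      unfolding abel using var[of k] by norm
    moreover have "norm (q (N+k) * E (N+k)) \<le> 1 + ct (N+k)" "norm (q N * E N) \<le> 1 + ct N"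
      using nq[of "N+k"] nq[of N] by (auto simp: norm_mult nE)
    moreover have "ct (N+k) \<le> 1 / (pi * w M)" using ctle[of M] M k by simp
    ultimately show ?thesis unfolding C_def by linarith
  qed
  have lim: "(\<lambda>M. C / real M + 2 / pi * inverse (real M * w M)) \<longlonglongrightarrow> 0"
  proof -
    have "(\<lambda>M. C / real M) \<longlonglongrightarrow> 0" by real_asymp
    moreover have "(\<lambda>M. 2 / pi * inverse (real M * w M)) \<longlonglongrightarrow> 2 / pi * 0"
      by (intro tendsto_mult tendsto_const tendsto_inverse_0_at_top winf)
    ultimately show ?thesis using tendsto_add by fastforce
  qed
  have "\<forall>\<^sub>F M in sequentially. norm (avg E M) \<le> C / real M + 2 / pi * inverse (real M * w M)"
  proof (rule eventually_sequentiallyI[of "Suc N"])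
    fix M assume M: "Suc N \<le> M"
    have "norm (avg E M) = norm (\<Sum>n=1..M. E n) / real M" by (simp add: avg_def field_simps)
    also have "\<dots> \<le> (C + 2 * (1 / (pi * w M))) / real M"
      by (intro divide_right_mono bound M) auto
    also have "\<dots> = C / real M + 2 / pi * inverse (real M * w M)"
      by (simp add: field_simps add_divide_distrib)
    finally show "norm (avg E M) \<le> C / real M + 2 / pi * inverse (real M * w M)" .
  qed
  then have "avg E \<longlonglongrightarrow> 0" using lim by (rule Lim_null_comparison)
  then show ?thesis unfolding E_def .
qed

section \<open>Finite differences\<close>

definition fdiff :: "(real \<Rightarrow> real) \<Rightarrow> real \<Rightarrow> real" where
  "fdiff f t = f (t + 1) - f t"

lemma fdiff_funpow_Suc: "(fdiff ^^ Suc n) f t = (fdiff ^^ n) f (t + 1) - (fdiff ^^ n) f t"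
  by (simp add: fdiff_def)

lemma fdiff_funpow_add:
  "(fdiff ^^ n) (\<lambda>t. f t + g t) t = (fdiff ^^ n) f t + (fdiff ^^ n) g t"
  by (induction n arbitrary: t) (simp_all add: fdiff_def algebra_simps)

lemma fdiff_funpow_cmult: "(fdiff ^^ n) (\<lambda>t. c * f t) t = c * (fdiff ^^ n) f t"
  by (induction n arbitrary: t) (simp_all add: fdiff_def algebra_simps)

lemma fdiff_funpow_sum:
  "finite J \<Longrightarrow> (fdiff ^^ n) (\<lambda>t. \<Sum>j\<in>J. f j t) t = (\<Sum>j\<in>J. (fdiff ^^ n) (f j) t)"
  by (induction n arbitrary: t) (simp_all add: fdiff_def sum_subtractf)

lemma fdiff_funpow_minus: "(fdiff ^^ n) (\<lambda>t. - f t) t = - (fdiff ^^ n) f t"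
  using fdiff_funpow_cmult[of n "-1" f t] by simp

lemma fdiff_funpow_shift: "(fdiff ^^ n) (\<lambda>t. f (t + h)) t = (fdiff ^^ n) f (t + h)"
  by (induction n arbitrary: t) (simp_all add: fdiff_def algebra_simps)

lemma fdiff_funpow_tendsto_0:
  assumes "(f \<longlongrightarrow> 0) at_top"
  shows "((fdiff ^^ n) f \<longlongrightarrow> 0) at_top"
proof (induction n)
  case (Suc n)
  have "((\<lambda>t. (fdiff ^^ n) f (t + 1)) \<longlongrightarrow> 0) at_top"
    by (rule filterlim_compose[OF Suc]) real_asymp
  from tendsto_diff[OF this Suc] show ?case by (simp add: fdiff_def[abs_def])
qed (use assms in simp)

section \<open>Hardy fields\<close>

lemma hardy_field_germ_cong:
  assumes "germ_of f \<in> H" "\<forall>\<^sub>F t in at_top. f t = g t"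
  shows "germ_of g \<in> H"
  using assms by (metis germ.abs_eq_iff)

lemma hardy_field_minus:
  assumes "hardy_field H" "germ_of f \<in> H"
  shows "germ_of (\<lambda>t. - f t) \<in> H"
proof -
  have "0 - germ_of f \<in> H" using assms unfolding hardy_field_def by blast
  then show ?thesis by (simp add: zero_germ_def minus_germ.abs_eq)
qed

lemma hardy_field_fdiff:
  assumes "hardy_field H" "germ_of f \<in> H"
  shows "germ_of (fdiff f) \<in> H"
proof -
  have "germ_of (\<lambda>t. f (t + 1)) - germ_of f \<in> H" using assms unfolding hardy_field_def by blast
  then show ?thesis by (simp add: minus_germ.abs_eq fdiff_def[abs_def])
qed

lemma hardy_field_fdiff_funpow:
  assumes "hardy_field H" "germ_of f \<in> H"
  shows "germ_of ((fdiff ^^ n) f) \<in> H"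
  by (induction n) (auto intro: hardy_field_fdiff assms)

text \<open>The product with the inverse germ is eventually 1, so a representative of a nonzero germ
  cannot have zeros arbitrarily far out.\<close>

lemma hardy_field_inverse:
  assumes "hardy_field H" "germ_of f \<in> H" "\<not> (\<forall>\<^sub>F t in at_top. f t = 0)"
  shows "germ_of (\<lambda>t. 1 / f t) \<in> H" "\<forall>\<^sub>F t in at_top. f t \<noteq> 0"
proof -
  have "germ_of f \<noteq> 0" using assms(3) by (simp add: zero_germ_def germ.abs_eq_iff)
  then obtain v where v: "v \<in> H" "germ_of f * v = 1" using assms unfolding hardy_field_def by blast
  obtain g where g: "v = germ_of g" using Quotient3_abs_rep[OF Quotient3_germ, of v] by metis
  have "\<forall>\<^sub>F t in at_top. f t * g t = 1"
    using v g by (simp add: times_germ.abs_eq one_germ_def germ.abs_eq_iff)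
  then have ev: "\<forall>\<^sub>F t in at_top. f t \<noteq> 0 \<and> g t = 1 / f t"
    by (rule eventually_mono) (metis mult_zero_left nonzero_mult_div_cancel_left zero_neq_one)
  then show "\<forall>\<^sub>F t in at_top. f t \<noteq> 0" by (rule eventually_mono) simp
  from ev have "\<forall>\<^sub>F t in at_top. g t = 1 / f t" by (rule eventually_mono) simp
  then show "germ_of (\<lambda>t. 1 / f t) \<in> H"
    using hardy_field_germ_cong[of g H "\<lambda>t. 1 / f t"] v g by simp
qed

lemma hardy_field_derivative:
  assumes "hardy_field H" "germ_of f \<in> H"
  obtains f' where "\<forall>\<^sub>F t in at_top. (f has_real_derivative f' t) (at t)" "germ_of f' \<in> H"
  using assms unfolding hardy_field_def by blast

text \<open>Far out, a function with nonzero germ is continuous without zeros, so the intermediate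
  value theorem rules out a change of sign.\<close>

lemma hardy_field_sign:
  assumes H: "hardy_field H" "germ_of f \<in> H"
  shows "(\<forall>\<^sub>F t in at_top. f t = 0) \<or> (\<forall>\<^sub>F t in at_top. f t > 0) \<or> (\<forall>\<^sub>F t in at_top. f t < 0)"
proof (cases "\<forall>\<^sub>F t in at_top. f t = 0")
  case False
  obtain f' where f': "\<forall>\<^sub>F t in at_top. (f has_real_derivative f' t) (at t)"
    using hardy_field_derivative[OF H] .
  from f' hardy_field_inverse(2)[OF H False]
  have "\<forall>\<^sub>F t in at_top. f t \<noteq> 0 \<and> (f has_real_derivative f' t) (at t)"
    by eventually_elim auto
  then obtain T where T: "\<And>t. t \<ge> T \<Longrightarrow> f t \<noteq> 0 \<and> (f has_real_derivative f' t) (at t)"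
    by (auto simp: eventually_at_top_linorder)
  have cont: "isCont f t" if "t \<ge> T" for t using T[OF that] DERIV_isCont by blast
  have same: "f t > 0 \<longleftrightarrow> f T > 0" if t: "t \<ge> T" for t
  proof (rule ccontr)
    assume ne: "\<not> ?thesis"
    have "\<exists>s\<ge>T. s \<le> t \<and> f s = 0"
    proof (cases "f T > 0")
      case True
      then have "f t \<le> 0" using ne by auto
      then show ?thesis using IVT2[of f t 0 T] t True cont by auto
    next
      case False
      then have "f t \<ge> 0" using ne by auto
      then show ?thesis using IVT[of f T 0 t] t False cont by auto
    qed
    then show False using T by auto
  qed
  show ?thesis
  proof (cases "f T > 0")
    case True
    then have "\<forall>t\<ge>T. f t > 0" using same by blast
    then show ?thesis by (auto simp: eventually_at_top_linorder)
  next
    case False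
    then have "f t < 0" if "t \<ge> T" for t using same[OF that] T[OF that] by linarith
    then show ?thesis by (auto simp: eventually_at_top_linorder)
  qed
qed simp

lemma hardy_field_mono:
  assumes H: "hardy_field H" "germ_of f \<in> H"
  obtains T where "(\<forall>s t. T \<le> s \<longrightarrow> s \<le> t \<longrightarrow> f s \<le> f t) \<or> (\<forall>s t. T \<le> s \<longrightarrow> s \<le> t \<longrightarrow> f t \<le> f s)"
proof -
  obtain f' where f': "\<forall>\<^sub>F t in at_top. (f has_real_derivative f' t) (at t)" "germ_of f' \<in> H"
    using hardy_field_derivative[OF H] .
  have "(\<forall>\<^sub>F t in at_top. f' t \<ge> 0) \<or> (\<forall>\<^sub>F t in at_top. f' t \<le> 0)"
    using hardy_field_sign[OF H(1) f'(2)]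
  proof (elim disjE)
    assume "\<forall>\<^sub>F t in at_top. f' t = 0"
    then show ?thesis by (intro disjI1) (erule eventually_mono, simp)
  next
    assume "\<forall>\<^sub>F t in at_top. f' t > 0"
    then show ?thesis by (intro disjI1) (erule eventually_mono, simp)
  next
    assume "\<forall>\<^sub>F t in at_top. f' t < 0"
    then show ?thesis by (intro disjI2) (erule eventually_mono, simp)
  qed
  then show ?thesis
  proof
    assume "\<forall>\<^sub>F t in at_top. f' t \<ge> 0"
    with f'(1) have "\<forall>\<^sub>F t in at_top. (f has_real_derivative f' t) (at t) \<and> f' t \<ge> 0"
      by eventually_elim auto
    then obtain T where T: "\<And>t. t \<ge> T \<Longrightarrow> (f has_real_derivative f' t) (at t) \<and> f' t \<ge> 0"
      by (auto simp: eventually_at_top_linorder)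
    have "f s \<le> f t" if "T \<le> s" "s \<le> t" for s t
      by (rule DERIV_nonneg_imp_nondecreasing[OF that(2)]) (meson T order_trans that(1))
    then show ?thesis using that by blast
  next
    assume "\<forall>\<^sub>F t in at_top. f' t \<le> 0"
    with f'(1) have "\<forall>\<^sub>F t in at_top. (f has_real_derivative f' t) (at t) \<and> f' t \<le> 0"
      by eventually_elim auto
    then obtain T where T: "\<And>t. t \<ge> T \<Longrightarrow> (f has_real_derivative f' t) (at t) \<and> f' t \<le> 0"
      by (auto simp: eventually_at_top_linorder)
    have "f t \<le> f s" if "T \<le> s" "s \<le> t" for s t
      by (rule DERIV_nonpos_imp_nonincreasing[OF that(2)]) (meson T order_trans that(1))
    then show ?thesis using that by blast
  qed
qed

text \<open>A real constant \<open>c\<close> need not lie in the field, so the sign of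
  \<open>f - c\<close> is not directly available; eventual monotonicity of \<open>f\<close> decides
  the comparison instead.\<close>

lemma hardy_field_compare_const:
  assumes H: "hardy_field H" "germ_of f \<in> H"
  shows "(\<forall>\<^sub>F t in at_top. f t \<le> c) \<or> (\<forall>\<^sub>F t in at_top. f t \<ge> c)"
proof -
  obtain T where "(\<forall>s t. T \<le> s \<longrightarrow> s \<le> t \<longrightarrow> f s \<le> f t) \<or> (\<forall>s t. T \<le> s \<longrightarrow> s \<le> t \<longrightarrow> f t \<le> f s)"
    using hardy_field_mono[OF H] .
  then show ?thesis
  proof
    assume m: "\<forall>s t. T \<le> s \<longrightarrow> s \<le> t \<longrightarrow> f s \<le> f t"
    show ?thesis
    proof (cases "\<forall>t\<ge>T. f t \<le> c")
      case False
      then obtain s where "s \<ge> T" "f s \<ge> c" by fastforce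
      then have "\<forall>t\<ge>s. f t \<ge> c" using m order_trans by blast
      then show ?thesis by (auto simp: eventually_at_top_linorder)
    qed (auto simp: eventually_at_top_linorder)
  next
    assume m: "\<forall>s t. T \<le> s \<longrightarrow> s \<le> t \<longrightarrow> f t \<le> f s"
    show ?thesis
    proof (cases "\<forall>t\<ge>T. f t \<ge> c")
      case False
      then obtain s where "s \<ge> T" "f s \<le> c" by fastforce
      then have "\<forall>t\<ge>s. f t \<le> c" using m order_trans by blast
      then show ?thesis by (auto simp: eventually_at_top_linorder)
    qed (auto simp: eventually_at_top_linorder)
  qed
qed

section \<open>Growth of functions with given differences\<close>

text \<open>Discrete integration; \<open>D\<close> is the constant of integration.\<close>

lemma eventually_le_of_diff_le:
  fixes u y :: "nat \<Rightarrow> real"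
  assumes "\<forall>\<^sub>F n in sequentially. u (Suc n) - u n \<le> y (Suc n) - y n"
  obtains D where "\<forall>\<^sub>F n in sequentially. u n \<le> y n + D"
proof -
  obtain N where N: "\<And>n. n \<ge> N \<Longrightarrow> u (Suc n) - u n \<le> y (Suc n) - y n"
    using assms by (auto simp: eventually_sequentially)
  have "u n \<le> y n + (u N - y N)" if "n \<ge> N" for n
    using that
  proof (induction n rule: dec_induct)
    case (step n) then show ?case using N[of n] by simp
  qed simp
  then show ?thesis using that by (auto simp: eventually_sequentially)
qed

lemma power_diff_le:
  "n \<ge> 1 \<Longrightarrow> real (Suc n) ^ Suc k - real n ^ Suc k \<le> (real (Suc k) * 2 ^ k) * real n ^ k"
proof -
  assume n: "n \<ge> 1"
  have "real (Suc n) ^ Suc k - real n ^ Suc k = (\<Sum>i<Suc k. real (Suc n) ^ i * real n ^ (k - i))"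
    by (subst power_diff_sumr2) (simp add: mult.commute)
  also have "\<dots> \<le> (\<Sum>i<Suc k. 2 ^ k * real n ^ k)"
  proof (rule sum_mono)
    fix i assume i: "i \<in> {..<Suc k}"
    have "real (Suc n) ^ i * real n ^ (k - i) \<le> (2 * real n) ^ i * real n ^ (k - i)"
      using n by (intro mult_right_mono power_mono) auto
    also have "\<dots> = 2 ^ i * (real n ^ i * real n ^ (k - i))" by (simp add: power_mult_distrib)
    also have "real n ^ i * real n ^ (k - i) = real n ^ k"
      using i by (simp add: power_add[symmetric])
    also have "2 ^ i * real n ^ k \<le> 2 ^ k * real n ^ k"
      using i by (intro mult_right_mono power_increasing) auto
    finally show "real (Suc n) ^ i * real n ^ (k - i) \<le> 2 ^ k * real n ^ k" .
  qed
  finally show ?thesis by simp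
qed

text \<open>The lower bound is summed \<open>k\<close> times: each summation raises the power of
  \<open>n\<close> by one, and halving the coefficient absorbs the constant of integration.\<close>

lemma lower_growth_of_fdiff:
  assumes "\<forall>\<^sub>F n in sequentially. c \<le> (fdiff ^^ k) f (real n)" "c > 0"
  shows "\<exists>c'>0. \<forall>\<^sub>F n in sequentially. c' * real n ^ k \<le> f (real n)"
  using assms
proof (induction k arbitrary: f c)
  case 0
  then show ?case by (intro exI[of _ c]) auto
next
  case (Suc k)
  from Suc.prems(1) have "\<forall>\<^sub>F n in sequentially. c \<le> (fdiff ^^ k) (fdiff f) (real n)"
    by (simp add: funpow_Suc_right del: funpow.simps)
  from Suc.IH[OF this Suc.prems(2)] obtain c1 where c1: "c1 > 0"
    "\<forall>\<^sub>F n in sequentially. c1 * real n ^ k \<le> fdiff f (real n)" by blast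
  \<comment> \<open>Chosen by \<open>power_diff_le\<close> so that \<open>c2 * n ^ Suc k\<close> has
    increments of at most \<open>c1 * n ^ k\<close>.\<close>
  define c2 where "c2 = c1 / (real (Suc k) * 2 ^ k)"
  have c2: "c2 > 0" using c1 by (simp add: c2_def)
  have "\<forall>\<^sub>F n in sequentially. c2 * real (Suc n) ^ Suc k - c2 * real n ^ Suc k \<le> f (real (Suc n)) - f (real n)"
    using c1(2) eventually_ge_at_top[of 1]
  proof eventually_elim
    case (elim n)
    have "c2 * real (Suc n) ^ Suc k - c2 * real n ^ Suc k = c2 * (real (Suc n) ^ Suc k - real n ^ Suc k)"
      by (simp add: right_diff_distrib)
    also have "\<dots> \<le> c2 * ((real (Suc k) * 2 ^ k) * real n ^ k)"
      using c2 elim(2) by (intro mult_left_mono power_diff_le) auto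
    also have "\<dots> = c1 * real n ^ k" by (simp add: c2_def)
    also have "\<dots> \<le> f (real (Suc n)) - f (real n)" using elim(1) by (simp add: fdiff_def add.commute)
    finally show ?case .
  qed
  then obtain D where D: "\<forall>\<^sub>F n in sequentially. c2 * real n ^ Suc k \<le> f (real n) + D"
    by (rule eventually_le_of_diff_le)
  have "filterlim (\<lambda>n. c2 / 2 * real n ^ Suc k) at_top sequentially"
    by (rule filterlim_tendsto_pos_mult_at_top[OF tendsto_const _ filterlim_pow_at_top])
      (use c2 in \<open>auto intro: filterlim_real_sequentially\<close>)
  then have "\<forall>\<^sub>F n in sequentially. D \<le> c2 / 2 * real n ^ Suc k"
    by (simp add: filterlim_at_top)
  with D have "\<forall>\<^sub>F n in sequentially. c2 / 2 * real n ^ Suc k \<le> f (real n)"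
    by eventually_elim auto
  then show ?case using c2 by (intro exI[of _ "c2/2"]) auto
qed

text \<open>Summing \<open>C / n\<close> once yields a logarithm, and each further summation a
  factor \<open>n\<close>. The result matches the lower growth condition on
  \<open>a\<close>.\<close>

lemma upper_growth_of_fdiff:
  assumes "\<forall>\<^sub>F n in sequentially. (fdiff ^^ Suc k) f (real n) \<le> C / real n" "C > 0"
  shows "\<exists>C'>0. \<forall>\<^sub>F n in sequentially. f (real n) \<le> C' * (real n ^ k * ln (real n))"
  using assms
proof (induction k arbitrary: f C)
  case 0
  \<comment> \<open>The factor 2 pays for \<open>1 / n \<le> 2 / (n + 1)\<close>, since the
    increment of the logarithm dominates \<open>1 / (n + 1)\<close>.\<close>
  have "\<forall>\<^sub>F n in sequentially. f (real (Suc n)) - f (real n) \<le> 2 * C * ln (real (Suc n)) - 2 * C * ln (real n)"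
    using 0(1) eventually_ge_at_top[of 1]
  proof eventually_elim
    case (elim n)
    have "1 - real n / real (Suc n) \<le> - ln (real n / real (Suc n))"
      using ln_le_minus_one[of "real n / real (Suc n)"] elim by auto
    also have "\<dots> = ln (real (Suc n)) - ln (real n)"
      using elim by (simp add: ln_div)
    finally have *: "1 / real (Suc n) \<le> ln (real (Suc n)) - ln (real n)"
      by (simp add: field_simps)
    have "f (real (Suc n)) - f (real n) \<le> C / real n" using elim(1) by (simp add: fdiff_def add.commute)
    also have "\<dots> \<le> 2 * C * (1 / real (Suc n))"
    proof -
      have "1 / real n \<le> 2 / real (Suc n)" using elim(2) by (simp add: field_simps)
      then have "C * (1 / real n) \<le> C * (2 / real (Suc n))" using 0(2) by (intro mult_left_mono) auto
      then show ?thesis by (simp add: mult.commute)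
    qed
    also have "\<dots> \<le> 2 * C * (ln (real (Suc n)) - ln (real n))"
      using * 0(2) by (intro mult_left_mono) auto
    finally show ?case by (simp add: algebra_simps)
  qed
  then obtain D where D: "\<forall>\<^sub>F n in sequentially. f (real n) \<le> 2 * C * ln (real n) + D"
    by (rule eventually_le_of_diff_le)
  have "\<forall>\<^sub>F n in sequentially. D \<le> ln (real n)"
    by real_asymp
  with D have "\<forall>\<^sub>F n in sequentially. f (real n) \<le> (2 * C + 1) * (real n ^ 0 * ln (real n))"
    by eventually_elim (simp add: algebra_simps)
  then show ?case using 0(2) by (intro exI[of _ "2 * C + 1"]) auto
next
  case (Suc k)
  from Suc.prems(1) have "\<forall>\<^sub>F n in sequentially. (fdiff ^^ Suc k) (fdiff f) (real n) \<le> C / real n"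
    by (simp add: funpow_Suc_right del: funpow.simps)
  from Suc.IH[OF this Suc.prems(2)] obtain C1 where C1: "C1 > 0"
    "\<forall>\<^sub>F n in sequentially. fdiff f (real n) \<le> C1 * (real n ^ k * ln (real n))" by blast
  let ?g = "\<lambda>n. real n ^ Suc k * ln (real n)"
  have "\<forall>\<^sub>F n in sequentially. f (real (Suc n)) - f (real n) \<le> C1 * ?g (Suc n) - C1 * ?g n"
    using C1(2) eventually_ge_at_top[of 1]
  proof eventually_elim
    case (elim n)
    \<comment> \<open>Splitting off one copy of \<open>n ^ k * ln n\<close> on the left leaves
      exactly \<open>?g n\<close>.\<close>
    have "(real n + 1) * real n ^ k * ln (real n) \<le> real (Suc n) ^ Suc k * ln (real (Suc n))"
      using elim(2) by (auto intro!: mult_mono power_mono)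
    then have "real n ^ k * ln (real n) \<le> ?g (Suc n) - ?g n" by (simp add: algebra_simps)
    then have "C1 * (real n ^ k * ln (real n)) \<le> C1 * (?g (Suc n) - ?g n)"
      using C1(1) by (intro mult_left_mono) auto
    then show ?case using elim(1) by (simp add: right_diff_distrib fdiff_def add.commute)
  qed
  then obtain D where D: "\<forall>\<^sub>F n in sequentially. f (real n) \<le> C1 * ?g n + D"
    by (rule eventually_le_of_diff_le)
  have "filterlim ?g at_top sequentially"
    by (intro filterlim_at_top_mult_at_top filterlim_pow_at_top filterlim_real_sequentially
        filterlim_compose[OF ln_at_top]) simp
  then have "\<forall>\<^sub>F n in sequentially. D \<le> ?g n" by (simp add: filterlim_at_top)
  with D have "\<forall>\<^sub>F n in sequentially. f (real n) \<le> (C1 + 1) * ?g n"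
    by eventually_elim (simp add: algebra_simps)
  then show ?case using C1(1) by (intro exI[of _ "C1 + 1"]) auto
qed

section \<open>What the growth of a function says about its differences\<close>

lemma growth_less_minus:
  "growth_less (\<lambda>t. - f t) g \<longleftrightarrow> growth_less f g" "growth_less f (\<lambda>t. - g t) \<longleftrightarrow> growth_less f g"
  using tendsto_minus_cancel_left[of "\<lambda>t. f t / g t" 0 at_top] unfolding growth_less_def by auto

lemma growth_less_fdiff_not_ge:
  assumes "growth_less a (\<lambda>t. t ^ k)" "e > 0"
  shows "\<not> (\<forall>\<^sub>F t in at_top. (fdiff ^^ k) a t \<ge> e)"
proof
  assume "\<forall>\<^sub>F t in at_top. (fdiff ^^ k) a t \<ge> e"
  then have "\<forall>\<^sub>F n in sequentially. e \<le> (fdiff ^^ k) a (real n)"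
    by (rule eventually_compose_filterlim) (rule filterlim_real_sequentially)
  from lower_growth_of_fdiff[OF this assms(2)] obtain c where c: "c > 0"
    "\<forall>\<^sub>F n in sequentially. c * real n ^ k \<le> a (real n)" by blast
  have "(\<lambda>n. a (real n) / real n ^ k) \<longlonglongrightarrow> 0"
    using filterlim_compose[OF _ filterlim_real_sequentially] assms(1) unfolding growth_less_def by fast
  then have "\<forall>\<^sub>F n in sequentially. a (real n) / real n ^ k < c"
    using c(1) by (rule order_tendstoD)
  with c(2) eventually_ge_at_top[of 1] have "\<forall>\<^sub>F n::nat in sequentially. False"
    by eventually_elim (auto simp: field_simps)
  then show False by simp
qed

text \<open>Monotonicity in the field decides the comparisons with \<open>e/2\<close> and
  \<open>-(e/2)\<close>, and the unwanted outcome would force growth of order \<open>t ^ k\<close>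
  on \<open>a\<close> or \<open>- a\<close>.\<close>

lemma hardy_fdiff_tendsto_0:
  assumes H: "hardy_field H" "germ_of a \<in> H" and g: "growth_less a (\<lambda>t. t ^ k)"
  shows "((fdiff ^^ k) a \<longlongrightarrow> 0) at_top"
proof (rule tendstoI)
  fix e :: real assume e: "e > 0"
  have 1: "\<forall>\<^sub>F t in at_top. (fdiff ^^ k) a t \<le> e/2"
    using hardy_field_compare_const[OF H(1) hardy_field_fdiff_funpow[OF H], of k "e/2"]
      growth_less_fdiff_not_ge[OF g, of "e/2"] e by auto
  have "\<not> (\<forall>\<^sub>F t in at_top. (fdiff ^^ k) (\<lambda>t. - a t) t \<ge> e/2)"
    using growth_less_fdiff_not_ge[of "\<lambda>t. - a t" k "e/2"] g e by (simp add: growth_less_minus)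
  then have "\<not> (\<forall>\<^sub>F t in at_top. (fdiff ^^ k) a t \<le> - (e/2))"
    unfolding fdiff_funpow_minus by (auto simp: le_minus_iff)
  then have 2: "\<forall>\<^sub>F t in at_top. (fdiff ^^ k) a t \<ge> - (e/2)"
    using hardy_field_compare_const[OF H(1) hardy_field_fdiff_funpow[OF H], of k "-(e/2)"] by auto
  from 1 2 show "\<forall>\<^sub>F t in at_top. dist ((fdiff ^^ k) a t) 0 < e"
    by eventually_elim (use e in auto)
qed

text \<open>If the difference of order \<open>d + 1\<close> were \<open>O(1/n)\<close>, summation
  for \<open>a\<close> and for \<open>- a\<close> would make \<open>\<bar>a n\<bar>\<close> at most
  a multiple of \<open>n ^ d * ln n\<close>.\<close>

lemma growth_less_fdiff_not_le:
  assumes "growth_less (\<lambda>t. t ^ d * ln t) a" "C > 0"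
  shows "\<not> (\<forall>\<^sub>F n in sequentially. \<bar>(fdiff ^^ Suc d) a (real n)\<bar> \<le> C / real n)"
proof
  assume A: "\<forall>\<^sub>F n in sequentially. \<bar>(fdiff ^^ Suc d) a (real n)\<bar> \<le> C / real n"
  have "\<forall>\<^sub>F n in sequentially. (fdiff ^^ Suc d) a (real n) \<le> C / real n"
    using A by (rule eventually_mono) auto
  from upper_growth_of_fdiff[OF this assms(2)] obtain C1 where C1: "C1 > 0"
    "\<forall>\<^sub>F n in sequentially. a (real n) \<le> C1 * (real n ^ d * ln (real n))" by blast
  have "\<forall>\<^sub>F n in sequentially. (fdiff ^^ Suc d) (\<lambda>t. - a t) (real n) \<le> C / real n"
    unfolding fdiff_funpow_minus using A by (rule eventually_mono) auto
  from upper_growth_of_fdiff[OF this assms(2)] obtain C2 where C2: "C2 > 0"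
    "\<forall>\<^sub>F n in sequentially. - a (real n) \<le> C2 * (real n ^ d * ln (real n))" by blast
  have "(\<lambda>n. real n ^ d * ln (real n) / a (real n)) \<longlonglongrightarrow> 0"
    using filterlim_compose[OF _ filterlim_real_sequentially] assms(1) unfolding growth_less_def by fast
  then have "(\<lambda>n. norm (real n ^ d * ln (real n) / a (real n))) \<longlonglongrightarrow> 0"
    by (rule tendsto_norm_zero)
  then have 3: "\<forall>\<^sub>F n in sequentially. norm (real n ^ d * ln (real n) / a (real n)) < 1 / (C1 + C2)"
    using C1(1) C2(1) by (intro order_tendstoD) auto
  have 4: "\<forall>\<^sub>F n in sequentially. a (real n) \<noteq> 0"
    using assms(1) eventually_compose_filterlim[OF _ filterlim_real_sequentially]
    unfolding growth_less_def by blast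
  from C1(2) C2(2) 3 4 eventually_ge_at_top[of 2] have "\<forall>\<^sub>F n::nat in sequentially. False"
  proof eventually_elim
    case (elim n)
    define g where "g = real n ^ d * ln (real n)"
    have g: "g > 0" unfolding g_def using elim(5) by (intro mult_pos_pos) auto
    have "\<bar>a (real n)\<bar> \<le> (C1 + C2) * g"
      using elim(1,2)[folded g_def] mult_pos_pos[OF C1(1) g] mult_pos_pos[OF C2(1) g]
      by (auto simp: abs_le_iff distrib_right)
    moreover have "g * (C1 + C2) < \<bar>a (real n)\<bar>"
      using elim(3)[folded g_def] elim(4) g C1(1) C2(1) by (simp add: abs_div field_simps)
    ultimately show False by (simp add: mult.commute)
  qed
  then show False by simp
qed

text \<open>The identity function need not belong to the Hardy field, so \<open>t * W t\<close> is not accessible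
  directly; instead compare the differences of \<open>1 / W\<close> with constants.\<close>

lemma hardy_fdiff_at_top:
  assumes H: "hardy_field H" "germ_of a \<in> H" and g: "growth_less (\<lambda>t. t ^ d * ln t) a"
    and pos: "\<forall>\<^sub>F t in at_top. (fdiff ^^ Suc d) a t > 0"
  shows "filterlim (\<lambda>n. real n * (fdiff ^^ Suc d) a (real n)) at_top sequentially"
  unfolding filterlim_at_top_gt[where c = 0]
proof (intro allI impI)
  fix Z :: real assume Z: "Z > 0"
  define W where "W = (fdiff ^^ Suc d) a"
  define z where "z t = 1 / W t" for t
  \<comment> \<open>With this slope, \<open>1 / W n \<le> e * n + D \<le> 2 * e * n = n / Z\<close>
    far out, which is the claim.\<close>
  define e where "e = 1 / (2 * Z)"
  have e: "e > 0" using Z by (simp add: e_def)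
  have nz: "\<not> (\<forall>\<^sub>F t in at_top. W t = 0)"
  proof
    assume "\<forall>\<^sub>F t in at_top. W t = 0"
    with pos have "\<forall>\<^sub>F t::real in at_top. False" unfolding W_def by eventually_elim auto
    then show False by simp
  qed
  have WH: "germ_of W \<in> H" unfolding W_def by (rule hardy_field_fdiff_funpow[OF H])
  have zH: "germ_of (fdiff z) \<in> H"
    using hardy_field_fdiff[OF H(1) hardy_field_inverse(1)[OF H(1) WH nz]] by (simp add: z_def[abs_def])
  have posn: "\<forall>\<^sub>F n in sequentially. W (real n) > 0"
    using pos unfolding W_def by (rule eventually_compose_filterlim) (rule filterlim_real_sequentially)
  \<comment> \<open>Otherwise \<open>1 / W\<close> would grow at least linearly and
    \<open>W n\<close> would be \<open>O(1/n)\<close>.\<close>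
  have "\<not> (\<forall>\<^sub>F t in at_top. fdiff z t \<ge> e)"
  proof
    assume "\<forall>\<^sub>F t in at_top. fdiff z t \<ge> e"
    then have "\<forall>\<^sub>F n in sequentially. e \<le> (fdiff ^^ 1) z (real n)"
      unfolding One_nat_def funpow.simps o_def id_def
      by (rule eventually_compose_filterlim) (rule filterlim_real_sequentially)
    from lower_growth_of_fdiff[OF this e] obtain c where c: "c > 0"
      "\<forall>\<^sub>F n in sequentially. c * real n ^ 1 \<le> z (real n)" by blast
    from c(2) posn eventually_ge_at_top[of 1]
    have "\<forall>\<^sub>F n in sequentially. \<bar>(fdiff ^^ Suc d) a (real n)\<bar> \<le> (1 / c) / real n"
      unfolding W_def[symmetric]
      by eventually_elim (use c(1) in \<open>auto simp: z_def field_simps\<close>)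
    then show False using growth_less_fdiff_not_le[OF g, of "1/c"] c(1) by simp
  qed
  then have "\<forall>\<^sub>F t in at_top. fdiff z t \<le> e"
    using hardy_field_compare_const[OF H(1) zH, of e] by blast
  then have "\<forall>\<^sub>F n in sequentially. fdiff z (real n) \<le> e"
    by (rule eventually_compose_filterlim) (rule filterlim_real_sequentially)
  then have "\<forall>\<^sub>F n in sequentially. z (real (Suc n)) - z (real n) \<le> e * real (Suc n) - e * real n"
    by (rule eventually_mono) (simp add: fdiff_def algebra_simps)
  then obtain D where D: "\<forall>\<^sub>F n in sequentially. z (real n) \<le> e * real n + D"
    by (rule eventually_le_of_diff_le)
  have "filterlim (\<lambda>n. e * real n) at_top sequentially" using e by real_asymp
  then have "\<forall>\<^sub>F n in sequentially. D \<le> e * real n" by (simp add: filterlim_at_top)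
  with D posn eventually_ge_at_top[of 1] have "\<forall>\<^sub>F n in sequentially. Z \<le> real n * W (real n)"
  proof eventually_elim
    case (elim n)
    have "1 / W (real n) \<le> 2 * e * real n" using elim by (simp add: z_def)
    then have "1 \<le> real n / Z * W (real n)" using elim(2) by (simp add: e_def field_simps)
    then show ?case using Z by (simp add: field_simps)
  qed
  then show "\<forall>\<^sub>F n in sequentially. Z \<le> real n * (fdiff ^^ Suc d) a (real n)"
    unfolding W_def .
qed

section \<open>Exponential sums\<close>

lemma tendsto_cis_diff:
  assumes "((\<lambda>t. u t - v t) \<longlongrightarrow> 0) F"
  shows "((\<lambda>t. cis (2 * pi * u t) - cis (2 * pi * v t)) \<longlongrightarrow> 0) F"
proof -
  have "((\<lambda>t. cis (2 * pi * (u t - v t)) - 1) \<longlongrightarrow> cis (2 * pi * 0) - 1) F"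
    by (intro tendsto_intros isCont_tendsto_compose[OF _ assms]) auto
  then have "((\<lambda>t. norm (cis (2 * pi * (u t - v t)) - 1)) \<longlongrightarrow> 0) F"
    by (intro tendsto_norm_zero) simp
  moreover have "norm (cis (2 * pi * (u t - v t)) - 1) = norm (cis (2 * pi * u t) - cis (2 * pi * v t))" for t
  proof -
    have "cis (2 * pi * u t) - cis (2 * pi * v t) = cis (2 * pi * v t) * (cis (2 * pi * (u t - v t)) - 1)"
      by (simp add: right_diff_distrib cis_mult)
    then show ?thesis by (simp add: norm_mult)
  qed
  ultimately show ?thesis by (simp add: tendsto_norm_zero_iff)
qed

lemma avg_cis_uminus:
  assumes "avg (\<lambda>m. cis (2 * pi * u m)) \<longlonglongrightarrow> 0"
  shows "avg (\<lambda>m. cis (2 * pi * (- u m))) \<longlonglongrightarrow> 0"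
  using tendsto_cnj[OF assms]
  by (simp add: avg_linear[OF bounded_linear_cnj, symmetric] cis_cnj)

lemma avg_cis_hardy_pos:
  assumes H: "hardy_field H" "germ_of a \<in> H"
    and g: "growth_less (\<lambda>t. t ^ d * ln t) a" "growth_less a (\<lambda>t. t ^ (d + 1))"
    and pos: "\<forall>\<^sub>F t in at_top. (fdiff ^^ Suc d) a t > 0" and c: "c \<noteq> 0"
  shows "avg (\<lambda>m. cis (2 * pi * (c * (fdiff ^^ d) a (real m)))) \<longlonglongrightarrow> 0"
proof -
  define W where "W = (fdiff ^^ Suc d) a"
  have W0: "(W \<longlongrightarrow> 0) at_top"
    unfolding W_def using hardy_fdiff_tendsto_0[OF H g(2)] by simp
  have WH: "germ_of W \<in> H" unfolding W_def by (rule hardy_field_fdiff_funpow[OF H])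
  obtain T where T: "(\<forall>s t. T \<le> s \<longrightarrow> s \<le> t \<longrightarrow> W s \<le> W t) \<or> (\<forall>s t. T \<le> s \<longrightarrow> s \<le> t \<longrightarrow> W t \<le> W s)"
    using hardy_field_mono[OF H(1) WH] .
  obtain T2 where T2: "\<And>t. t \<ge> T2 \<Longrightarrow> W t > 0"
    using pos by (auto simp: W_def eventually_at_top_linorder)
  \<comment> \<open>A positive function that tends to 0 cannot be eventually nondecreasing.\<close>
  have anti: "\<forall>s t. T \<le> s \<longrightarrow> s \<le> t \<longrightarrow> W t \<le> W s"
  proof (rule ccontr)
    assume "\<not> ?thesis"
    then have m: "\<forall>s t. T \<le> s \<longrightarrow> s \<le> t \<longrightarrow> W s \<le> W t" using T by blast
    define s where "s = max T T2"
    have "\<forall>\<^sub>F t in at_top. W t < W s"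
      using order_tendstoD(2)[OF W0, of "W s"] T2[of s] by (simp add: s_def)
    moreover have "\<forall>\<^sub>F t in at_top. W s \<le> W t"
      using eventually_ge_at_top[of s] by eventually_elim (use m in \<open>auto simp: s_def\<close>)
    ultimately have "\<forall>\<^sub>F t::real in at_top. False" by eventually_elim auto
    then show False by simp
  qed
  have Wn: "\<forall>\<^sub>F n in sequentially. W (real n) > 0"
    using pos unfolding W_def by (rule eventually_compose_filterlim) (rule filterlim_real_sequentially)
  have Wanti: "\<forall>\<^sub>F n in sequentially. W (real (Suc n)) \<le> W (real n)"
  proof -
    have "\<forall>\<^sub>F n in sequentially. T \<le> real n"
      by (rule eventually_compose_filterlim[OF eventually_ge_at_top filterlim_real_sequentially])
    then show ?thesis by (rule eventually_mono) (use anti in auto)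
  qed
  have pos_c: "avg (\<lambda>m. cis (2 * pi * (c * (fdiff ^^ d) a (real m)))) \<longlonglongrightarrow> 0" if c: "c > 0" for c
  proof -
    have eq: "c * (fdiff ^^ d) a (real (Suc n)) - c * (fdiff ^^ d) a (real n) = c * W (real n)" for n
      by (simp add: W_def fdiff_def algebra_simps)
    show ?thesis
    proof (rule avg_cis_fejer, unfold eq)
      show "\<forall>\<^sub>F n in sequentially. 0 < c * W (real n)"
        using Wn by (rule eventually_mono) (use c in simp)
      show "\<forall>\<^sub>F n in sequentially. c * W (real (Suc n)) \<le> c * W (real n)"
        using Wanti by (rule eventually_mono) (use c in simp)
      show "(\<lambda>n. c * W (real n)) \<longlonglongrightarrow> 0"
        by (rule tendsto_mult_right_zero) (rule filterlim_compose[OF W0 filterlim_real_sequentially])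
      have "filterlim (\<lambda>n. c * (real n * W (real n))) at_top sequentially"
        using hardy_fdiff_at_top[OF H g(1) pos] c unfolding W_def
        by (intro filterlim_tendsto_pos_mult_at_top[OF tendsto_const]) auto
      then show "filterlim (\<lambda>n. real n * (c * W (real n))) at_top sequentially"
        by (simp add: mult.left_commute)
    qed
  qed
  show ?thesis
  proof (cases "c > 0")
    case False
    then have "avg (\<lambda>m. cis (2 * pi * (- c * (fdiff ^^ d) a (real m)))) \<longlonglongrightarrow> 0"
      using c by (intro pos_c) auto
    from avg_cis_uminus[OF this] show ?thesis by simp
  qed (rule pos_c)
qed

text \<open>Vanishing of \<open>(fdiff ^^ Suc d) a\<close> is excluded by the lower growth of
  \<open>a\<close>, and the negative case is the positive one for \<open>- a\<close> and
  \<open>- c\<close>.\<close>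

lemma avg_cis_hardy:
  assumes H: "hardy_field H" "germ_of a \<in> H"
    and g: "growth_less (\<lambda>t. t ^ d * ln t) a" "growth_less a (\<lambda>t. t ^ (d + 1))"
    and c: "c \<noteq> 0"
  shows "avg (\<lambda>m. cis (2 * pi * (c * (fdiff ^^ d) a (real m)))) \<longlonglongrightarrow> 0"
  using hardy_field_sign[OF H(1) hardy_field_fdiff_funpow[OF H], of "Suc d"]
proof (elim disjE)
  assume "\<forall>\<^sub>F t in at_top. (fdiff ^^ Suc d) a t = 0"
  then have "\<forall>\<^sub>F n in sequentially. (fdiff ^^ Suc d) a (real n) = 0"
    by (rule eventually_compose_filterlim) (rule filterlim_real_sequentially)
  then have "\<forall>\<^sub>F n in sequentially. \<bar>(fdiff ^^ Suc d) a (real n)\<bar> \<le> 1 / real n"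
    by (rule eventually_mono) simp
  then show ?thesis using growth_less_fdiff_not_le[OF g(1), of 1] by simp
next
  assume "\<forall>\<^sub>F t in at_top. (fdiff ^^ Suc d) a t > 0"
  then show ?thesis by (rule avg_cis_hardy_pos[OF H g _ c])
next
  assume "\<forall>\<^sub>F t in at_top. (fdiff ^^ Suc d) a t < 0"
  then have "\<forall>\<^sub>F t in at_top. (fdiff ^^ Suc d) (\<lambda>t. - a t) t > 0"
    unfolding fdiff_funpow_minus by simp
  from avg_cis_hardy_pos[OF H(1) hardy_field_minus[OF H] _ _ this, of "- c"]
  show ?thesis using g c by (simp add: growth_less_minus fdiff_funpow_minus)
qed

text \<open>The induction runs over arbitrary functions \<open>u\<close>, since combinations with
  real coefficients need not lie in the Hardy field. A van der Corput step with lag \<open>h\<close>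
  replaces \<open>u\<close> by \<open>u (t + h) - u t\<close> and the leading coefficient
  \<open>c\<close> by \<open>c * h\<close>. Hence the base case for every nonzero coefficient, and
  the assumption that \<open>V\<close> varies slowly.\<close>

lemma avg_cis_fdiff_induct:
  assumes V: "(fdiff V \<longlongrightarrow> 0) at_top"
    and base: "\<And>c. c \<noteq> 0 \<Longrightarrow> avg (\<lambda>m. cis (2 * pi * (c * V (real m)))) \<longlonglongrightarrow> 0"
    and "c \<noteq> 0" "((\<lambda>t. (fdiff ^^ n) u t - c * V t) \<longlongrightarrow> 0) at_top"
  shows "avg (\<lambda>m. cis (2 * pi * u (real m))) \<longlonglongrightarrow> 0"
  using assms(3,4)
proof (induction n arbitrary: u c)
  case 0
  have "((\<lambda>t. c * V t - u t) \<longlongrightarrow> 0) at_top"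
    using tendsto_minus[OF 0(2)] by simp
  then have "(\<lambda>m. c * V (real m) - u (real m)) \<longlonglongrightarrow> 0"
    by (rule filterlim_compose) (rule filterlim_real_sequentially)
  from avg_cong_tendsto[OF tendsto_cis_diff[OF this] base[OF 0(1)]] show ?case .
next
  case (Suc n)
  note prems = Suc.prems and IH = Suc.IH
  define g where "g = (fdiff ^^ n) u"
  have sh: "filterlim (\<lambda>t::real. t + real h) at_top at_top" for h by real_asymp
  have Vsh: "((\<lambda>t. V (t + real h) - V t) \<longlongrightarrow> 0) at_top" for h
  proof (induction h)
    case (Suc h)
    from tendsto_add[OF filterlim_compose[OF V sh[of h]] Suc]
    show ?case by (simp add: fdiff_def algebra_simps)
  qed simp
  \<comment> \<open>A sum of \<open>h\<close> unit steps, each close to some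
    \<open>c * V (t + i)\<close> and so to \<open>c * V t\<close>.\<close>
  have gsh: "((\<lambda>t. g (t + real h) - g t - c * real h * V t) \<longlongrightarrow> 0) at_top" for h
  proof (induction h)
    case (Suc h)
    have "((\<lambda>t. g (t + real h + 1) - g (t + real h) - c * V (t + real h)) \<longlongrightarrow> 0) at_top"
      using filterlim_compose[OF prems(2) sh[of h]]
      by (simp add: g_def fdiff_funpow_Suc del: funpow.simps)
    from tendsto_add[OF tendsto_add[OF this Suc] tendsto_mult_right_zero[OF Vsh[of h], of c]]
    show ?case by (simp add: algebra_simps)
  qed simp
  show ?case
  proof (rule van_der_corput)
    fix h :: nat assume h: "h \<ge> 1"
    have "(fdiff ^^ n) (\<lambda>t. u (t + real h) - u t) t = g (t + real h) - g t" for t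
      using fdiff_funpow_add[of n "\<lambda>t. u (t + real h)" "\<lambda>t. - u t" t]
      by (simp add: g_def fdiff_funpow_minus fdiff_funpow_shift)
    then have "avg (\<lambda>m. cis (2 * pi * (u (real m + real h) - u (real m)))) \<longlonglongrightarrow> 0"
      using IH[of "c * real h" "\<lambda>t. u (t + real h) - u t"] gsh[of h] prems(1) h by simp
    then show "avg (\<lambda>m. cis (2 * pi * u (real (m + h))) * cnj (cis (2 * pi * u (real m)))) \<longlonglongrightarrow> 0"
      by (simp add: cis_cnj cis_mult right_diff_distrib)
  qed simp
qed

text \<open>The lowest index \<open>i0\<close> with a nonzero coefficient decides: after
  \<open>d - i0\<close> further differences its term is \<open>c i0 * (fdiff ^^ d) a\<close>, while
  the later terms have order above \<open>d\<close> and tend to 0.\<close>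

lemma avg_cis_fdiff_combination:
  assumes H: "hardy_field H" "germ_of a \<in> H"
    and g: "growth_less (\<lambda>t. t ^ d * ln t) a" "growth_less a (\<lambda>t. t ^ (d + 1))"
    and c: "i \<le> d" "c i \<noteq> 0"
  shows "avg (\<lambda>m. cis (2 * pi * (\<Sum>j\<le>d. c j * (fdiff ^^ j) a (real m)))) \<longlonglongrightarrow> 0"
proof -
  have W0: "((fdiff ^^ Suc d) a \<longlongrightarrow> 0) at_top"
    using hardy_fdiff_tendsto_0[OF H g(2)] by simp
  have high: "((fdiff ^^ k) a \<longlongrightarrow> 0) at_top" if "k > d" for k
  proof -
    have "k = (k - Suc d) + Suc d" using that by simp
    then show ?thesis using fdiff_funpow_tendsto_0[OF W0, of "k - Suc d"] by (metis comp_apply funpow_add)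
  qed
  define i0 where "i0 = (LEAST i. c i \<noteq> 0)"
  have "i0 \<le> i" unfolding i0_def by (rule Least_le) (rule c(2))
  then have i0: "i0 \<le> d" "c i0 \<noteq> 0" "\<And>j. j < i0 \<Longrightarrow> c j = 0"
    using c(1) LeastI[of "\<lambda>i. c i \<noteq> 0", OF c(2)] not_less_Least[of _ "\<lambda>i. c i \<noteq> 0"]
    unfolding i0_def[symmetric] by (linarith, blast, blast)
  define u where "u = (\<lambda>t. \<Sum>j\<le>d. c j * (fdiff ^^ j) a t)"
  have "(fdiff ^^ (d - i0)) u t = (\<Sum>j\<le>d. c j * (fdiff ^^ (d - i0 + j)) a t)" for t
    unfolding u_def fdiff_funpow_sum[OF finite_atMost] fdiff_funpow_cmult funpow_add by simp
  also have "(\<Sum>j\<le>d. c j * (fdiff ^^ (d - i0 + j)) a t)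
      = c i0 * (fdiff ^^ d) a t + (\<Sum>j\<in>{..d} - {i0}. c j * (fdiff ^^ (d - i0 + j)) a t)" for t
    using i0(1) by (subst sum.remove[of _ i0]) auto
  finally have eq: "(fdiff ^^ (d - i0)) u t - c i0 * (fdiff ^^ d) a t
      = (\<Sum>j\<in>{..d} - {i0}. c j * (fdiff ^^ (d - i0 + j)) a t)" for t by simp
  have "((\<lambda>t. (\<Sum>j\<in>{..d} - {i0}. c j * (fdiff ^^ (d - i0 + j)) a t)) \<longlongrightarrow> (\<Sum>j\<in>{..d} - {i0}. 0)) at_top"
  proof (rule tendsto_sum)
    fix j assume j: "j \<in> {..d} - {i0}"
    show "((\<lambda>t. c j * (fdiff ^^ (d - i0 + j)) a t) \<longlongrightarrow> 0) at_top"
    proof (cases "j < i0")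
      case False
      then have "d - i0 + j > d" using j i0(1) by auto
      then show ?thesis using high by (intro tendsto_mult_right_zero) auto
    qed (simp add: i0(3))
  qed
  then have "((\<lambda>t. (fdiff ^^ (d - i0)) u t - c i0 * (fdiff ^^ d) a t) \<longlongrightarrow> 0) at_top"
    unfolding eq by simp
  from avg_cis_fdiff_induct[OF _ avg_cis_hardy[OF H g] i0(2) this] W0
  show ?thesis by (simp add: u_def)
qed

section \<open>Newton's formula up to a null sequence\<close>

lemma gbinomial_Suc_int:
  "(of_int (k + 1) gchoose Suc j :: real) = (of_int k gchoose j) + (of_int k gchoose Suc j)"
  by (simp only: of_int_add of_int_1 gbinomial_Suc_Suc)

text \<open>Pascal's rule is run in both directions, because negative times \<open>k\<close> occur
  as well. Integrality is what makes \<open>skew_pos\<close> well defined modulo 1.\<close>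

lemma gbinomial_int_in_Ints: "(of_int k gchoose j :: real) \<in> \<int>"
proof (induction k arbitrary: j rule: int_induct[where k = 0])
  case base
  then show ?case by (simp add: gbinomial_0_left)
next
  case (step1 k)
  then show ?case by (cases j) (simp_all only: gbinomial_Suc_int Ints_add gbinomial_0 Ints_1)
next
  case (step2 k)
  show ?case
  proof (induction j)
    case (Suc j)
    have "(of_int (k - 1) gchoose Suc j :: real) = (of_int k gchoose Suc j) - (of_int (k - 1) gchoose j)"
      using gbinomial_Suc_int[of "k - 1" j] by simp
    then show ?case using Suc step2 by (simp only: Ints_diff)
  qed simp
qed

text \<open>Going from \<open>k\<close> to \<open>k + 1\<close> changes the remainder for
  \<open>u\<close> by the remainder for \<open>fdiff u\<close> with one term less, which is null by
  induction on \<open>n\<close>. The step can be taken forwards and backwards from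
  \<open>k = 0\<close>.\<close>

lemma newton_tendsto:
  assumes "((fdiff ^^ n) u \<longlongrightarrow> 0) at_top"
  shows "((\<lambda>t. u (t + of_int k) - (\<Sum>j<n. (of_int k gchoose j) * (fdiff ^^ j) u t)) \<longlongrightarrow> 0) at_top"
  using assms
proof (induction n arbitrary: u k)
  case 0
  have "filterlim (\<lambda>t::real. t + of_int k) at_top at_top" by real_asymp
  then show ?case using filterlim_compose[of u "nhds 0" at_top] 0 by simp
next
  case (Suc n)
  define r where "r k t = u (t + of_int k) - (\<Sum>j<Suc n. (of_int k gchoose j) * (fdiff ^^ j) u t)" for k t
  have "((fdiff ^^ n) (fdiff u) \<longlongrightarrow> 0) at_top"
    using Suc.prems by (simp add: funpow_Suc_right del: funpow.simps)
  note IH = Suc.IH[OF this]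
  have diff: "r (k + 1) t - r k t
      = fdiff u (t + of_int k) - (\<Sum>j<n. (of_int k gchoose j) * (fdiff ^^ j) (fdiff u) t)" for k t
  proof -
    have e: "(\<Sum>j<Suc n. (of_int k gchoose j) * (fdiff ^^ j) u t)
        = u t + (\<Sum>j<n. (of_int k gchoose Suc j) * (fdiff ^^ j) (fdiff u) t)" for k
      by (subst sum.lessThan_Suc_shift) (simp add: funpow_Suc_right del: funpow.simps)
    show ?thesis
      unfolding r_def e gbinomial_Suc_int by (simp add: fdiff_def distrib_right sum.distrib algebra_simps)
  qed
  have step: "((\<lambda>t. r (k + 1) t - r k t) \<longlongrightarrow> 0) at_top" for k
    unfolding diff by (rule IH)
  have "(r k \<longlongrightarrow> 0) at_top" for k
  proof (induction k rule: int_induct[where k = 0])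
    case base
    have "(\<Sum>j<Suc n. (of_int 0 gchoose j) * (fdiff ^^ j) u t) = u t" for t
      by (subst sum.lessThan_Suc_shift) (simp add: gbinomial_0_left)
    then show ?case by (simp add: r_def[abs_def])
  next
    case (step1 k)
    from tendsto_add[OF step[of k] step1(2)] show ?case by simp
  next
    case (step2 k)
    from tendsto_diff[OF step2(2) step[of "k - 1"]] show ?case by simp
  qed
  then show ?case by (simp only: r_def[abs_def])
qed

section \<open>Trigonometric approximation on the torus\<close>

text \<open>Points are pairs of unreduced real coordinate sequences; a character only sees the
  coordinates up to \<open>d\<close>, and these modulo 1.\<close>

definition torus_char :: "nat \<Rightarrow> (nat \<Rightarrow> int) \<Rightarrow> (nat \<Rightarrow> int) \<Rightarrow> (nat \<Rightarrow> real) \<times> (nat \<Rightarrow> real) \<Rightarrow> complex" where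
  "torus_char d l l' p =
     cis (2 * pi * (\<Sum>i\<le>d. of_int (l i) * fst p i + of_int (l' i) * snd p i))"

inductive_set trig_poly :: "nat \<Rightarrow> ((nat \<Rightarrow> real) \<times> (nat \<Rightarrow> real) \<Rightarrow> complex) set" for d where
  char: "(\<lambda>p. c * torus_char d l l' p) \<in> trig_poly d"
| add: "f \<in> trig_poly d \<Longrightarrow> g \<in> trig_poly d \<Longrightarrow> (\<lambda>p. f p + g p) \<in> trig_poly d"

lemma norm_torus_char [simp]: "norm (torus_char d l l' p) = 1"
  by (simp add: torus_char_def)

lemma torus_char_mult:
  "torus_char d l l' p * torus_char d m m' p = torus_char d (\<lambda>i. l i + m i) (\<lambda>i. l' i + m' i) p"
  unfolding torus_char_def cis_mult distrib_left[symmetric] sum.distrib[symmetric]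
  by (simp add: algebra_simps)

lemma cnj_torus_char: "cnj (torus_char d l l' p) = torus_char d (\<lambda>i. - l i) (\<lambda>i. - l' i) p"
proof -
  have "- (2 * pi * (\<Sum>i\<le>d. of_int (l i) * fst p i + of_int (l' i) * snd p i))
      = 2 * pi * (\<Sum>i\<le>d. of_int (- l i) * fst p i + of_int (- l' i) * snd p i)"
    unfolding mult_minus_right[symmetric] sum_negf[symmetric] by (simp add: algebra_simps)
  then show ?thesis unfolding torus_char_def cis_cnj by (rule arg_cong)
qed

lemma trig_poly_const: "(\<lambda>_. c) \<in> trig_poly d"
  using trig_poly.char[of c d "\<lambda>_. 0" "\<lambda>_. 0"] by (simp add: torus_char_def)

lemma trig_poly_mult:
  assumes "f \<in> trig_poly d" "g \<in> trig_poly d"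
  shows "(\<lambda>p. f p * g p) \<in> trig_poly d"
  using assms
proof (induction rule: trig_poly.induct)
  case (char c l l')
  from char show ?case
  proof (induction rule: trig_poly.induct)
    case (char e m m')
    have "(\<lambda>p. c * torus_char d l l' p * (e * torus_char d m m' p))
        = (\<lambda>p. (c * e) * torus_char d (\<lambda>i. l i + m i) (\<lambda>i. l' i + m' i) p)"
      by (simp add: torus_char_mult[symmetric] mult_ac)
    then show ?case by (simp only: trig_poly.char)
  next
    case (add f g)
    from trig_poly.add[OF add.IH] show ?case by (simp add: algebra_simps)
  qed
next
  case (add f1 f2)
  from trig_poly.add[OF add.IH[OF add.prems]] show ?case by (simp add: algebra_simps)
qed

lemma trig_poly_Re_char: "(\<lambda>p. complex_of_real (Re (torus_char d l l' p))) \<in> trig_poly d"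
proof -
  have "(\<lambda>p. 1/2 * torus_char d l l' p + 1/2 * torus_char d (\<lambda>i. - l i) (\<lambda>i. - l' i) p) \<in> trig_poly d"
    by (intro trig_poly.intros)
  moreover have "1/2 * z + 1/2 * cnj z = complex_of_real (Re z)" for z
    by (simp add: complex_eq_iff)
  ultimately show ?thesis by (simp only: cnj_torus_char[symmetric])
qed

lemma trig_poly_Im_char: "(\<lambda>p. complex_of_real (Im (torus_char d l l' p))) \<in> trig_poly d"
proof -
  have "(\<lambda>p. (- \<i>/2) * torus_char d l l' p + \<i>/2 * torus_char d (\<lambda>i. - l i) (\<lambda>i. - l' i) p) \<in> trig_poly d"
    by (intro trig_poly.intros)
  moreover have "(- \<i>/2) * z + \<i>/2 * cnj z = complex_of_real (Im z)" for z
    by (simp add: complex_eq_iff)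
  ultimately show ?thesis by (simp only: cnj_torus_char[symmetric])
qed

lemma torus_char_fst:
  "i \<le> d \<Longrightarrow> torus_char d (\<lambda>j. if j = i then 1 else 0) (\<lambda>_. 0) p = cis (2 * pi * fst p i)"
proof -
  assume i: "i \<le> d"
  have "(\<Sum>j\<le>d. of_int (if j = i then 1 else 0) * fst p j + of_int 0 * snd p j)
      = (\<Sum>j\<le>d. if j = i then fst p j else 0)"
    by (intro sum.cong) auto
  then show ?thesis using i by (simp add: torus_char_def)
qed

lemma torus_char_snd:
  "i \<le> d \<Longrightarrow> torus_char d (\<lambda>_. 0) (\<lambda>j. if j = i then 1 else 0) p = cis (2 * pi * snd p i)"
proof -
  assume i: "i \<le> d"
  have "(\<Sum>j\<le>d. of_int 0 * fst p j + of_int (if j = i then 1 else 0) * snd p j)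
      = (\<Sum>j\<le>d. if j = i then snd p j else 0)"
    by (intro sum.cong) auto
  then show ?thesis using i by (simp add: torus_char_def)
qed

lemma cis_eq_iff_Ints: "cis (2 * pi * x) = cis (2 * pi * y) \<longleftrightarrow> x - y \<in> \<int>"
proof -
  have "cis (2 * pi * x) = cis (2 * pi * y) \<longleftrightarrow> cis (2 * pi * (x - y)) = 1"
  proof -
    have "cis (2 * pi * (x - y)) = cis (2 * pi * x) / cis (2 * pi * y)"
      by (simp add: cis_divide right_diff_distrib)
    then show ?thesis by simp
  qed
  also have "\<dots> \<longleftrightarrow> cos (2 * pi * (x - y)) = 1"
    using cos_one_sin_zero[of "2 * pi * (x - y)"] by (auto simp: complex_eq_iff)
  also have "\<dots> \<longleftrightarrow> (\<exists>n::int. 2 * pi * (x - y) = of_int n * 2 * pi)"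
    by (rule cos_one_2pi_int)
  also have "\<dots> \<longleftrightarrow> x - y \<in> \<int>"
    by (auto simp: Ints_def)
  finally show ?thesis .
qed

section \<open>Stone-Weierstrass on the torus\<close>

lemma compact_fun:
  fixes S :: "'b::topological_space set"
  assumes "compact S"
  shows "compact {x :: 'a \<Rightarrow> 'b. \<forall>i. x i \<in> S}"
proof -
  have "compactin (product_topology (\<lambda>_. euclidean) UNIV) (PiE (UNIV :: 'a set) (\<lambda>_. S))"
    using assms by (simp add: compactin_PiE)
  moreover have "PiE (UNIV :: 'a set) (\<lambda>_. S) = {x. \<forall>i. x i \<in> S}" by auto
  ultimately show ?thesis by (simp add: euclidean_product_topology)
qed

lemma continuous_on_fst_coord [continuous_intros]:
  "continuous_on S (\<lambda>p. fst p i :: 'b::topological_space)"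
  by (rule continuous_on_product_then_coordinatewise) (intro continuous_intros)

lemma continuous_on_snd_coord [continuous_intros]:
  "continuous_on S (\<lambda>p. snd p i :: 'b::topological_space)"
  by (rule continuous_on_product_then_coordinatewise) (intro continuous_intros)

text \<open>\<open>G\<close> factors through the map \<open>q\<close> onto a compact set of tuples
  of points on the unit circle, where Stone-Weierstrass applies; coordinate functions pull back to
  real and imaginary parts of characters.\<close>

lemma trig_poly_approximation:
  fixes G :: "(nat \<Rightarrow> real) \<times> (nat \<Rightarrow> real) \<Rightarrow> real"
  assumes cont: "continuous_on UNIV G"
    and per: "\<And>p p'. (\<And>i. i \<le> d \<Longrightarrow> fst p i - fst p' i \<in> \<int> \<and> snd p i - snd p' i \<in> \<int>) \<Longrightarrow> G p = G p'"
    and e: "e > 0"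
  obtains P where "(\<lambda>p. complex_of_real (P p)) \<in> trig_poly d" "\<And>p. \<bar>G p - P p\<bar> < e"
proof -
  \<comment> \<open>The value 1 erases the coordinates beyond \<open>d\<close>, on which
    \<open>G\<close> does not depend by \<open>per\<close>.\<close>
  define q :: "(nat \<Rightarrow> real) \<times> (nat \<Rightarrow> real) \<Rightarrow> (nat \<Rightarrow> complex) \<times> (nat \<Rightarrow> complex)" where
    "q p = (\<lambda>i. if i \<le> d then cis (2 * pi * fst p i) else 1, \<lambda>i. if i \<le> d then cis (2 * pi * snd p i) else 1)" for p
  define K :: "((nat \<Rightarrow> real) \<times> (nat \<Rightarrow> real)) set" where
    "K = {x. \<forall>i. x i \<in> {0..1}} \<times> {x. \<forall>i. x i \<in> {0..1}}"
  define S where "S = q ` K"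
  have K: "compact K" unfolding K_def by (intro compact_Times compact_fun compact_Icc)
  have q: "continuous_on T q" for T
  proof -
    have "continuous_on T (\<lambda>p. if i \<le> d then cis (2 * pi * fst p i) else 1)"
      "continuous_on T (\<lambda>p. if i \<le> d then cis (2 * pi * snd p i) else 1)" for i
      by (cases "i \<le> d"; simp; intro continuous_intros)+
    then show ?thesis
      unfolding q_def by (intro continuous_on_Pair continuous_on_coordinatewise_then_product)
  qed
  have S: "compact S" unfolding S_def by (intro compact_continuous_image q K)
  have qG: "G p = G p'" if "q p = q p'" for p p'
    using that by (intro per) (auto simp: q_def fun_eq_iff cis_eq_iff_Ints[symmetric] split: if_splits)
  have qK: "\<exists>k\<in>K. q k = q p" for p
  proof (intro bexI)
    show "(\<lambda>i. frac (fst p i), \<lambda>i. frac (snd p i)) \<in> K"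
      by (auto simp: K_def frac_lt_1 less_imp_le)
    show "q (\<lambda>i. frac (fst p i), \<lambda>i. frac (snd p i)) = q p"
      by (auto simp: q_def fun_eq_iff cis_eq_iff_Ints frac_def)
  qed
  then have qS: "q p \<in> S" for p unfolding S_def by (metis imageI)
  define g where "g z = G (SOME p. q p = z)" for z
  have g: "g (q p) = G p" for p
    unfolding g_def by (rule qG) (rule someI, rule refl)
  \<comment> \<open>\<open>q\<close> acts as a quotient map: the preimage of a closed set under
    \<open>g\<close> is the image of a compact part of the cube \<open>K\<close>.\<close>
  have gcont: "continuous_on S g"
    unfolding continuous_on_closed_vimage[OF compact_imp_closed[OF S]]
  proof (intro allI impI)
    fix B :: "real set" assume B: "closed B"
    have "g -` B \<inter> S = q ` (K \<inter> G -` B)" by (auto simp: S_def g)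
    moreover have "closed (G -` B)"
      using cont B by (simp add: continuous_on_closed_vimage)
    then have "compact (q ` (K \<inter> G -` B))"
      by (intro compact_continuous_image q compact_Int_closed K)
    ultimately show "closed (g -` B \<inter> S)" by (simp add: compact_imp_closed)
  qed
  \<comment> \<open>Membership asks for a trigonometric pullback, so the approximant from
    Stone-Weierstrass already yields the polynomial.\<close>
  define R where "R = {r. continuous_on S r \<and> (\<lambda>p. complex_of_real (r (q p))) \<in> trig_poly d}"
  interpret function_ring_on R S
  proof
    show "compact S" by (rule S)
    show "continuous_on S f" if "f \<in> R" for f using that by (simp add: R_def)
    show "(\<lambda>x. f x + g x) \<in> R" if "f \<in> R" "g \<in> R" for f g
      using that trig_poly.add[of "\<lambda>p. complex_of_real (f (q p))" d "\<lambda>p. complex_of_real (g (q p))"]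
      by (auto simp: R_def intro!: continuous_intros)
    show "(\<lambda>x. f x * g x) \<in> R" if "f \<in> R" "g \<in> R" for f g
      using that trig_poly_mult[of "\<lambda>p. complex_of_real (f (q p))" d "\<lambda>p. complex_of_real (g (q p))"]
      by (auto simp: R_def intro!: continuous_intros)
    show "(\<lambda>_. c) \<in> R" for c by (simp add: R_def trig_poly_const)
    show "\<exists>f\<in>R. f z \<noteq> f w" if zw: "z \<in> S" "w \<in> S" "z \<noteq> w" for z w
    proof -
      have fstR: "(\<lambda>z. Re (fst z i)) \<in> R" "(\<lambda>z. Im (fst z i)) \<in> R" if "i \<le> d" for i
        using that trig_poly_Re_char[of d "\<lambda>j. if j = i then 1 else 0" "\<lambda>_. 0"]
          trig_poly_Im_char[of d "\<lambda>j. if j = i then 1 else 0" "\<lambda>_. 0"]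
        unfolding R_def torus_char_fst[OF that]
        by (auto simp: q_def intro!: continuous_intros)
      have sndR: "(\<lambda>z. Re (snd z i)) \<in> R" "(\<lambda>z. Im (snd z i)) \<in> R" if "i \<le> d" for i
        using that trig_poly_Re_char[of d "\<lambda>_. 0" "\<lambda>j. if j = i then 1 else 0"]
          trig_poly_Im_char[of d "\<lambda>_. 0" "\<lambda>j. if j = i then 1 else 0"]
        unfolding R_def torus_char_snd[OF that]
        by (auto simp: q_def intro!: continuous_intros)
      obtain i where "fst z i \<noteq> fst w i \<or> snd z i \<noteq> snd w i"
        using zw(3) by (metis ext prod_eqI)
      moreover from this have "i \<le> d" using zw(1,2) by (auto simp: S_def q_def split: if_splits)
      ultimately show ?thesis
        using fstR sndR by (metis complex_eq_iff)
    qed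
  qed
  obtain r where r: "r \<in> R" "\<And>z. z \<in> S \<Longrightarrow> \<bar>g z - r z\<bar> < e"
    using Stone_Weierstrass_basic[OF gcont e] by blast
  show ?thesis
  proof (rule that)
    show "(\<lambda>p. complex_of_real (r (q p))) \<in> trig_poly d" using r(1) by (simp add: R_def)
    show "\<bar>G p - r (q p)\<bar> < e" for p using r(2)[OF qS[of p]] by (simp add: g)
  qed
qed

lemma trig_poly_bounded:
  assumes "f \<in> trig_poly d"
  obtains B where "\<And>p. norm (f p) \<le> B"
proof -
  from assms have "\<exists>B. \<forall>p. norm (f p) \<le> B"
  proof (induction rule: trig_poly.induct)
    case (char c l l')
    show ?case by (rule exI[of _ "norm c"]) (simp add: norm_mult)
  next
    case (add f g)
    then obtain B C where "\<forall>p. norm (f p) \<le> B" "\<forall>p. norm (g p) \<le> C" by blast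
    then show ?case
      by (intro exI[of _ "B + C"]) (metis add_mono norm_triangle_le)
  qed
  then show ?thesis using that by blast
qed

section \<open>Weyl's criterion\<close>

text \<open>For trigonometric polynomials the limit is read off the characters, and uniform
  approximation of \<open>G\<close> costs \<open>e/3\<close> on each side. The points
  \<open>X m\<close> need no reduction modulo 1, since \<open>G\<close> and the characters are
  periodic.\<close>

lemma weyl_equidistribution:
  fixes M :: "((nat \<Rightarrow> real) \<times> (nat \<Rightarrow> real)) measure" and X :: "nat \<Rightarrow> (nat \<Rightarrow> real) \<times> (nat \<Rightarrow> real)"
    and G :: "(nat \<Rightarrow> real) \<times> (nat \<Rightarrow> real) \<Rightarrow> real"
  assumes "prob_space M"
    and meas: "\<And>i. i \<le> d \<Longrightarrow> (\<lambda>p. fst p i) \<in> borel_measurable M"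
      "\<And>i. i \<le> d \<Longrightarrow> (\<lambda>p. snd p i) \<in> borel_measurable M"
    and weyl: "\<And>l l' i. i \<le> d \<Longrightarrow> l i \<noteq> 0 \<or> l' i \<noteq> 0 \<Longrightarrow> avg (\<lambda>m. torus_char d l l' (X m)) \<longlonglongrightarrow> 0"
    and int0: "\<And>l l' i. i \<le> d \<Longrightarrow> l i \<noteq> 0 \<or> l' i \<noteq> 0 \<Longrightarrow> (\<integral>p. torus_char d l l' p \<partial>M) = 0"
    and cont: "continuous_on UNIV G" and G: "G \<in> borel_measurable M"
    and per: "\<And>p p'. (\<And>i. i \<le> d \<Longrightarrow> fst p i - fst p' i \<in> \<int> \<and> snd p i - snd p' i \<in> \<int>) \<Longrightarrow> G p = G p'"
  shows "avg (\<lambda>m. G (X m)) \<longlonglongrightarrow> (\<integral>p. G p \<partial>M)"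
proof -
  interpret prob_space M by fact
  have char_meas: "torus_char d l l' \<in> borel_measurable M" for l l'
  proof -
    have "(\<lambda>p. \<Sum>i\<le>d. of_int (l i) * fst p i + of_int (l' i) * snd p i) \<in> borel_measurable M"
      by (intro borel_measurable_sum borel_measurable_add borel_measurable_times borel_measurable_const meas) auto
    moreover have "cis \<in> borel_measurable borel"
      by (intro borel_measurable_continuous_onI continuous_on_cis continuous_intros)
    ultimately show ?thesis unfolding torus_char_def[abs_def] by measurable
  qed
  have trig: "integrable M f \<and> avg (\<lambda>m. f (X m)) \<longlonglongrightarrow> (\<integral>p. f p \<partial>M)" if "f \<in> trig_poly d" for f
    using that
  proof (induction rule: trig_poly.induct)
    case (char c l l')
    have i: "integrable M (torus_char d l l')"
      by (rule integrable_const_bound[of _ 1]) (auto intro: char_meas)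
    have "avg (\<lambda>m. torus_char d l l' (X m)) \<longlonglongrightarrow> (\<integral>p. torus_char d l l' p \<partial>M)"
    proof (cases "\<exists>i\<le>d. l i \<noteq> 0 \<or> l' i \<noteq> 0")
      case True
      then show ?thesis using weyl int0 by metis
    next
      case False
      then have "torus_char d l l' = (\<lambda>_. 1)" by (auto simp: torus_char_def fun_eq_iff)
      then show ?thesis by (simp add: tendsto_avg_const prob_space)
    qed
    then show ?case using i by (auto simp: avg_mult_left intro!: tendsto_mult)
  next
    case (add f g)
    then show ?case by (auto simp: avg_add intro!: tendsto_add)
  qed
  show ?thesis
  proof (rule LIMSEQ_I)
    fix e :: real assume e: "e > 0"
    obtain P where P: "(\<lambda>p. complex_of_real (P p)) \<in> trig_poly d" "\<And>p. \<bar>G p - P p\<bar> < e/3"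
      by (rule trig_poly_approximation[OF cont, of d "e/3"]) (use per e in auto)
    obtain B where B: "\<And>p. norm (complex_of_real (P p)) \<le> B" using trig_poly_bounded[OF P(1)] by blast
    have Pi: "integrable M P"
      using integrable_Re[OF conjunct1[OF trig[OF P(1)]]] by simp
    have "norm (G p) \<le> B + e/3" for p using P(2)[of p] B[of p] by (simp add: abs_if split: if_splits)
    then have Gi: "integrable M G" by (intro integrable_const_bound[of _ "B + e/3"] G) auto
    have "(\<lambda>M. Re (avg (\<lambda>m. complex_of_real (P (X m))) M)) \<longlonglongrightarrow> Re (\<integral>p. complex_of_real (P p) \<partial>M)"
      by (intro tendsto_Re conjunct2[OF trig[OF P(1)]])
    then have "avg (\<lambda>m. P (X m)) \<longlonglongrightarrow> (\<integral>p. P p \<partial>M)"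
      by (simp add: avg_linear[OF bounded_linear_Re, symmetric])
    from LIMSEQ_D[OF this, of "e/3"] obtain N where N: "\<And>n. n \<ge> N \<Longrightarrow> norm (avg (\<lambda>m. P (X m)) n - (\<integral>p. P p \<partial>M)) < e/3"
      using e by auto
    show "\<exists>no. \<forall>n\<ge>no. norm (avg (\<lambda>m. G (X m)) n - (\<integral>p. G p \<partial>M)) < e"
    proof (intro exI allI impI)
      fix n assume n: "n \<ge> max 1 N"
      have "norm (avg (\<lambda>m. G (X m)) n - avg (\<lambda>m. P (X m)) n) \<le> avg (\<lambda>m. norm (G (X m) - P (X m))) n"
        unfolding avg_diff[symmetric] by (rule norm_avg_le)
      also have "\<dots> \<le> avg (\<lambda>m. e/3) n"
        by (rule avg_mono) (use P(2) in \<open>auto simp: less_imp_le\<close>)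
      finally have 1: "norm (avg (\<lambda>m. G (X m)) n - avg (\<lambda>m. P (X m)) n) \<le> e/3"
        using n by (simp add: avg_const)
      have "norm ((\<integral>p. P p \<partial>M) - (\<integral>p. G p \<partial>M)) \<le> (\<integral>p. norm (P p - G p) \<partial>M)"
        unfolding Bochner_Integration.integral_diff[OF Pi Gi, symmetric] by (rule integral_norm_bound)
      also have "\<dots> \<le> (\<integral>p. e/3 \<partial>M)"
        using Pi Gi P(2) by (intro integral_mono) (auto simp: abs_minus_commute less_imp_le)
      finally have 2: "norm ((\<integral>p. P p \<partial>M) - (\<integral>p. G p \<partial>M)) \<le> e/3" by (simp add: prob_space)
      show "norm (avg (\<lambda>m. G (X m)) n - (\<integral>p. G p \<partial>M)) < e"
        using 1 2 N[of n] n by (auto simp: abs_if split: if_splits)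
    qed
  qed
qed

section \<open>Haar measure on the circle and the torus\<close>

lemma space_circle_haar [simp]: "space circle_haar = {0..<1}"
  by (simp add: circle_haar_def space_restrict_space)

lemma sets_circle_haar: "sets circle_haar = sets (restrict_space borel {0..<1})"
  unfolding circle_haar_def by (rule sets_restrict_space_cong) simp

lemma emeasure_circle_haar:
  assumes "A \<in> sets circle_haar"
  shows "emeasure circle_haar A = emeasure lborel A"
  using assms unfolding circle_haar_def
  by (intro emeasure_restrict_space) (auto simp: sets_restrict_space)

lemma in_sets_circle_haar: "A \<in> sets circle_haar \<longleftrightarrow> A \<in> sets borel \<and> A \<subseteq> {0..<1}"
  by (auto simp: sets_circle_haar sets_restrict_space_iff)

lemma prob_space_circle_haar: "prob_space circle_haar"
proof
  have "{0..<1::real} \<in> sets circle_haar" by (simp add: in_sets_circle_haar)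
  then show "emeasure circle_haar (space circle_haar) = 1"
    by (simp add: emeasure_circle_haar)
qed

interpretation circle: prob_space circle_haar by (rule prob_space_circle_haar)

lemma measurable_circle_haar_borel:
  "f \<in> measurable borel N \<Longrightarrow> f \<in> measurable circle_haar N"
  using measurable_restrict_space1[of f borel N "{0..<1}"]
  by (subst measurable_cong_sets[OF sets_circle_haar refl])

lemma measurable_into_circle_haar:
  assumes "f \<in> borel_measurable N" "\<And>x. x \<in> space N \<Longrightarrow> f x \<in> {0..<1}"
  shows "f \<in> measurable N circle_haar"
  using measurable_restrict_space2[of f N "{0..<1}" borel] assms
  by (subst measurable_cong_sets[OF refl sets_circle_haar]) auto

lemma borel_measurable_frac [measurable]: "frac \<in> borel_measurable (borel :: real measure)"
  unfolding frac_def[abs_def] by measurable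

lemma measurable_frac_circle_haar:
  "f \<in> borel_measurable N \<Longrightarrow> (\<lambda>x. frac (f x)) \<in> measurable N circle_haar"
  by (rule measurable_into_circle_haar) (auto simp: frac_lt_1 intro: measurable_compose[OF _ borel_measurable_frac])

lemma measurable_circle_coord [measurable]: "(\<lambda>x. x) \<in> borel_measurable circle_haar"
  by (rule measurable_circle_haar_borel) simp

lemma emeasure_lborel_vimage_add:
  fixes B :: "real set"
  assumes "B \<in> sets borel"
  shows "emeasure lborel ((\<lambda>x. x + c) -` B) = emeasure lborel B"
proof -
  have "emeasure lborel B = emeasure (distr lborel borel ((+) c)) B"
    by (simp add: lborel_distr_plus)
  also have "\<dots> = emeasure lborel ((+) c -` B)"
    using assms by (subst emeasure_distr) auto
  also have "(+) c = (\<lambda>x. x + c)" by (simp add: fun_eq_iff)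
  finally show ?thesis by simp
qed

text \<open>Cutting \<open>A\<close> at \<open>t = frac s\<close> makes its preimage a union of two
  disjoint translates, and translation invariance of Lebesgue measure applies to each.\<close>

lemma distr_circle_haar_translate:
  "distr circle_haar circle_haar (\<lambda>x. frac (x + s)) = circle_haar"
proof (rule measure_eqI)
  have meas: "(\<lambda>x. frac (x + s)) \<in> measurable circle_haar circle_haar"
    by (rule measurable_frac_circle_haar) (rule measurable_circle_haar_borel, simp)
  fix A assume "A \<in> sets (distr circle_haar circle_haar (\<lambda>x. frac (x + s)))"
  then have A: "A \<in> sets circle_haar" by simp
  then have Ab: "A \<in> sets borel" "A \<subseteq> {0..<1}" by (auto simp: in_sets_circle_haar)
  define t where "t = frac s"
  have t: "0 \<le> t" "t < 1" by (auto simp: t_def frac_lt_1)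
  define A1 A2 where "A1 = A \<inter> {t..<1}" and "A2 = A \<inter> {0..<t}"
  have Am: "A1 \<in> sets borel" "A2 \<in> sets borel" using Ab by (auto simp: A1_def A2_def)
  have fr: "frac (x + s) = (if x < 1 - t then x + t else x + (t - 1))" if "0 \<le> x" "x < 1" for x
  proof -
    have "frac (x + s) = frac (x + t)"
      by (simp add: t_def frac_add_simps)
    also have "\<dots> = (if x < 1 - t then x + t else x + (t - 1))"
      using that t by (auto simp: frac_unique_iff intro!: frac_unique_iff[THEN iffD2])
    finally show ?thesis .
  qed
  let ?P1 = "(\<lambda>x. x + t) -` A1" and ?P2 = "(\<lambda>x. x + (t - 1)) -` A2"
  have pre: "(\<lambda>x. frac (x + s)) -` A \<inter> space circle_haar = ?P1 \<union> ?P2"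
  proof (rule set_eqI)
    fix x
    show "x \<in> (\<lambda>x. frac (x + s)) -` A \<inter> space circle_haar \<longleftrightarrow> x \<in> ?P1 \<union> ?P2"
      using fr[of x] Ab t by (auto simp: A1_def A2_def subset_iff split: if_splits)
  qed
  have Pm: "?P1 \<in> sets borel" "?P2 \<in> sets borel"
    using measurable_sets_borel[of "\<lambda>x. x + t" borel A1] measurable_sets_borel[of "\<lambda>x. x + (t - 1)" borel A2] Am
    by auto
  have "emeasure (distr circle_haar circle_haar (\<lambda>x. frac (x + s))) A = emeasure circle_haar (?P1 \<union> ?P2)"
    using meas A pre by (simp add: emeasure_distr)
  also have "\<dots> = emeasure lborel (?P1 \<union> ?P2)"
    using measurable_sets[OF meas A] pre by (intro emeasure_circle_haar) simp
  also have "\<dots> = emeasure lborel ?P1 + emeasure lborel ?P2"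
    using Pm by (intro plus_emeasure[symmetric]) (auto simp: A1_def A2_def)
  also have "\<dots> = emeasure lborel A1 + emeasure lborel A2"
    using Am by (simp add: emeasure_lborel_vimage_add)
  also have "\<dots> = emeasure lborel (A1 \<union> A2)"
    using Am by (intro plus_emeasure) (auto simp: A1_def A2_def)
  also have "A1 \<union> A2 = A" using Ab(2) by (auto simp: A1_def A2_def)
  also have "emeasure lborel A = emeasure circle_haar A" using A by (simp add: emeasure_circle_haar)
  finally show "emeasure (distr circle_haar circle_haar (\<lambda>x. frac (x + s))) A = emeasure circle_haar A" .
qed simp

lemma periodic1_add_int: "periodic1 f \<Longrightarrow> f (x + of_int n) = f x"
proof (induction n arbitrary: x rule: int_induct[where k = 0])
  case (step1 n)
  then show ?case unfolding periodic1_def by (metis add.assoc of_int_1 of_int_add)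
next
  case (step2 n)
  have "f (x + of_int (n - 1)) = f (x + of_int (n - 1) + 1)" using step2(3) unfolding periodic1_def by metis
  then show ?case using step2 by simp
qed simp

lemma periodic1_Ints: "periodic1 f \<Longrightarrow> x - y \<in> \<int> \<Longrightarrow> f x = f y"
  using periodic1_add_int[of f y] by (metis Ints_cases add_diff_cancel_left' add.commute diff_add_cancel)

lemma periodic1_frac: "periodic1 f \<Longrightarrow> f (frac x) = f x"
  by (rule periodic1_Ints) (simp_all add: frac_def)

lemma circle_integral_translate:
  fixes g :: "real \<Rightarrow> 'b::{banach, second_countable_topology}"
  assumes "periodic1 g" "g \<in> borel_measurable borel"
  shows "(\<integral>x. g (x + s) \<partial>circle_haar) = (\<integral>x. g x \<partial>circle_haar)"
proof -
  have meas: "(\<lambda>x. frac (x + s)) \<in> measurable circle_haar circle_haar"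
    by (rule measurable_frac_circle_haar) (rule measurable_circle_haar_borel, simp)
  have "(\<integral>x. g x \<partial>circle_haar) = (\<integral>x. g x \<partial>(distr circle_haar circle_haar (\<lambda>x. frac (x + s))))"
    by (simp add: distr_circle_haar_translate)
  also have "\<dots> = (\<integral>x. g (frac (x + s)) \<partial>circle_haar)"
    by (rule integral_distr[OF meas]) (rule measurable_circle_haar_borel[OF assms(2)])
  also have "\<dots> = (\<integral>x. g (x + s) \<partial>circle_haar)"
    by (simp add: periodic1_frac[OF assms(1)])
  finally show ?thesis by simp
qed

lemma borel_measurable_cis [measurable]: "cis \<in> borel_measurable borel"
  by (intro borel_measurable_continuous_onI continuous_intros)

text \<open>Translation by \<open>1 / (2 * n)\<close> reverses the sign of the integrand, so the
  integral is its own negative.\<close>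

lemma circle_integral_cis:
  assumes "n \<noteq> 0"
  shows "(\<integral>x. cis (2 * pi * (of_int n * x)) \<partial>circle_haar) = 0"
proof -
  let ?g = "\<lambda>x. cis (2 * pi * (of_int n * x))"
  have "?g (x + 1) = ?g x" for x
    by (subst cis_eq_iff_Ints) (simp add: algebra_simps)
  then have "(\<integral>x. ?g (x + 1 / (2 * of_int n)) \<partial>circle_haar) = (\<integral>x. ?g x \<partial>circle_haar)"
    by (intro circle_integral_translate) (auto simp: periodic1_def)
  moreover have "?g (x + 1 / (2 * of_int n)) = - ?g x" for x
  proof -
    have "2 * pi * (of_int n * (x + 1 / (2 * of_int n))) = 2 * pi * (of_int n * x) + pi"
      using assms by (simp add: field_simps)
    then show ?thesis by (simp add: cis_mult[symmetric])
  qed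
  ultimately show ?thesis by simp
qed

section \<open>Haar measure on products of circles\<close>

interpretation torus: product_prob_space "\<lambda>_::nat. circle_haar" I for I
  by standard

lemma prob_space_torus_haar: "prob_space (torus_haar k)"
  unfolding torus_haar_def by (rule torus.prob_space_axioms)

lemma measurable_torus_coord:
  assumes "i < k"
  shows "(\<lambda>x. x i) \<in> measurable (torus_haar k) circle_haar"
  unfolding torus_haar_def using assms by (intro measurable_component_singleton) simp

lemma measurable_torus_coord_borel:
  "i < k \<Longrightarrow> (\<lambda>x. x i) \<in> borel_measurable (torus_haar k)"
  by (rule measurable_compose[OF measurable_torus_coord measurable_circle_coord])

text \<open>Compares the product sigma-algebra with the Borel sets of the full function space, so
  that functions continuous there can be integrated over the torus.\<close>

lemma borel_measurable_torus_id: "(\<lambda>x. x) \<in> borel_measurable (torus_haar k)"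
proof (rule measurable_coordinatewise_then_product)
  fix i
  show "(\<lambda>x. x i) \<in> borel_measurable (torus_haar k)"
  proof (cases "i < k")
    case False
    \<comment> \<open>Points of the product are extensional: coordinates from \<open>k\<close> on
      have the constant value \<open>undefined\<close>.\<close>
    have "x i = undefined" if "x \<in> space (torus_haar k)" for x
      using that False by (auto simp: torus_haar_def space_PiM PiE_def extensional_def)
    then show ?thesis by (subst measurable_cong[of _ _ "\<lambda>_. undefined"]) auto
  qed (rule measurable_torus_coord_borel)
qed

lemma torus_integral_coord:
  fixes g :: "real \<Rightarrow> 'b::{banach, second_countable_topology}"
  assumes "i < k" "g \<in> borel_measurable circle_haar"
  shows "(\<integral>x. g (x i) \<partial>torus_haar k) = (\<integral>x. g x \<partial>circle_haar)"
proof -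
  have "(\<integral>x. g x \<partial>circle_haar) = (\<integral>x. g x \<partial>distr (torus_haar k) circle_haar (\<lambda>x. x i))"
    unfolding torus_haar_def using assms(1) by (subst torus.PiM_component) auto
  also have "\<dots> = (\<integral>x. g (x i) \<partial>torus_haar k)"
    by (rule integral_distr[OF measurable_torus_coord[OF assms(1)] assms(2)])
  finally show ?thesis by simp
qed

lemma cis_sum: "finite I \<Longrightarrow> cis (\<Sum>i\<in>I. f i) = (\<Prod>i\<in>I. cis (f i))"
  by (induction I rule: finite_induct) (simp_all add: cis_mult[symmetric])

lemma torus_integral_cis:
  "(\<integral>x. cis (2 * pi * (\<Sum>i\<le>d. of_int (l i) * x i)) \<partial>torus_haar (d + 1))
     = (\<Prod>i<d+1. \<integral>x. cis (2 * pi * (of_int (l i) * x)) \<partial>circle_haar)"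
proof -
  have "cis (2 * pi * (\<Sum>i\<le>d. of_int (l i) * x i)) = (\<Prod>i<d+1. cis (2 * pi * (of_int (l i) * x i)))" for x :: "nat \<Rightarrow> real"
    unfolding sum_distrib_left by (subst cis_sum) (auto simp: lessThan_Suc_atMost)
  moreover have "integrable circle_haar (\<lambda>x. cis (2 * pi * (of_int (l i) * x)))" for i
    by (rule circle.integrable_const_bound[of _ 1]) auto
  ultimately show ?thesis
    unfolding torus_haar_def by (simp only:) (intro torus.product_integral_prod, auto)
qed

abbreviation (input) torus_pair :: "nat \<Rightarrow> ((nat \<Rightarrow> real) \<times> (nat \<Rightarrow> real)) measure" where
  "torus_pair d \<equiv> torus_haar (d + 1) \<Otimes>\<^sub>M torus_haar (d + 1)"

lemma pair_prob_space_torus: "pair_prob_space (torus_haar j) (torus_haar k)"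
  by (intro pair_prob_space.intro pair_sigma_finite.intro prob_space_torus_haar
      prob_space_imp_sigma_finite)

lemma prob_space_torus_pair: "prob_space (torus_pair d)"
proof -
  interpret pair_prob_space "torus_haar (d + 1)" "torus_haar (d + 1)" by (rule pair_prob_space_torus)
  show ?thesis by unfold_locales
qed

lemma torus_pair_integral_fst:
  fixes f :: "_ \<Rightarrow> 'b::{banach, second_countable_topology}"
  assumes "integrable (torus_pair d) f"
  shows "(\<integral>p. f p \<partial>torus_pair d) = (\<integral>x. \<integral>y. f (x, y) \<partial>torus_haar (d + 1) \<partial>torus_haar (d + 1))"
proof -
  interpret pair_prob_space "torus_haar (d + 1)" "torus_haar (d + 1)" by (rule pair_prob_space_torus)
  show ?thesis using integral_fst'[OF assms] by simp
qed

lemma measurable_torus_pair_fst: "i \<le> d \<Longrightarrow> (\<lambda>p. fst p i) \<in> borel_measurable (torus_pair d)"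
  by (rule measurable_compose[OF measurable_fst measurable_torus_coord_borel]) simp

lemma measurable_torus_pair_snd: "i \<le> d \<Longrightarrow> (\<lambda>p. snd p i) \<in> borel_measurable (torus_pair d)"
  by (rule measurable_compose[OF measurable_snd measurable_torus_coord_borel]) simp

lemma borel_measurable_torus_pair:
  fixes G :: "(nat \<Rightarrow> real) \<times> (nat \<Rightarrow> real) \<Rightarrow> 'b::topological_space"
  assumes "continuous_on UNIV G"
  shows "G \<in> borel_measurable (torus_pair d)"
proof -
  have "(\<lambda>p. (fst p, snd p)) \<in> borel_measurable (torus_pair d)"
    by (intro borel_measurable_Pair measurable_compose[OF measurable_fst borel_measurable_torus_id]
        measurable_compose[OF measurable_snd borel_measurable_torus_id])
  then have "(\<lambda>p. p) \<in> borel_measurable (torus_pair d)" by simp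
  from measurable_compose[OF this borel_measurable_continuous_onI[OF assms]] show ?thesis .
qed

text \<open>By Fubini the integral is a product over the coordinates of both blocks, and one nonzero
  frequency makes its factor vanish.\<close>

lemma torus_pair_integral_char:
  assumes "i \<le> d" "l i \<noteq> 0 \<or> l' i \<noteq> 0"
  shows "(\<integral>p. torus_char d l l' p \<partial>torus_pair d) = 0"
proof -
  interpret prob_space "torus_pair d" by (rule prob_space_torus_pair)
  have "continuous_on UNIV (torus_char d l l')"
    unfolding torus_char_def[abs_def] by (intro continuous_intros)
  then have int: "integrable (torus_pair d) (torus_char d l l')"
    by (intro integrable_const_bound[of _ 1] borel_measurable_torus_pair) auto
  let ?I = "\<lambda>l. \<integral>x. cis (2 * pi * (\<Sum>i\<le>d. of_int (l i) * x i)) \<partial>torus_haar (d + 1)"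
  have "torus_char d l l' (x, y) = cis (2 * pi * (\<Sum>i\<le>d. of_int (l i) * x i)) * cis (2 * pi * (\<Sum>i\<le>d. of_int (l' i) * y i))" for x y
    by (simp add: torus_char_def cis_mult sum.distrib distrib_left)
  then have "(\<integral>p. torus_char d l l' p \<partial>torus_pair d) = ?I l * ?I l'"
    by (simp only: torus_pair_integral_fst[OF int] integral_mult_right_zero integral_mult_left_zero)
  moreover have "?I l = 0 \<or> ?I l' = 0"
    unfolding torus_integral_cis using assms circle_integral_cis
    by (meson finite_lessThan lessThan_iff less_add_one order_le_less_trans prod_zero)
  ultimately show ?thesis by auto
qed

section \<open>Invariance of Haar measure under the skew map\<close>

text \<open>With the other coordinates fixed, \<open>E\<close> rotates coordinate \<open>i\<close>
  by the fixed angle \<open>y j\<close>, which preserves the circle measure; Fubini does the rest.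
  The skew map is a composition of such shears.\<close>

lemma distr_torus_add_coord:
  fixes I :: "nat set"
  assumes I: "finite I" "i \<in> I" "j \<in> I" "j \<noteq> i"
  defines "M \<equiv> PiM I (\<lambda>_. circle_haar)"
  defines "E \<equiv> \<lambda>y. y(i := frac (y i + y j))"
  shows "E \<in> measurable M M" "distr M M E = M"
proof -
  have coord: "(\<lambda>y. y k) \<in> borel_measurable M" if "k \<in> I" for k
    unfolding M_def
    by (rule measurable_compose[OF measurable_component_singleton[OF that] measurable_circle_coord])
  have "(\<lambda>y. \<lambda>k\<in>I. if k = i then frac (y i + y j) else y k) \<in> measurable M M"
    unfolding M_def
  proof (rule measurable_restrict, fold M_def)
    fix k assume k: "k \<in> I"
    show "(\<lambda>y. if k = i then frac (y i + y j) else y k) \<in> measurable M circle_haar"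
    proof (cases "k = i")
      case True
      then show ?thesis using coord I by (auto intro!: measurable_frac_circle_haar)
    next
      case False
      then show ?thesis using k by (simp add: M_def)
    qed
  qed
  then show E: "E \<in> measurable M M"
    by (rule measurable_cong[THEN iffD1, rotated])
      (use I in \<open>auto simp: M_def E_def space_PiM PiE_def extensional_def fun_eq_iff\<close>)
  show "distr M M E = M"
  proof (rule measure_eqI)
    fix A assume "A \<in> sets (distr M M E)"
    then have A: "A \<in> sets M" by simp
    define I' where "I' = I - {i}"
    have I': "I = insert i I'" "i \<notin> I'" "finite I'" "j \<in> I'" using I by (auto simp: I'_def)
    have tr: "(\<lambda>t. frac (t + s)) \<in> measurable circle_haar circle_haar" for s
      by (rule measurable_frac_circle_haar) (rule measurable_circle_haar_borel, simp)
    have indA: "indicator A \<in> borel_measurable (PiM (insert i I') (\<lambda>_. circle_haar))"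
      using A by (simp add: M_def I'(1)[symmetric])
    have indAE: "(\<lambda>y. indicator A (E y)) \<in> borel_measurable (PiM (insert i I') (\<lambda>_. circle_haar))"
      using measurable_compose[OF E[unfolded M_def I'(1)] indA] .
    have "emeasure (distr M M E) A = (\<integral>\<^sup>+ y. indicator A y \<partial>distr M M E)"
      using A by simp
    also have "\<dots> = (\<integral>\<^sup>+ y. indicator A (E y) \<partial>M)"
      using A by (intro nn_integral_distr E) auto
    also have "\<dots> = (\<integral>\<^sup>+ x. \<integral>\<^sup>+ t. indicator A (E (x(i := t))) \<partial>circle_haar \<partial>PiM I' (\<lambda>_. circle_haar))"
      unfolding M_def I'(1) by (rule torus.product_nn_integral_insert[OF I'(3,2) indAE])
    also have "\<dots> = (\<integral>\<^sup>+ x. \<integral>\<^sup>+ t. indicator A (x(i := t)) \<partial>circle_haar \<partial>PiM I' (\<lambda>_. circle_haar))"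
    proof (rule nn_integral_cong)
      fix x assume x: "x \<in> space (PiM I' (\<lambda>_. circle_haar))"
      have "(\<lambda>t. x(i := t)) \<in> measurable circle_haar (PiM (insert i I') (\<lambda>_. circle_haar))"
        using measurable_component_update[OF x I'(2)] .
      from measurable_compose[OF this indA]
      have m: "(\<lambda>t. indicator A (x(i := t)) :: ennreal) \<in> borel_measurable circle_haar" .
      have "(\<integral>\<^sup>+ t. indicator A (E (x(i := t))) \<partial>circle_haar)
          = (\<integral>\<^sup>+ t. indicator A (x(i := frac (t + x j))) \<partial>circle_haar)"
        using I(4) by (simp add: E_def)
      also have "\<dots> = (\<integral>\<^sup>+ t. indicator A (x(i := t)) \<partial>distr circle_haar circle_haar (\<lambda>t. frac (t + x j)))"
        by (subst nn_integral_distr[OF tr]) (use m in simp_all)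
      finally show "(\<integral>\<^sup>+ t. indicator A (E (x(i := t))) \<partial>circle_haar)
          = (\<integral>\<^sup>+ t. indicator A (x(i := t)) \<partial>circle_haar)"
        by (simp add: distr_circle_haar_translate)
    qed
    also have "\<dots> = (\<integral>\<^sup>+ y. indicator A y \<partial>M)"
      unfolding M_def I'(1) by (rule torus.product_nn_integral_insert[OF I'(3,2) indA, symmetric])
    also have "\<dots> = emeasure M A" using A by simp
    finally show "emeasure (distr M M E) A = emeasure M A" .
  qed simp
qed

lemma torus_skew_preserves:
  "torus_skew d \<in> measurable (torus_haar (d + 1)) (torus_haar (d + 1))"
  "distr (torus_haar (d + 1)) (torus_haar (d + 1)) (torus_skew d) = torus_haar (d + 1)"
proof -
  let ?M = "torus_haar (d + 1)"
  \<comment> \<open>\<open>T k\<close> has already replaced the coordinates from \<open>k\<close> upwards, so that the replacement of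
    coordinate \<open>k - 1\<close> still sees the original coordinate \<open>k - 2\<close>.\<close>
  define T where "T k y = (\<lambda>i\<in>{..<d + 1}. if i < k then y i else frac (y i + y (i - 1)))" for k and y :: "nat \<Rightarrow> real"
  have "T k \<in> measurable ?M ?M \<and> distr ?M ?M (T k) = ?M" if "1 \<le> k" "k \<le> d + 1" for k
    using that(2,1)
  proof (induction k rule: inc_induct)
    case base
    \<comment> \<open>\<open>T (d + 1)\<close> still restricts to the index set, hence is the
      identity only on extensional functions.\<close>
    have id: "T (d + 1) y = y" if "y \<in> space ?M" for y
      using that by (auto simp: T_def torus_haar_def space_PiM PiE_def extensional_def fun_eq_iff)
    have "T (d + 1) \<in> measurable ?M ?M"
      by (subst measurable_cong[OF id]) auto
    moreover have "distr ?M ?M (T (d + 1)) = ?M"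
      by (subst distr_cong[OF refl refl id]) (auto simp: distr_id)
    ultimately show ?case by blast
  next
    case (step k)
    define E where "E y = y(k := frac (y k + y (k - 1)))" for y :: "nat \<Rightarrow> real"
    have E: "E \<in> measurable ?M ?M" "distr ?M ?M E = ?M"
      unfolding E_def torus_haar_def using step by (auto intro!: distr_torus_add_coord)
    have "T k y = E (T (Suc k) y)" for y
      using step by (auto simp: T_def E_def fun_eq_iff)
    then have Tk: "T k = E \<circ> T (Suc k)" by auto
    have IH: "T (Suc k) \<in> measurable ?M ?M" "distr ?M ?M (T (Suc k)) = ?M" using step by auto
    have "distr ?M ?M (T k) = distr (distr ?M ?M (T (Suc k))) ?M E"
      unfolding Tk by (rule distr_distr[OF E(1) IH(1), symmetric])
    then have "distr ?M ?M (T k) = ?M" by (simp only: IH E)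
    moreover have "T k \<in> measurable ?M ?M"
      unfolding Tk by (rule measurable_comp[OF IH(1) E(1)])
    ultimately show ?case by blast
  qed
  moreover have "torus_skew d = T 1"
    by (auto simp: torus_skew_def T_def fun_eq_iff)
  ultimately show "torus_skew d \<in> measurable ?M ?M" "distr ?M ?M (torus_skew d) = ?M" by auto
qed

lemma mp_system_torus_skew_pair:
  "mp_system (torus_pair d) (map_prod (torus_skew d) (torus_skew d))"
proof -
  let ?M = "torus_haar (d + 1)"
  have sf: "sigma_finite_measure (distr ?M ?M (torus_skew d))"
    unfolding torus_skew_preserves by (intro prob_space_imp_sigma_finite prob_space_torus_haar)
  have eq: "map_prod (torus_skew d) (torus_skew d) = (\<lambda>(x, y). (torus_skew d x, torus_skew d y))"
    by auto
  have "distr ?M ?M (torus_skew d) \<Otimes>\<^sub>M distr ?M ?M (torus_skew d)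
      = distr (torus_pair d) (torus_pair d) (\<lambda>(x, y). (torus_skew d x, torus_skew d y))"
    by (rule pair_measure_distr[OF torus_skew_preserves(1) torus_skew_preserves(1) sf])
  moreover have "(\<lambda>(x, y). (torus_skew d x, torus_skew d y)) \<in> measurable (torus_pair d) (torus_pair d)"
    using torus_skew_preserves(1)[of d] by measurable
  ultimately show ?thesis
    unfolding mp_system_def eq torus_skew_preserves using prob_space_torus_pair by auto
qed

section \<open>Approximation of the observable\<close>

lemma continuous_on_compose_frac:
  fixes g :: "real \<Rightarrow> 'b::topological_space"
  assumes "continuous_on {0..1} g" "g 0 = g 1"
  shows "continuous_on UNIV (\<lambda>x. g (frac x))"
  unfolding continuous_on_eq_continuous_at[OF open_UNIV]
proof
  fix x0 :: real
  define n where "n = real_of_int \<lfloor>x0\<rfloor>"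
  \<comment> \<open>The open window around \<open>x0\<close> has the integer \<open>n\<close> in its
    middle, where the two branches agree because \<open>g 0 = g 1\<close>.\<close>
  let ?f = "\<lambda>x. if x \<le> n then g (x - n + 1) else g (x - n)"
  have x0: "x0 \<in> {n - 1<..<n + 1}" by (auto simp: n_def) linarith
  have "continuous_on ({n-1..n} \<union> {n..n+1}) ?f"
    by (rule continuous_on_If)
      (auto intro!: continuous_on_compose2[OF assms(1)] continuous_intros simp: assms(2))
  then have "continuous_on {n - 1<..<n + 1} ?f"
    by (rule continuous_on_subset) auto
  moreover have "?f x = g (frac x)" if "x \<in> {n - 1<..<n + 1}" for x
  proof (cases "x < n")
    case True
    then have "frac x = x - n + 1" using that by (simp add: frac_unique_iff n_def)
    then show ?thesis using True by simp
  next
    case False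
    then have "frac x = x - n" using that by (simp add: frac_unique_iff n_def)
    then show ?thesis using False assms(2) by simp
  qed
  ultimately have "continuous_on {n - 1<..<n + 1} (\<lambda>x. g (frac x))"
    by (rule continuous_on_eq)
  then show "isCont (\<lambda>x. g (frac x)) x0"
    using x0 by (simp add: continuous_on_eq_continuous_at)
qed

lemma periodic1_compose_frac: "periodic1 (\<lambda>x. g (frac x))"
  by (simp add: periodic1_def frac_1_eq)

lemma periodic1_continuous_bounded:
  fixes g :: "real \<Rightarrow> 'b::real_normed_vector"
  assumes "continuous_on UNIV g" "periodic1 g"
  obtains B where "B \<ge> 0" "\<And>x. norm (g x) \<le> B"
proof -
  have "compact (g ` {0..1})"
    by (intro compact_continuous_image continuous_on_subset[OF assms(1)]) auto
  then obtain B where B: "\<And>y. y \<in> g ` {0..1} \<Longrightarrow> norm y \<le> B"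
    using compact_imp_bounded bounded_iff by metis
  have *: "norm (g x) \<le> B" for x
  proof -
    have "frac x \<in> {0..1}" using frac_lt_1[of x] by auto
    then have "norm (g (frac x)) \<le> B" using B by blast
    then show ?thesis by (simp add: periodic1_frac[OF assms(2)])
  qed
  moreover have "B \<ge> 0" using *[of 0] norm_ge_zero order_trans by blast
  ultimately show ?thesis using that by blast
qed

lemma circle_integrable_periodic1:
  fixes g :: "real \<Rightarrow> 'b::{banach, second_countable_topology}"
  assumes "continuous_on UNIV g" "periodic1 g"
  shows "integrable circle_haar g"
proof -
  obtain B where "\<And>x. norm (g x) \<le> B" using periodic1_continuous_bounded[OF assms] by metis
  then show ?thesis
    by (intro circle.integrable_const_bound[of _ B] measurable_circle_haar_borel
        borel_measurable_continuous_onI assms) auto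
qed

text \<open>A form of Riemann integrability that, unlike the two-sided one, passes to compositions with
  contractions.\<close>

definition dominated_approx :: "complex set \<Rightarrow> (real \<Rightarrow> complex) \<Rightarrow> bool" where
  "dominated_approx Y \<psi> \<longleftrightarrow> (\<forall>e>0. \<exists>g h.
     continuous_on UNIV g \<and> periodic1 g \<and> range g \<subseteq> Y \<and>
     continuous_on UNIV h \<and> periodic1 h \<and>
     (\<forall>x. norm (\<psi> x - g x) \<le> h x) \<and> (\<integral>x. h x \<partial>circle_haar) \<le> e)"

lemma riemann_integrable_realE:
  assumes "riemann_integrable_real f" "e > 0"
  obtains m p where "continuous_on UNIV m" "periodic1 m" "continuous_on UNIV p" "periodic1 p"
    "\<And>x. m x \<le> f x \<and> f x \<le> p x" "(\<integral>x. (p x - m x) \<partial>circle_haar) \<le> e"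
  using assms unfolding riemann_integrable_real_def by blast

text \<open>The lower functions of both parts form \<open>g\<close>, and their gaps to the upper
  ones add up to \<open>h\<close>, because the modulus is at most the sum of the absolute values of
  the two parts.\<close>

lemma riemann_integrable_dominated_approx:
  assumes "riemann_integrable_circle \<phi>"
  shows "dominated_approx UNIV \<phi>"
  unfolding dominated_approx_def
proof (intro allI impI)
  fix e :: real assume e: "e > 0"
  have R: "riemann_integrable_real (\<lambda>x. Re (\<phi> x))" "riemann_integrable_real (\<lambda>x. Im (\<phi> x))"
    using assms by (auto simp: riemann_integrable_circle_def)
  obtain m1 p1 where 1: "continuous_on UNIV m1" "periodic1 m1" "continuous_on UNIV p1" "periodic1 p1"
    "\<And>x. m1 x \<le> Re (\<phi> x) \<and> Re (\<phi> x) \<le> p1 x" "(\<integral>x. (p1 x - m1 x) \<partial>circle_haar) \<le> e/2"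
    using riemann_integrable_realE[OF R(1) half_gt_zero[OF e]] by blast
  obtain m2 p2 where 2: "continuous_on UNIV m2" "periodic1 m2" "continuous_on UNIV p2" "periodic1 p2"
    "\<And>x. m2 x \<le> Im (\<phi> x) \<and> Im (\<phi> x) \<le> p2 x" "(\<integral>x. (p2 x - m2 x) \<partial>circle_haar) \<le> e/2"
    using riemann_integrable_realE[OF R(2) half_gt_zero[OF e]] by blast
  let ?g = "\<lambda>x. complex_of_real (m1 x) + \<i> * complex_of_real (m2 x)"
  let ?h = "\<lambda>x. (p1 x - m1 x) + (p2 x - m2 x)"
  have "continuous_on UNIV ?g" "continuous_on UNIV ?h" using 1 2 by (auto intro!: continuous_intros)
  moreover have "periodic1 ?g" "periodic1 ?h" using 1 2 by (auto simp: periodic1_def)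
  moreover have "norm (\<phi> x - ?g x) \<le> ?h x" for x
    using cmod_le[of "\<phi> x - ?g x"] 1(5)[of x] 2(5)[of x] by simp
  moreover have "(\<integral>x. ?h x \<partial>circle_haar) \<le> e"
  proof -
    have "integrable circle_haar (\<lambda>x. p1 x - m1 x)" "integrable circle_haar (\<lambda>x. p2 x - m2 x)"
      by (intro Bochner_Integration.integrable_diff circle_integrable_periodic1 1 2)+
    then show ?thesis using 1(6) 2(6) by (subst Bochner_Integration.integral_add) auto
  qed
  ultimately show "\<exists>g h. continuous_on UNIV g \<and> periodic1 g \<and> range g \<subseteq> UNIV \<and>
     continuous_on UNIV h \<and> periodic1 h \<and>
     (\<forall>x. norm (\<phi> x - g x) \<le> h x) \<and> (\<integral>x. h x \<partial>circle_haar) \<le> e" by blast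
qed

lemma riemann_integrable_bounded:
  assumes "riemann_integrable_circle \<phi>"
  shows "bounded (range \<phi>)"
proof -
  obtain g h where gh: "continuous_on UNIV g" "periodic1 g" "continuous_on UNIV h" "periodic1 h"
     "\<And>x. norm (\<phi> x - g x) \<le> h x"
    using riemann_integrable_dominated_approx[OF assms] unfolding dominated_approx_def
    by (metis zero_less_one)
  obtain B where B: "\<And>x. norm (g x) \<le> B" using periodic1_continuous_bounded[OF gh(1,2)] by metis
  obtain C where C: "\<And>x. norm (h x) \<le> C" using periodic1_continuous_bounded[OF gh(3,4)] by metis
  have "norm (\<phi> x) \<le> B + C" for x
    using gh(5)[of x] B[of x] C[of x] norm_triangle_ineq2[of "\<phi> x" "g x"] by simp
  then show ?thesis by (auto simp: bounded_iff)
qed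

lemma riemann_integrable_periodic1:
  assumes "riemann_integrable_circle \<phi>"
  shows "periodic1 \<phi>"
  using assms unfolding riemann_integrable_circle_def riemann_integrable_real_def periodic1_def
  by (auto simp: complex_eq_iff)

lemma riemann_integrable_measurable:
  assumes "riemann_integrable_circle \<phi>"
  shows "\<phi> \<in> borel_measurable borel"
  using assms unfolding riemann_integrable_circle_def riemann_integrable_real_def
  by (auto simp: borel_measurable_complex_iff)

text \<open>Nearest-point projection onto a closed convex set is 1-Lipschitz, so the same
  \<open>h\<close> works, and it moves the approximants into \<open>Y\<close>.\<close>

lemma dominated_approx_closest_point:
  assumes "dominated_approx UNIV \<phi>" "convex Y" "closed Y" "Y \<noteq> {}"
  shows "dominated_approx Y (\<lambda>x. closest_point Y (\<phi> x))"
  unfolding dominated_approx_def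
proof (intro allI impI)
  fix e :: real assume "e > 0"
  then obtain g h where gh: "continuous_on UNIV g" "periodic1 g" "continuous_on UNIV h" "periodic1 h"
     "\<And>x. norm (\<phi> x - g x) \<le> h x" "(\<integral>x. h x \<partial>circle_haar) \<le> e"
    using assms(1) unfolding dominated_approx_def by metis
  let ?g = "\<lambda>x. closest_point Y (g x)"
  have "continuous_on UNIV ?g"
    by (rule continuous_on_compose2[OF continuous_on_closest_point[OF assms(2-4), of UNIV] gh(1)]) auto
  moreover have "periodic1 ?g" using gh(2) by (simp add: periodic1_def)
  moreover have "range ?g \<subseteq> Y" using assms(3,4) closest_point_in_set by blast
  moreover have "norm (closest_point Y (\<phi> x) - ?g x) \<le> h x" for x
    using closest_point_lipschitz[OF assms(2-4), of "\<phi> x" "g x"] gh(5)[of x] by (simp add: dist_norm)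
  ultimately show "\<exists>g h. continuous_on UNIV g \<and> periodic1 g \<and> range g \<subseteq> Y \<and>
     continuous_on UNIV h \<and> periodic1 h \<and>
     (\<forall>x. norm (closest_point Y (\<phi> x) - g x) \<le> h x) \<and> (\<integral>x. h x \<partial>circle_haar) \<le> e"
    using gh by blast
qed

text \<open>\<open>frac\<close> jumps at the integers. Its substitute \<theta> descends continuously
  to 0 just before the next integer, and \<tau> is a bump that pays for the places where the two
  differ.\<close>

lemma frac_approximation:
  assumes "0 < \<eta>" "\<eta> < 1/2"
  obtains \<theta> \<tau> :: "real \<Rightarrow> real" where
    "continuous_on UNIV \<theta>" "periodic1 \<theta>" "continuous_on UNIV \<tau>" "periodic1 \<tau>"
    "\<And>x. 0 \<le> \<tau> x" "\<And>x. frac x \<noteq> \<theta> x \<Longrightarrow> 1 \<le> \<tau> x"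
    "(\<integral>x. \<tau> x \<partial>circle_haar) \<le> 8 * \<eta>"
proof -
  \<comment> \<open>\<open>g1\<close> leaves the identity only within distance \<eta> of 1. There
    \<open>g2\<close>, which falls from 2 at both ends of the interval to 0 at distance
    \<open>2 * \<eta>\<close> from them, is still at least 1.\<close>
  define g1 where "g1 t = min t ((1 - t) / \<eta>)" for t
  define g2 where "g2 t = max 0 (2 - min t (1 - t) / \<eta>)" for t
  have c: "continuous_on {0..1} g1" "continuous_on {0..1} g2"
    unfolding g1_def g2_def using assms by (auto intro!: continuous_intros)
  have e: "g1 0 = g1 1" "g2 0 = g2 1" using assms by (auto simp: g1_def g2_def)
  define \<theta> \<tau> where "\<theta> x = g1 (frac x)" and "\<tau> x = g2 (frac x)" for x
  have \<theta>: "continuous_on UNIV \<theta>" "periodic1 \<theta>"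
    unfolding \<theta>_def by (intro continuous_on_compose_frac periodic1_compose_frac c e)+
  have \<tau>: "continuous_on UNIV \<tau>" "periodic1 \<tau>"
    unfolding \<tau>_def by (intro continuous_on_compose_frac periodic1_compose_frac c e)+
  have ge1: "1 \<le> \<tau> x" if "frac x \<noteq> \<theta> x" for x
  proof -
    have "(1 - frac x) / \<eta> < frac x" using that by (auto simp: \<theta>_def g1_def min_def split: if_splits)
    then have "(1 - frac x) / \<eta> < 1" using frac_lt_1[of x] by linarith
    moreover have "min (frac x) (1 - frac x) / \<eta> \<le> (1 - frac x) / \<eta>"
      using assms by (intro divide_right_mono) auto
    ultimately show ?thesis unfolding \<tau>_def g2_def by linarith
  qed
  \<comment> \<open>On the fundamental domain \<tau> vanishes outside \<open>A\<close> and
    \<open>B\<close>; their total length is \<open>4 * \<eta>\<close> and \<tau> is at most 2,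
    whence \<open>8 * \<eta>\<close>.\<close>
  define A where "A = {0..2*\<eta>}" 
  define B where "B = {1 - 2*\<eta>..<1}"
  have AB: "A \<in> sets circle_haar" "B \<in> sets circle_haar"
    using assms by (auto simp: in_sets_circle_haar A_def B_def)
  have int: "(\<integral>x. \<tau> x \<partial>circle_haar) \<le> (\<integral>x. 2 * indicator A x + 2 * indicator B x \<partial>circle_haar)"
  proof (rule integral_mono)
    show "integrable circle_haar \<tau>" by (rule circle_integrable_periodic1[OF \<tau>])
    show "integrable circle_haar (\<lambda>x. 2 * indicator A x + 2 * indicator B x :: real)"
      using AB by (auto intro!: Bochner_Integration.integrable_add integrable_mult_right
          simp: circle.emeasure_finite less_top[symmetric])
    fix x assume "x \<in> space circle_haar"
    then have x: "0 \<le> x" "x < 1" by auto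
    show "\<tau> x \<le> 2 * indicator A x + 2 * indicator B x"
    proof (cases "x \<in> A \<union> B")
      case True
      have "0 \<le> min x (1 - x) / \<eta>" using x assms by auto
      then have "\<tau> x \<le> 2" using x by (simp add: \<tau>_def g2_def frac_eq)
      then show ?thesis using True by (auto simp: indicator_def)
    next
      case False
      then have "2 * \<eta> \<le> min x (1 - x)" using x by (auto simp: A_def B_def)
      then have "2 \<le> min x (1 - x) / \<eta>" using assms by (simp add: field_simps)
      then have "\<tau> x = 0" using x by (simp add: \<tau>_def g2_def frac_eq)
      then show ?thesis by (auto simp: indicator_def)
    qed
  qed
  also have "\<dots> = 2 * measure circle_haar A + 2 * measure circle_haar B"
    using AB by (subst Bochner_Integration.integral_add)
      (auto intro!: integrable_mult_right simp: circle.emeasure_finite less_top[symmetric] Int_absorb2 in_sets_circle_haar)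
  also have "\<dots> = 8 * \<eta>"
    using AB assms by (simp add: measure_def emeasure_circle_haar) (simp add: A_def B_def)
  finally have "(\<integral>x. \<tau> x \<partial>circle_haar) \<le> 8 * \<eta>" .
  then show ?thesis using that[OF \<theta> \<tau> _ ge1] by (simp add: \<tau>_def g2_def)
qed

definition biperiodic :: "(real \<times> real \<Rightarrow> 'a) \<Rightarrow> bool" where
  "biperiodic F \<longleftrightarrow> (\<forall>x y x' y'. x - x' \<in> \<int> \<longrightarrow> y - y' \<in> \<int> \<longrightarrow> F (x, y) = F (x', y'))"

lemma biperiodicD: "biperiodic F \<Longrightarrow> x - x' \<in> \<int> \<Longrightarrow> y - y' \<in> \<int> \<Longrightarrow> F (x, y) = F (x', y')"
  by (auto simp: biperiodic_def)

text \<open>Uniform continuity on a compact square suffices: the integer translation that brings the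
  first point into the fundamental square is applied to the second point as well.\<close>

lemma biperiodic_tendsto_diff:
  fixes F :: "real \<times> real \<Rightarrow> 'b::real_normed_vector"
  assumes F: "continuous_on UNIV F" "biperiodic F"
    and x: "(\<lambda>m. x m - x' m) \<longlonglongrightarrow> 0" and y: "(\<lambda>m. y m - y' m) \<longlonglongrightarrow> 0"
  shows "(\<lambda>m. F (x m, y m) - F (x' m, y' m)) \<longlonglongrightarrow> 0"
proof (rule LIMSEQ_I)
  fix e :: real assume e: "e > 0"
  \<comment> \<open>The fundamental square enlarged by 1 on each side, so that it contains the
    second point once the coordinates differ by less than \<open>\<kappa> \<le> 1\<close>.\<close>
  let ?K = "{-1..2} \<times> {-1..2} :: (real \<times> real) set"
  have "uniformly_continuous_on ?K F"
    by (intro compact_uniformly_continuous continuous_on_subset[OF F(1)] compact_Times) auto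
  then obtain \<delta> where \<delta>: "\<delta> > 0" "\<And>u v. u \<in> ?K \<Longrightarrow> v \<in> ?K \<Longrightarrow> dist v u < \<delta> \<Longrightarrow> dist (F v) (F u) < e"
    using e unfolding uniformly_continuous_on_def by metis
  define \<kappa> where "\<kappa> = min 1 (\<delta>/2)"
  have \<kappa>: "\<kappa> > 0" using \<delta> by (simp add: \<kappa>_def)
  obtain N1 where N1: "\<And>m. m \<ge> N1 \<Longrightarrow> \<bar>x m - x' m\<bar> < \<kappa>" using LIMSEQ_D[OF x \<kappa>] by auto
  obtain N2 where N2: "\<And>m. m \<ge> N2 \<Longrightarrow> \<bar>y m - y' m\<bar> < \<kappa>" using LIMSEQ_D[OF y \<kappa>] by auto
  show "\<exists>no. \<forall>m\<ge>no. norm (F (x m, y m) - F (x' m, y' m) - 0) < e"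
  proof (intro exI allI impI)
    fix m assume m: "m \<ge> max N1 N2"
    have dx: "\<bar>x m - x' m\<bar> < \<kappa>" and dy: "\<bar>y m - y' m\<bar> < \<kappa>" using N1 N2 m by auto
    define u where "u = (frac (x m), frac (y m))"
    define v where "v = (x' m - of_int \<lfloor>x m\<rfloor>, y' m - of_int \<lfloor>y m\<rfloor>)"
    have Fu: "F (x m, y m) = F u" unfolding u_def by (rule biperiodicD[OF F(2)]) (simp_all add: frac_def)
    have Fv: "F (x' m, y' m) = F v" unfolding v_def by (rule biperiodicD[OF F(2)]) simp_all
    have uK: "u \<in> ?K" using frac_lt_1[of "x m"] frac_lt_1[of "y m"] frac_ge_0[of "x m"] frac_ge_0[of "y m"]
      by (auto simp: u_def intro: order_trans[of _ 0])
    have d1: "\<bar>fst v - fst u\<bar> = \<bar>x m - x' m\<bar>" "\<bar>snd v - snd u\<bar> = \<bar>y m - y' m\<bar>"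
      by (auto simp: u_def v_def frac_def abs_minus_commute)
    have "0 \<le> fst u" "fst u < 1" "0 \<le> snd u" "snd u < 1" by (auto simp: u_def frac_lt_1)
    then have vK: "v \<in> ?K"
      using d1 dx dy unfolding \<kappa>_def mem_Times_iff by auto
    have "dist v u \<le> \<bar>fst v - fst u\<bar> + \<bar>snd v - snd u\<bar>"
      using sqrt_sum_squares_le_sum_abs[of "fst v - fst u" "snd v - snd u"]
      by (simp add: dist_prod_def dist_real_def)
    also have "\<dots> < \<delta>" using d1 dx dy by (simp add: \<kappa>_def)
    finally have "dist (F v) (F u) < e" using \<delta>(2)[OF uK vK] by simp
    then show "norm (F (x m, y m) - F (x' m, y' m) - 0) < e"
      by (simp add: Fu Fv dist_norm norm_minus_commute)
  qed
qed

text \<open>There are two sources of error: replacing \<psi> by \<open>g\<close> costs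
  \<open>h\<close>, and replacing \<open>frac\<close> by \<theta> costs a bounded amount that
  \<open>K * \<tau>\<close> covers. The integral of \<open>h\<close> is unaffected by the shift
  \<open>\<alpha> * \<theta> x\<close>, as the inner integral over \<open>y\<close> is translation
  invariant.\<close>

lemma dominated_approx_skew:
  assumes "dominated_approx Y \<psi>" "e > 0"
  obtains F :: "real \<times> real \<Rightarrow> complex" and H :: "real \<times> real \<Rightarrow> real" where
    "continuous_on UNIV F" "biperiodic F" "range F \<subseteq> Y" "continuous_on UNIV H" "biperiodic H"
    "\<And>x y. norm (\<psi> (y - \<alpha> * frac x) - F (x, y)) \<le> H (x, y)"
    "(\<integral>p. H (fst p d, snd p d) \<partial>torus_pair d) \<le> e" "bounded (range H)"
proof -
  obtain g h where g: "continuous_on UNIV g" "periodic1 g" "range g \<subseteq> Y"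
    and h: "continuous_on UNIV h" "periodic1 h"
    and gh: "\<And>x. norm (\<psi> x - g x) \<le> h x" "(\<integral>x. h x \<partial>circle_haar) \<le> e/2"
    using assms unfolding dominated_approx_def by (metis half_gt_zero)
  obtain B where B: "B \<ge> 0" "\<And>x. norm (g x) \<le> B" using periodic1_continuous_bounded[OF g(1,2)] by blast
  obtain C where C: "C \<ge> 0" "\<And>x. norm (h x) \<le> C" using periodic1_continuous_bounded[OF h] by blast
  \<comment> \<open>Crude bound for \<open>norm (\<psi> u - g v)\<close> with unrelated
    \<open>u\<close> and \<open>v\<close>: at most \<open>C\<close> from \<open>\<psi> u\<close> to
    \<open>g u\<close>, then \<open>2 * B\<close> from \<open>g u\<close> to
    \<open>g v\<close>.\<close>
  define K where "K = C + 2 * B"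
  have K: "K \<ge> 0" using B C by (simp add: K_def)
  \<comment> \<open>Makes \<open>K * (8 * \<eta>)\<close> at most \<open>e/2\<close>;
    \<open>K + 1\<close> avoids division by zero, and \<open>1/4\<close> keeps \<eta> below
    \<open>1/2\<close>.\<close>
  define \<eta> where "\<eta> = min (1/4) (e / (16 * (K + 1)))"
  have \<eta>: "0 < \<eta>" "\<eta> < 1/2" using K assms(2) by (auto simp: \<eta>_def)
  have K\<eta>: "K * (8 * \<eta>) \<le> e/2"
  proof -
    have "K * (8 * \<eta>) \<le> (K + 1) * (8 * (e / (16 * (K + 1))))"
      using K \<eta> by (intro mult_mono) (auto simp: \<eta>_def)
    also have "\<dots> = e/2" using K by (simp add: field_simps)
    finally show ?thesis .
  qed
  obtain \<theta> \<tau> where \<theta>: "continuous_on UNIV \<theta>" "periodic1 \<theta>" and \<tau>: "continuous_on UNIV \<tau>" "periodic1 \<tau>"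
    and \<tau>0: "\<And>x. 0 \<le> \<tau> x" and \<tau>1: "\<And>x. frac x \<noteq> \<theta> x \<Longrightarrow> 1 \<le> \<tau> x"
    and \<tau>i: "(\<integral>x. \<tau> x \<partial>circle_haar) \<le> 8 * \<eta>"
    using frac_approximation[OF \<eta>] by blast
  define F where "F p = g (snd p - \<alpha> * \<theta> (fst p))" for p
  define H1 where "H1 p = h (snd p - \<alpha> * \<theta> (fst p))" for p
  define H where "H p = H1 p + K * \<tau> (fst p)" for p
  have arg: "continuous_on S (\<lambda>p. snd p - \<alpha> * \<theta> (fst p))" for S :: "(real \<times> real) set"
    by (intro continuous_intros continuous_on_compose2[OF \<theta>(1)]) auto
  have Fc: "continuous_on UNIV F" unfolding F_def
    by (rule continuous_on_compose2[OF g(1) arg]) auto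
  have H1c: "continuous_on UNIV H1" unfolding H1_def
    by (rule continuous_on_compose2[OF h(1) arg]) auto
  have tc: "continuous_on UNIV (\<lambda>p::real\<times>real. \<tau> (fst p))"
    by (rule continuous_on_compose2[OF \<tau>(1)]) (auto intro!: continuous_intros)
  have Hc: "continuous_on UNIV H" unfolding H_def by (intro continuous_intros H1c tc)
  have argp: "(y - \<alpha> * \<theta> x) - (y' - \<alpha> * \<theta> x') \<in> \<int>" if "x - x' \<in> \<int>" "y - y' \<in> \<int>" for x y x' y'
    using that periodic1_Ints[OF \<theta>(2) that(1)] by simp
  have Fp: "biperiodic F"
    unfolding biperiodic_def F_def by (auto intro!: periodic1_Ints[OF g(2)] argp)
  have H1p: "biperiodic H1"
    unfolding biperiodic_def H1_def by (auto intro!: periodic1_Ints[OF h(2)] argp)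
  then have Hp: "biperiodic H"
    using periodic1_Ints[OF \<tau>(2)] by (auto simp: biperiodic_def H_def)
  have h0: "h x \<ge> 0" for x using gh(1)[of x] norm_ge_zero order_trans by blast
  have bound: "norm (\<psi> (y - \<alpha> * frac x) - F (x, y)) \<le> H (x, y)" for x y
  proof (cases "frac x = \<theta> x")
    case True
    then show ?thesis using gh(1)[of "y - \<alpha> * \<theta> x"] mult_nonneg_nonneg[OF K \<tau>0[of x]]
      by (simp add: F_def H_def H1_def)
  next
    case False
    let ?u = "y - \<alpha> * frac x" and ?v = "y - \<alpha> * \<theta> x"
    have "norm (\<psi> ?u - g ?v) \<le> norm (\<psi> ?u - g ?u) + norm (g ?u - g ?v)"
      using norm_triangle_ineq[of "\<psi> ?u - g ?u" "g ?u - g ?v"] by simp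
    also have "\<dots> \<le> C + (B + B)"
      using gh(1)[of ?u] C(2)[of ?u] B(2)[of ?u] B(2)[of ?v] norm_triangle_ineq4[of "g ?u" "g ?v"] by simp
    also have "\<dots> = K * 1" by (simp add: K_def)
    also have "\<dots> \<le> K * \<tau> x" using K \<tau>1[OF False] by (intro mult_left_mono)
    also have "\<dots> \<le> H (x, y)" using h0 by (simp add: H_def H1_def)
    finally show ?thesis by (simp add: F_def)
  qed
  interpret M: prob_space "torus_pair d" by (rule prob_space_torus_pair)
  obtain D where D: "\<And>x. norm (\<tau> x) \<le> D" using periodic1_continuous_bounded[OF \<tau>] by metis
  have coordc: "continuous_on UNIV (\<lambda>p :: (nat \<Rightarrow> real) \<times> (nat \<Rightarrow> real). (fst p d, snd p d))"
    by (intro continuous_intros)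
  have i1: "integrable (torus_pair d) (\<lambda>p. H1 (fst p d, snd p d))"
    by (intro M.integrable_const_bound[of _ C] borel_measurable_torus_pair
        continuous_on_compose2[OF H1c coordc]) (use C in \<open>auto simp: H1_def\<close>)
  have i2: "integrable (torus_pair d) (\<lambda>p. \<tau> (fst p d))"
    by (intro M.integrable_const_bound[of _ D] borel_measurable_torus_pair
        continuous_on_compose2[OF \<tau>(1)] continuous_intros) (use D in auto)
  have hm: "h \<in> borel_measurable borel" and \<tau>m: "\<tau> \<in> borel_measurable borel"
    by (auto intro!: borel_measurable_continuous_onI h \<tau>)
  have "(\<integral>y. H1 (x d, y d) \<partial>torus_haar (d + 1)) = (\<integral>x. h x \<partial>circle_haar)" for x
  proof -
    have "(\<integral>y. H1 (x d, y d) \<partial>torus_haar (d + 1)) = (\<integral>y. h (y d + (- \<alpha> * \<theta> (x d))) \<partial>torus_haar (d + 1))"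
      by (simp add: H1_def)
    also have "\<dots> = (\<integral>y. h (y + (- \<alpha> * \<theta> (x d))) \<partial>circle_haar)"
      by (rule torus_integral_coord) (use hm in \<open>auto intro!: measurable_circle_haar_borel\<close>)
    also have "\<dots> = (\<integral>x. h x \<partial>circle_haar)" by (rule circle_integral_translate[OF h(2) hm])
    finally show ?thesis .
  qed
  then have I1: "(\<integral>p. H1 (fst p d, snd p d) \<partial>torus_pair d) = (\<integral>x. h x \<partial>circle_haar)"
    using prob_space.prob_space[OF prob_space_torus_haar]
    by (simp add: torus_pair_integral_fst[OF i1, simplified])
  have "(\<integral>x. \<tau> (x d) \<partial>torus_haar (d + 1)) = (\<integral>x. \<tau> x \<partial>circle_haar)"
    by (rule torus_integral_coord) (use \<tau>m in \<open>auto intro!: measurable_circle_haar_borel\<close>)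
  then have I2: "(\<integral>p. \<tau> (fst p d) \<partial>torus_pair d) = (\<integral>x. \<tau> x \<partial>circle_haar)"
    using prob_space.prob_space[OF prob_space_torus_haar]
    by (simp add: torus_pair_integral_fst[OF i2, simplified])
  have "(\<integral>p. H (fst p d, snd p d) \<partial>torus_pair d) = (\<integral>x. h x \<partial>circle_haar) + K * (\<integral>x. \<tau> x \<partial>circle_haar)"
    using i1 i2 I1 I2 by (simp add: H_def)
  also have "\<dots> \<le> e"
    using gh(2) mult_left_mono[OF \<tau>i K] K\<eta> by linarith
  finally have int: "(\<integral>p. H (fst p d, snd p d) \<partial>torus_pair d) \<le> e" .
  have "norm (H p) \<le> C + K * D" for p
    using norm_triangle_ineq[of "H1 p" "K * \<tau> (fst p)"] C(2)[of "snd p - \<alpha> * \<theta> (fst p)"]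
      mult_left_mono[OF D[of "fst p"] K] K by (simp add: H_def H1_def abs_mult)
  then have "bounded (range H)" by (auto simp: bounded_iff)
  moreover have "range F \<subseteq> Y" using g(3) by (auto simp: F_def)
  ultimately show ?thesis using that[OF Fc Fp _ Hc Hp bound int] by blast
qed

section \<open>Continuous functions on the sequence space\<close>

text \<open>Uniform continuity in a form that is linear in finitely many coordinate errors, so that
  it can be averaged along an orbit and integrated.\<close>

lemma seq_space_functional_bound:
  fixes f :: "(int \<Rightarrow> complex) \<Rightarrow> real"
  assumes Y: "compact Y" and f: "continuous_on (seq_space Y) f"
  obtains B where "\<And>x. x \<in> seq_space Y \<Longrightarrow> \<bar>f x\<bar> \<le> B" "B \<ge> 0"
    "\<And>e. e > 0 \<Longrightarrow> \<exists>F C. finite F \<and> C \<ge> 0 \<and> (\<forall>x\<in>seq_space Y. \<forall>z\<in>seq_space Y.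
       \<bar>f x - f z\<bar> \<le> e + C * (\<Sum>k\<in>F. norm (x k - z k)))"
proof -
  have comp: "compact (seq_space Y)" unfolding seq_space_def by (rule compact_fun[OF Y])
  have "compact (f ` seq_space Y)" by (rule compact_continuous_image[OF f comp])
  then obtain B0 where B0: "\<And>x. x \<in> seq_space Y \<Longrightarrow> \<bar>f x\<bar> \<le> B0"
    using compact_imp_bounded bounded_iff by (metis imageI real_norm_def)
  define B where "B = max 0 B0"
  have B: "\<bar>f x\<bar> \<le> B" if "x \<in> seq_space Y" for x using B0[OF that] by (simp add: B_def)
  have "\<exists>F C. finite F \<and> C \<ge> 0 \<and> (\<forall>x\<in>seq_space Y. \<forall>z\<in>seq_space Y.
       \<bar>f x - f z\<bar> \<le> e + C * (\<Sum>k\<in>F. norm (x k - z k)))" if e: "e > 0" for e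
  proof -
    have "uniformly_continuous_on (seq_space Y) f" by (rule compact_uniformly_continuous[OF f comp])
    then obtain \<delta> where \<delta>: "\<delta> > 0"
      "\<And>x z. x \<in> seq_space Y \<Longrightarrow> z \<in> seq_space Y \<Longrightarrow> dist z x < \<delta> \<Longrightarrow> dist (f z) (f x) < e"
      using e unfolding uniformly_continuous_on_def by metis
    \<comment> \<open>The distance of two functions is at most twice the largest of the distances in
      the first coordinates plus \<open>(1/2) ^ N\<close>, hence the thresholds
      \<open>\<delta>/4\<close> and \<open>\<delta>/2\<close>.\<close>
    obtain N where N: "(1/2::real) ^ N < \<delta>/2" using real_arch_pow_inv[of "\<delta>/2" "1/2"] \<delta> by auto
    define F :: "int set" where "F = from_nat ` {..N}"
    \<comment> \<open>If one coordinate differs by \<open>\<delta>/4\<close>, the right-hand side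
      already reaches the trivial bound \<open>2 * B\<close>.\<close>
    define C where "C = 8 * B / \<delta>"
    have C: "C \<ge> 0" using \<delta> by (simp add: C_def B_def)
    have "\<bar>f x - f z\<bar> \<le> e + C * (\<Sum>k\<in>F. norm (x k - z k))"
      if xz: "x \<in> seq_space Y" "z \<in> seq_space Y" for x z
    proof (cases "\<forall>k\<in>F. norm (x k - z k) < \<delta>/4")
      case True
      let ?A = "{dist (x (from_nat n :: int)) (z (from_nat n)) | n. n \<le> N}"
      have A: "?A = (\<lambda>n. dist (x (from_nat n :: int)) (z (from_nat n))) ` {..N}" by auto
      have "Max ?A < \<delta>/4"
        unfolding A using True by (subst Max_less_iff) (auto simp: F_def dist_norm)
      then have "dist x z < \<delta>" using dist_fun_le_dist_first_terms[of x z N] N by linarith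
      then have "\<bar>f x - f z\<bar> < e" using \<delta>(2)[OF xz(2,1)] by (simp add: dist_real_def)
      moreover have "0 \<le> C * (\<Sum>k\<in>F. norm (x k - z k))" using C by (intro mult_nonneg_nonneg sum_nonneg) auto
      ultimately show ?thesis by simp
    next
      case False
      then obtain k where k: "k \<in> F" "norm (x k - z k) \<ge> \<delta>/4" by fastforce
      have "\<bar>f x - f z\<bar> \<le> 2 * B" using B[OF xz(1)] B[OF xz(2)] by linarith
      also have "\<dots> = C * (\<delta>/4)" using \<delta> by (simp add: C_def)
      also have "\<dots> \<le> C * (\<Sum>k\<in>F. norm (x k - z k))"
        using k C member_le_sum[of k F "\<lambda>k. norm (x k - z k)"]
        by (intro mult_left_mono) (auto simp: F_def)
      finally show ?thesis using e by simp
    qed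
    then show ?thesis using C by (intro exI[of _ F] exI[of _ C]) (auto simp: F_def)
  qed
  then show ?thesis using that[OF B] by (simp add: B_def)
qed

section \<open>The factor map\<close>

text \<open>The last coordinate of the \<open>k\<close>-th iterate of the skew map, before reduction modulo 1.\<close>

definition skew_pos :: "nat \<Rightarrow> int \<Rightarrow> (nat \<Rightarrow> real) \<Rightarrow> real" where
  "skew_pos d k x = (\<Sum>i\<le>d. (of_int k gchoose (d - i)) * x i)"

lemma skew_pos_0: "skew_pos d 0 x = x d"
proof -
  have "skew_pos d 0 x = (\<Sum>i\<le>d. if i = d then x i else 0)"
    unfolding skew_pos_def by (intro sum.cong) (auto simp: gbinomial_0_left)
  then show ?thesis by simp
qed

lemma skew_pos_Ints:
  assumes "\<And>i. i \<le> d \<Longrightarrow> x i - y i \<in> \<int>"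
  shows "skew_pos d k x - skew_pos d k y \<in> \<int>"
  unfolding skew_pos_def sum_subtractf[symmetric] right_diff_distrib[symmetric]
  using assms by (intro Ints_sum Ints_mult gbinomial_int_in_Ints) auto

text \<open>Pascal's rule for an integer upper argument, so that negative \<open>k\<close> describes
  backward iterates.\<close>

lemma skew_pos_Suc:
  "skew_pos d (k + 1) x = skew_pos d k (\<lambda>i. if i = 0 then x 0 else x i + x (i - 1))"
proof (cases d)
  case 0
  then show ?thesis by (simp add: skew_pos_def)
next
  case (Suc n)
  have "skew_pos d k (\<lambda>i. if i = 0 then x 0 else x i + x (i - 1))
      = (\<Sum>i\<le>d. (of_int k gchoose (d - i)) * x i + (of_int k gchoose (d - i)) * (if i = 0 then 0 else x (i - 1)))"
    unfolding skew_pos_def by (intro sum.cong) (auto simp: distrib_left)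
  also have "\<dots> = (\<Sum>i\<le>d. (of_int k gchoose (d - i)) * x i)
      + (\<Sum>i\<le>d. (of_int k gchoose (d - i)) * (if i = 0 then 0 else x (i - 1)))"
    by (rule sum.distrib)
  also have "(\<Sum>i\<le>d. (of_int k gchoose (d - i)) * (if i = 0 then 0 else x (i - 1)))
      = (\<Sum>i\<le>n. (of_int k gchoose (n - i)) * x i)"
    unfolding Suc by (subst sum.atMost_Suc_shift) simp
  also have "(\<Sum>i\<le>d. (of_int k gchoose (d - i)) * x i)
      = (\<Sum>i\<le>n. (of_int k gchoose (d - i)) * x i) + x d"
    unfolding Suc by simp
  also have "(\<Sum>i\<le>n. (of_int k gchoose (d - i)) * x i) + x d + (\<Sum>i\<le>n. (of_int k gchoose (n - i)) * x i)
      = (\<Sum>i\<le>n. (of_int (k + 1) gchoose (d - i)) * x i) + x d"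
  proof -
    have "(of_int (k + 1) gchoose (d - i)) * x i = (of_int k gchoose (n - i)) * x i + (of_int k gchoose (d - i)) * x i"
      if "i \<le> n" for i
      using that unfolding Suc Suc_diff_le[OF that] gbinomial_Suc_int by (simp add: distrib_right)
    then show ?thesis by (simp add: sum.distrib)
  qed
  also have "\<dots> = skew_pos d (k + 1) x" unfolding skew_pos_def Suc by simp
  finally show ?thesis by simp
qed

lemma skew_pos_torus_skew: "skew_pos d k (torus_skew d x) - skew_pos d (k + 1) x \<in> \<int>"
  unfolding skew_pos_Suc
  by (rule skew_pos_Ints) (auto simp: torus_skew_def frac_def)

lemma continuous_on_skew_pos_fst [continuous_intros]: "continuous_on S (\<lambda>p. skew_pos d k (fst p))"
  unfolding skew_pos_def by (intro continuous_intros)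

lemma continuous_on_skew_pos_snd [continuous_intros]: "continuous_on S (\<lambda>p. skew_pos d k (snd p))"
  unfolding skew_pos_def by (intro continuous_intros)

text \<open>For \<open>x = t\<close> and \<open>y = \<alpha> * t\<close> the argument
  \<open>y - \<alpha> * frac x\<close> is \<open>of_int \<lfloor>t\<rfloor> * \<alpha>\<close>.
  Modulo 1 it depends only on the classes of \<open>x\<close> and \<open>y\<close>, so for periodic
  \<psi> the map is well defined on the torus.\<close>

definition factor_map :: "(real \<Rightarrow> complex) \<Rightarrow> real \<Rightarrow> nat \<Rightarrow> (nat \<Rightarrow> real) \<times> (nat \<Rightarrow> real) \<Rightarrow> int \<Rightarrow> complex" where
  "factor_map \<psi> \<alpha> d p k = \<psi> (skew_pos d k (snd p) - \<alpha> * frac (skew_pos d k (fst p)))"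

lemma factor_map_equivariant:
  assumes "periodic1 \<psi>"
  shows "factor_map \<psi> \<alpha> d (map_prod (torus_skew d) (torus_skew d) p) = seq_shift (factor_map \<psi> \<alpha> d p)"
proof
  fix k
  have "frac (skew_pos d k (torus_skew d (fst p))) = frac (skew_pos d (k + 1) (fst p))"
    using skew_pos_torus_skew[of d k "fst p"] periodic1_Ints[of frac]
    by (simp add: periodic1_def frac_1_eq)
  moreover have "\<psi> (skew_pos d k (torus_skew d (snd p)) - c) = \<psi> (skew_pos d (k + 1) (snd p) - c)" for c
    using skew_pos_torus_skew[of d k "snd p"] by (intro periodic1_Ints[OF assms]) simp
  ultimately show "factor_map \<psi> \<alpha> d (map_prod (torus_skew d) (torus_skew d) p) k = seq_shift (factor_map \<psi> \<alpha> d p) k"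
    by (simp add: factor_map_def seq_shift_def)
qed

abbreviation (input) seq_measurable :: "complex set \<Rightarrow> (int \<Rightarrow> complex) measure" where
  "seq_measurable Y \<equiv> restrict_space borel (seq_space Y)"

lemma factor_map_measurable:
  assumes "\<psi> \<in> borel_measurable borel" "range \<psi> \<subseteq> Y"
  shows "factor_map \<psi> \<alpha> d \<in> measurable (torus_pair d) (seq_measurable Y)"
proof (rule measurable_restrict_space2)
  show "factor_map \<psi> \<alpha> d \<in> space (torus_pair d) \<rightarrow> seq_space Y"
    using assms(2) by (auto simp: factor_map_def seq_space_def)
  show "factor_map \<psi> \<alpha> d \<in> borel_measurable (torus_pair d)"
  proof (rule measurable_coordinatewise_then_product)
    fix k
    have [measurable]: "(\<lambda>p. skew_pos d k (fst p)) \<in> borel_measurable (torus_pair d)"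
      "(\<lambda>p. skew_pos d k (snd p)) \<in> borel_measurable (torus_pair d)"
      by (intro borel_measurable_torus_pair continuous_intros)+
    have "(\<lambda>p. skew_pos d k (snd p) - \<alpha> * frac (skew_pos d k (fst p))) \<in> borel_measurable (torus_pair d)"
      by (intro borel_measurable_diff borel_measurable_times borel_measurable_const
          measurable_compose[OF _ borel_measurable_frac]) measurable
    from measurable_compose[OF this assms(1)]
    show "(\<lambda>p. factor_map \<psi> \<alpha> d p k) \<in> borel_measurable (torus_pair d)"
      unfolding factor_map_def .
  qed
qed

lemma seq_shift_measurable: "seq_shift \<in> measurable (seq_measurable Y) (seq_measurable Y)"
proof (rule measurable_restrict_space3)
  have "continuous_on UNIV seq_shift"
    unfolding seq_shift_def by (intro continuous_on_coordinatewise_then_product continuous_on_product_coordinates)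
  then show "seq_shift \<in> borel_measurable borel" by (rule borel_measurable_continuous_onI)
  show "seq_shift \<in> seq_space Y \<rightarrow> seq_space Y" by (auto simp: seq_space_def seq_shift_def)
qed

text \<open>Equivariance holds at every point, so the image measure inherits its invariance from the
  torus.\<close>

lemma factor_map_is_factor:
  fixes \<alpha> :: real and d :: nat
  assumes "periodic1 \<psi>" "\<psi> \<in> borel_measurable borel" "range \<psi> \<subseteq> Y"
  defines "\<mu> \<equiv> distr (torus_pair d) (seq_measurable Y) (factor_map \<psi> \<alpha> d)"
  shows "is_factor \<mu> seq_shift (torus_pair d) (map_prod (torus_skew d) (torus_skew d))"
proof -
  let ?T = "map_prod (torus_skew d) (torus_skew d)" and ?M = "torus_pair d" and ?\<pi> = "factor_map \<psi> \<alpha> d"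
  have T: "mp_system ?M ?T" by (rule mp_system_torus_skew_pair)
  then have Tm: "?T \<in> measurable ?M ?M" "distr ?M ?M ?T = ?M" by (auto simp: mp_system_def)
  have \<pi>: "?\<pi> \<in> measurable ?M (seq_measurable Y)" by (rule factor_map_measurable[OF assms(2,3)])
  have sets: "sets \<mu> = sets (seq_measurable Y)" by (simp add: \<mu>_def)
  have \<pi>\<mu>: "?\<pi> \<in> measurable ?M \<mu>" using \<pi> by (simp add: measurable_cong_sets[OF refl sets])
  have S: "seq_shift \<in> measurable \<mu> \<mu>"
    using seq_shift_measurable by (simp add: measurable_cong_sets[OF sets sets])
  have d: "distr ?M \<mu> ?\<pi> = \<mu>" unfolding \<mu>_def by (rule distr_cong) auto
  have "distr \<mu> \<mu> seq_shift = distr (distr ?M \<mu> ?\<pi>) \<mu> seq_shift" by (simp only: d)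
  also have "\<dots> = distr ?M \<mu> (seq_shift \<circ> ?\<pi>)" by (rule distr_distr[OF S \<pi>\<mu>])
  also have "seq_shift \<circ> ?\<pi> = ?\<pi> \<circ> ?T"
    using factor_map_equivariant[OF assms(1)] by (auto simp: fun_eq_iff)
  also have "distr ?M \<mu> (?\<pi> \<circ> ?T) = distr (distr ?M ?M ?T) \<mu> ?\<pi>"
    by (rule distr_distr[OF \<pi>\<mu> Tm(1), symmetric])
  also have "\<dots> = \<mu>" by (simp only: Tm d)
  finally have "distr \<mu> \<mu> seq_shift = \<mu>" .
  moreover have "prob_space \<mu>" unfolding \<mu>_def by (rule prob_space.prob_space_distr[OF prob_space_torus_pair \<pi>])
  ultimately show ?thesis
    unfolding is_factor_def mp_system_def
    using T S \<pi>\<mu> d factor_map_equivariant[OF assms(1)] by (auto simp: mp_system_def intro!: bexI[of _ ?\<pi>])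
qed

section \<open>Equidistribution of the differences\<close>

text \<open>The order is reversed because the skew map adds coordinate \<open>i - 1\<close> to
  coordinate \<open>i\<close>: the last coordinate is \<open>a\<close> itself, and coordinate 0,
  which the map fixes, is the difference of order \<open>d\<close>, whose increments tend to 0 under
  the growth hypotheses.\<close>

definition diff_point :: "(real \<Rightarrow> real) \<Rightarrow> real \<Rightarrow> nat \<Rightarrow> nat \<Rightarrow> (nat \<Rightarrow> real) \<times> (nat \<Rightarrow> real)" where
  "diff_point a \<alpha> d m = (\<lambda>i. (fdiff ^^ (d - i)) a (real m), \<lambda>i. \<alpha> * (fdiff ^^ (d - i)) a (real m))"

lemma sum_atMost_rev: "(\<Sum>i\<le>d. f (d - i)) = (\<Sum>i\<le>(d::nat). f i)"
  by (rule sum.reindex_bij_witness[of _ "\<lambda>i. d - i" "\<lambda>i. d - i"]) auto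

lemma skew_pos_diff_point_fst:
  "skew_pos d k (fst (diff_point a \<alpha> d m)) = (\<Sum>j<d + 1. (of_int k gchoose j) * (fdiff ^^ j) a (real m))"
  using sum_atMost_rev[of "\<lambda>j. (of_int k gchoose j) * (fdiff ^^ j) a (real m)" d]
  by (simp add: skew_pos_def diff_point_def lessThan_Suc_atMost)

lemma skew_pos_diff_point_snd:
  "skew_pos d k (snd (diff_point a \<alpha> d m)) = \<alpha> * skew_pos d k (fst (diff_point a \<alpha> d m))"
  unfolding skew_pos_def sum_distrib_left by (intro sum.cong) (simp_all add: diff_point_def)

lemma skew_pos_diff_point_tendsto:
  assumes "((fdiff ^^ (d + 1)) a \<longlongrightarrow> 0) at_top"
  shows "(\<lambda>m. a (real m + of_int k) - skew_pos d k (fst (diff_point a \<alpha> d m))) \<longlonglongrightarrow> 0"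
  unfolding skew_pos_diff_point_fst
  by (rule filterlim_compose[OF newton_tendsto[OF assms] filterlim_real_sequentially])

lemma diff_point_equidistributed:
  fixes G :: "(nat \<Rightarrow> real) \<times> (nat \<Rightarrow> real) \<Rightarrow> real"
  assumes H: "hardy_field H" "germ_of a \<in> H"
    and g: "growth_less (\<lambda>t. t ^ d * ln t) a" "growth_less a (\<lambda>t. t ^ (d + 1))"
    and \<alpha>: "\<alpha> \<notin> \<rat>"
    and cont: "continuous_on UNIV G"
    and per: "\<And>p p'. (\<And>i. i \<le> d \<Longrightarrow> fst p i - fst p' i \<in> \<int> \<and> snd p i - snd p' i \<in> \<int>) \<Longrightarrow> G p = G p'"
  shows "avg (\<lambda>m. G (diff_point a \<alpha> d m)) \<longlonglongrightarrow> (\<integral>p. G p \<partial>torus_pair d)"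
proof (rule weyl_equidistribution[OF prob_space_torus_pair measurable_torus_pair_fst
      measurable_torus_pair_snd _ torus_pair_integral_char cont borel_measurable_torus_pair[OF cont] per])
  fix l l' :: "nat \<Rightarrow> int" and i assume i: "i \<le> d" "l i \<noteq> 0 \<or> l' i \<noteq> 0"
  \<comment> \<open>Both blocks see the same differences, so their frequencies merge into one real
    coefficient; \<open>d - j\<close> undoes the reversed order.\<close>
  define c where "c j = of_int (l (d - j)) + of_int (l' (d - j)) * \<alpha>" for j
  have "c (d - i) \<noteq> 0"
  proof
    assume "c (d - i) = 0"
    then have *: "of_int (l i) + of_int (l' i) * \<alpha> = 0" using i by (simp add: c_def)
    show False
    proof (cases "l' i = 0")
      case False
      then have "\<alpha> = - (of_int (l i) / of_int (l' i))" using * by (simp add: field_simps)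
      then show False using \<alpha> by (metis Rats_divide Rats_minus_iff Rats_of_int)
    qed (use * i in simp)
  qed
  then have "avg (\<lambda>m. cis (2 * pi * (\<Sum>j\<le>d. c j * (fdiff ^^ j) a (real m)))) \<longlonglongrightarrow> 0"
    by (intro avg_cis_fdiff_combination[OF H g, of "d - i"]) auto
  moreover have "(\<Sum>j\<le>d. c j * (fdiff ^^ j) a (real m))
      = (\<Sum>i\<le>d. of_int (l i) * fst (diff_point a \<alpha> d m) i + of_int (l' i) * snd (diff_point a \<alpha> d m) i)" for m
    unfolding sum_atMost_rev[of "\<lambda>j. c j * (fdiff ^^ j) a (real m)", symmetric]
    by (intro sum.cong) (auto simp: c_def diff_point_def algebra_simps)
  ultimately show "avg (\<lambda>m. torus_char d l l' (diff_point a \<alpha> d m)) \<longlonglongrightarrow> 0"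
    by (simp add: torus_char_def)
qed (auto simp: per)

text \<open>Raising \<open>k\<close> by one amounts to composing with the measure preserving skew
  product, up to integers that \<open>H\<close> ignores. So all \<open>k\<close> reduce to
  \<open>k = 0\<close>, which reads off the last coordinates.\<close>

lemma integral_skew_pos:
  fixes H :: "real \<times> real \<Rightarrow> real"
  assumes "continuous_on UNIV H" "biperiodic H"
  shows "(\<integral>p. H (skew_pos d k (fst p), skew_pos d k (snd p)) \<partial>torus_pair d)
    = (\<integral>p. H (fst p d, snd p d) \<partial>torus_pair d)"
proof -
  let ?T = "map_prod (torus_skew d) (torus_skew d)" and ?M = "torus_pair d"
  let ?I = "\<lambda>k. (\<integral>p. H (skew_pos d k (fst p), skew_pos d k (snd p)) \<partial>?M)"
  have Tm: "?T \<in> measurable ?M ?M" "distr ?M ?M ?T = ?M"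
    using mp_system_torus_skew_pair by (auto simp: mp_system_def)
  have step: "?I (k + 1) = ?I k" for k
  proof -
    have m: "(\<lambda>p. H (skew_pos d k (fst p), skew_pos d k (snd p))) \<in> borel_measurable ?M"
      by (intro borel_measurable_torus_pair continuous_on_compose2[OF assms(1)] continuous_intros) auto
    have "?I k = (\<integral>p. H (skew_pos d k (fst p), skew_pos d k (snd p)) \<partial>distr ?M ?M ?T)"
      by (simp only: Tm)
    also have "\<dots> = (\<integral>p. H (skew_pos d k (fst (?T p)), skew_pos d k (snd (?T p))) \<partial>?M)"
      by (rule integral_distr[OF Tm(1) m])
    also have "\<dots> = ?I (k + 1)"
      by (intro Bochner_Integration.integral_cong refl biperiodicD[OF assms(2)])
        (simp_all add: skew_pos_torus_skew)
    finally show ?thesis by simp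
  qed
  have "?I k = ?I 0"
  proof (induction k rule: int_induct[where k = 0])
    case (step2 k)
    have "?I k = ?I (k - 1)" using step[of "k - 1"] by (simp only: diff_add_cancel)
    then show ?case using step2(2) by (simp only:)
  qed (simp_all only: step)
  then show ?thesis by (simp add: skew_pos_0)
qed

section \<open>Convergence of the empirical measures\<close>

lemma seq_shift_funpow: "(seq_shift ^^ m) \<beta> = (\<lambda>k. \<beta> (k + int m))"
  by (induction m arbitrary: \<beta>) (simp_all add: seq_shift_def algebra_simps)

text \<open>\<open>Z\<close> is the continuous approximation of the factor map. The orbit averages
  are compared with those of \<open>f (Z (X m))\<close>, these converge to the integral of
  \<open>f (Z p)\<close>, and this is close to the integral for the factor map. Both comparisons are
  controlled by the integrals of \<open>H\<close>.\<close>

lemma empirical_measures_converge: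
  fixes f :: "(int \<Rightarrow> complex) \<Rightarrow> real"
  assumes hardy: "hardy_field HF" "germ_of a \<in> HF"
    and growth: "growth_less (\<lambda>t. t ^ d * ln t) a" "growth_less a (\<lambda>t. t ^ (d + 1))"
    and \<alpha>: "\<alpha> \<notin> \<rat>"
    and Y: "compact Y"
    and \<psi>: "\<psi> \<in> borel_measurable borel" "range \<psi> \<subseteq> Y" "dominated_approx Y \<psi>"
    and \<beta>: "\<beta> \<in> seq_space Y" "\<And>n. n \<ge> 1 \<Longrightarrow> \<beta> (int n) = \<psi> (of_int \<lfloor>a (real n)\<rfloor> * \<alpha>)"
    and f: "continuous_on (seq_space Y) f"
  shows "avg (\<lambda>m. f ((seq_shift ^^ m) \<beta>)) \<longlonglongrightarrow> (\<integral>p. f (factor_map \<psi> \<alpha> d p) \<partial>torus_pair d)"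
proof (rule LIMSEQ_I)
  fix \<epsilon> :: real assume \<epsilon>: "\<epsilon> > 0"
  interpret M: prob_space "torus_pair d" by (rule prob_space_torus_pair)
  \<comment> \<open>The budget is \<open>3 * e\<close> from \<open>U\<close>, \<open>e\<close> from
    equidistribution and \<open>2 * e\<close> between the two integrals, so
    \<open>6 * e < \<epsilon>\<close> in all.\<close>
  define e where "e = \<epsilon> / 7"
  have e: "e > 0" using \<epsilon> by (simp add: e_def)
  obtain B where B: "\<And>x. x \<in> seq_space Y \<Longrightarrow> \<bar>f x\<bar> \<le> B"
    and lip: "\<exists>K C. finite K \<and> C \<ge> 0 \<and> (\<forall>x\<in>seq_space Y. \<forall>z\<in>seq_space Y.
       \<bar>f x - f z\<bar> \<le> e + C * (\<Sum>k\<in>K. norm (x k - z k)))"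
    using seq_space_functional_bound[OF Y f] e by metis
  then obtain K C where K: "finite K" and C: "C \<ge> 0" and
    lip: "\<And>x z. x \<in> seq_space Y \<Longrightarrow> z \<in> seq_space Y \<Longrightarrow>
       \<bar>f x - f z\<bar> \<le> e + C * (\<Sum>k\<in>K. norm (x k - z k))" by blast
  \<comment> \<open>The error in each of the \<open>card K\<close> coordinates is weighted by
    \<open>C\<close>; the sum then stays at most \<open>e\<close>.\<close>
  define e' where "e' = e / (C * real (card K) + 1)"
  have e': "e' > 0" using e C by (simp add: e'_def add_nonneg_pos)
  have Ce': "C * (real (card K) * e') \<le> e"
  proof -
    have "C * (real (card K) * e') \<le> (C * real (card K) + 1) * e'" using e' by (simp add: algebra_simps)
    also have "\<dots> = e" using C by (simp add: e'_def add_nonneg_pos less_imp_neq[symmetric])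
    finally show ?thesis .
  qed
  obtain F :: "real \<times> real \<Rightarrow> complex" and H :: "real \<times> real \<Rightarrow> real" where
    F: "continuous_on UNIV F" "biperiodic F" "range F \<subseteq> Y"
    and H: "continuous_on UNIV H" "biperiodic H" "bounded (range H)"
    and FH: "\<And>x y. norm (\<psi> (y - \<alpha> * frac x) - F (x, y)) \<le> H (x, y)"
    and Hint: "(\<integral>p. H (fst p d, snd p d) \<partial>torus_pair d) \<le> e'"
    by (rule dominated_approx_skew[OF \<psi>(3) e', of \<alpha> d]) blast
  define X where "X = diff_point a \<alpha> d"
  define pos where "pos k p = (skew_pos d k (fst p), skew_pos d k (snd p))" for k and p :: "(nat \<Rightarrow> real) \<times> (nat \<Rightarrow> real)"
  define Z where "Z p = (\<lambda>k. F (pos k p))" for p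
  have Zs: "Z p \<in> seq_space Y" for p using F(3) by (auto simp: Z_def seq_space_def)
  have posc: "continuous_on UNIV (pos k)" for k unfolding pos_def by (intro continuous_intros)
  have posp: "F' (pos k p) = F' (pos k p')"
    if "biperiodic F'" "\<And>i. i \<le> d \<Longrightarrow> fst p i - fst p' i \<in> \<int> \<and> snd p i - snd p' i \<in> \<int>"
    for F' :: "real \<times> real \<Rightarrow> 'z" and k p p'
    unfolding pos_def using that by (intro biperiodicD skew_pos_Ints) auto
  have Zc: "continuous_on UNIV Z"
    unfolding Z_def
    by (intro continuous_on_coordinatewise_then_product continuous_on_compose2[OF F(1) posc]) auto
  have fZc: "continuous_on UNIV (\<lambda>p. f (Z p))"
    by (rule continuous_on_compose2[OF f Zc]) (use Zs in auto)
  have HPc: "continuous_on UNIV (\<lambda>p. H (pos k p))" for k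
    by (rule continuous_on_compose2[OF H(1) posc]) auto
  have limZ: "avg (\<lambda>m. f (Z (X m))) \<longlonglongrightarrow> (\<integral>p. f (Z p) \<partial>torus_pair d)"
    unfolding X_def
  proof (rule diff_point_equidistributed[OF hardy growth \<alpha> fZc])
    fix p p' :: "(nat \<Rightarrow> real) \<times> (nat \<Rightarrow> real)"
    assume "\<And>i. i \<le> d \<Longrightarrow> fst p i - fst p' i \<in> \<int> \<and> snd p i - snd p' i \<in> \<int>"
    then have "Z p = Z p'" unfolding Z_def using posp[OF F(2)] by blast
    then show "f (Z p) = f (Z p')" by simp
  qed
  have limH: "avg (\<lambda>m. H (pos k (X m))) \<longlonglongrightarrow> (\<integral>p. H (pos k p) \<partial>torus_pair d)" for k
    unfolding X_def
    by (rule diff_point_equidistributed[OF hardy growth \<alpha> HPc]) (rule posp[OF H(2)])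
  have intH: "(\<integral>p. H (pos k p) \<partial>torus_pair d) \<le> e'" for k
    unfolding pos_def using integral_skew_pos[OF H(1,2), of d k] Hint by simp
  have D0: "((fdiff ^^ (d + 1)) a \<longlongrightarrow> 0) at_top" by (rule hardy_fdiff_tendsto_0[OF hardy growth(2)])
  \<comment> \<open>The exact position at time \<open>m + k\<close>, which Newton's formula
    approximates by \<open>pos k (X m)\<close>. The bound by \<open>H\<close> holds at the exact
    position and has to be transferred.\<close>
  define q where "q k m = (a (real m + of_int k), \<alpha> * a (real m + of_int k))" for k :: int and m :: nat
  have near: "(\<lambda>m. F' (q k m) - F' (pos k (X m))) \<longlonglongrightarrow> 0"
    if "continuous_on UNIV F'" "biperiodic F'" for F' :: "real \<times> real \<Rightarrow> 'z::real_normed_vector" and k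
  proof -
    have 1: "(\<lambda>m. a (real m + of_int k) - skew_pos d k (fst (X m))) \<longlonglongrightarrow> 0"
      unfolding X_def by (rule skew_pos_diff_point_tendsto[OF D0])
    have 2: "(\<lambda>m. \<alpha> * a (real m + of_int k) - skew_pos d k (snd (X m))) \<longlonglongrightarrow> 0"
      using tendsto_mult_right_zero[OF 1, of \<alpha>]
      unfolding X_def skew_pos_diff_point_snd right_diff_distrib .
    show ?thesis unfolding q_def pos_def by (rule biperiodic_tendsto_diff[OF that 1 2])
  qed
  \<comment> \<open>Excess of the error over \<open>H\<close> at the Newton position, cut off at 0;
    the transfer makes it a null sequence.\<close>
  define \<delta> where "\<delta> k m = max 0 (norm (\<beta> (k + int m) - Z (X m) k) - H (pos k (X m)))" for k m
  have \<delta>0: "\<delta> k \<longlonglongrightarrow> 0" for k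
  proof -
    have lim: "(\<lambda>m. norm (H (q k m) - H (pos k (X m))) + norm (F (q k m) - F (pos k (X m)))) \<longlonglongrightarrow> 0"
      using tendsto_add[OF tendsto_norm_zero[OF near[OF H(1,2)]] tendsto_norm_zero[OF near[OF F(1,2)]]] by simp
    have "\<forall>\<^sub>F m in sequentially. norm (\<delta> k m) \<le> norm (H (q k m) - H (pos k (X m))) + norm (F (q k m) - F (pos k (X m)))"
    proof (rule eventually_sequentiallyI)
      \<comment> \<open>From here on \<open>m + k \<ge> 1\<close>, so the arbitrary values of the
        extension at nonpositive indices do not enter.\<close>
      fix m assume m: "nat (1 - k) \<le> m"
      define n where "n = nat (k + int m)"
      have n: "n \<ge> 1" "k + int m = int n" "real n = real m + of_int k" using m by (auto simp: n_def)
      have "\<beta> (k + int m) = \<psi> (of_int \<lfloor>a (real n)\<rfloor> * \<alpha>)" using \<beta>(2)[OF n(1)] n(2) by simp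
      also have "of_int \<lfloor>a (real n)\<rfloor> * \<alpha> = \<alpha> * a (real n) - \<alpha> * frac (a (real n))"
        by (simp add: frac_def algebra_simps)
      finally have "norm (\<beta> (k + int m) - F (q k m)) \<le> H (q k m)"
        using FH[of "\<alpha> * a (real n)" "a (real n)"] n(3) by (simp add: q_def)
      then show "norm (\<delta> k m) \<le> norm (H (q k m) - H (pos k (X m))) + norm (F (q k m) - F (pos k (X m)))"
        using norm_triangle_ineq[of "\<beta> (k + int m) - F (q k m)" "F (q k m) - F (pos k (X m))"]
        by (auto simp: \<delta>_def Z_def)
    qed
    then show ?thesis using lim by (rule Lim_null_comparison)
  qed
  have \<beta>s: "(seq_shift ^^ m) \<beta> \<in> seq_space Y" for m
    using \<beta>(1) by (auto simp: seq_space_def seq_shift_funpow)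
  define U where "U n = e + C * (\<Sum>k\<in>K. avg (\<lambda>m. H (pos k (X m))) n + avg (\<delta> k) n)" for n
  have ineq1: "\<bar>avg (\<lambda>m. f ((seq_shift ^^ m) \<beta>)) n - avg (\<lambda>m. f (Z (X m))) n\<bar> \<le> U n" if n: "n \<ge> 1" for n
  proof -
    have "\<bar>avg (\<lambda>m. f ((seq_shift ^^ m) \<beta>)) n - avg (\<lambda>m. f (Z (X m))) n\<bar>
        \<le> avg (\<lambda>m. \<bar>f ((seq_shift ^^ m) \<beta>) - f (Z (X m))\<bar>) n"
      using norm_avg_le[of "\<lambda>m. f ((seq_shift ^^ m) \<beta>) - f (Z (X m))" n] by (simp add: avg_diff)
    also have "\<dots> \<le> avg (\<lambda>m. e + C * (\<Sum>k\<in>K. H (pos k (X m)) + \<delta> k m)) n"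
    proof (rule avg_mono)
      fix m
      have "\<bar>f ((seq_shift ^^ m) \<beta>) - f (Z (X m))\<bar> \<le> e + C * (\<Sum>k\<in>K. norm (((seq_shift ^^ m) \<beta>) k - Z (X m) k))"
        by (rule lip[OF \<beta>s Zs])
      also have "\<dots> \<le> e + C * (\<Sum>k\<in>K. H (pos k (X m)) + \<delta> k m)"
        using C by (intro add_left_mono mult_left_mono sum_mono) (auto simp: seq_shift_funpow \<delta>_def)
      finally show "\<bar>f ((seq_shift ^^ m) \<beta>) - f (Z (X m))\<bar> \<le> e + C * (\<Sum>k\<in>K. H (pos k (X m)) + \<delta> k m)" .
    qed
    also have "\<dots> = U n" using n by (simp add: U_def avg_add avg_const avg_mult_left avg_sum)
    finally show ?thesis .
  qed
  have Ulim: "U \<longlonglongrightarrow> e + C * (\<Sum>k\<in>K. (\<integral>p. H (pos k p) \<partial>torus_pair d) + 0)"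
    unfolding U_def by (intro tendsto_intros limH tendsto_avg_null \<delta>0)
  have sumH: "C * (\<Sum>k\<in>K. (\<integral>p. H (pos k p) \<partial>torus_pair d)) \<le> e"
  proof -
    have "(\<Sum>k\<in>K. (\<integral>p. H (pos k p) \<partial>torus_pair d)) \<le> real (card K) * e'"
      by (rule sum_bounded_above) (rule intH)
    then show ?thesis using mult_left_mono[OF _ C] Ce' order_trans by blast
  qed
  have \<pi>m: "factor_map \<psi> \<alpha> d \<in> measurable (torus_pair d) (seq_measurable Y)"
    by (rule factor_map_measurable[OF \<psi>(1,2)])
  have \<pi>s: "factor_map \<psi> \<alpha> d p \<in> seq_space Y" for p
    using \<psi>(2) by (auto simp: factor_map_def seq_space_def)
  have f\<pi>m: "(\<lambda>p. f (factor_map \<psi> \<alpha> d p)) \<in> borel_measurable (torus_pair d)"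
    by (rule measurable_compose[OF \<pi>m borel_measurable_continuous_on_restrict[OF f]])
  have i1: "integrable (torus_pair d) (\<lambda>p. f (factor_map \<psi> \<alpha> d p))"
    by (rule M.integrable_const_bound[of _ B, OF _ f\<pi>m]) (use B \<pi>s in auto)
  have i2: "integrable (torus_pair d) (\<lambda>p. f (Z p))"
    by (rule M.integrable_const_bound[of _ B, OF _ borel_measurable_torus_pair[OF fZc]]) (use B Zs in auto)
  obtain BH where BH: "\<And>x. norm (H x) \<le> BH" using H(3) by (auto simp: bounded_iff)
  have i3: "integrable (torus_pair d) (\<lambda>p. H (pos k p))" for k
    by (rule M.integrable_const_bound[of _ BH, OF _ borel_measurable_torus_pair[OF HPc]]) (use BH in auto)
  have i4: "integrable (torus_pair d) (\<lambda>p. C * (\<Sum>k\<in>K. H (pos k p)))"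
    by (intro integrable_mult_right Bochner_Integration.integrable_sum i3)
  have ineq2: "\<bar>(\<integral>p. f (Z p) \<partial>torus_pair d) - (\<integral>p. f (factor_map \<psi> \<alpha> d p) \<partial>torus_pair d)\<bar> \<le> 2 * e"
  proof -
    have "\<bar>(\<integral>p. f (Z p) \<partial>torus_pair d) - (\<integral>p. f (factor_map \<psi> \<alpha> d p) \<partial>torus_pair d)\<bar>
        \<le> (\<integral>p. \<bar>f (Z p) - f (factor_map \<psi> \<alpha> d p)\<bar> \<partial>torus_pair d)"
      unfolding Bochner_Integration.integral_diff[OF i2 i1, symmetric] by (rule integral_abs_bound)
    also have "\<dots> \<le> (\<integral>p. e + C * (\<Sum>k\<in>K. H (pos k p)) \<partial>torus_pair d)"
    proof (rule integral_mono)
      show "integrable (torus_pair d) (\<lambda>p. \<bar>f (Z p) - f (factor_map \<psi> \<alpha> d p)\<bar>)" using i1 i2 by auto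
      show "integrable (torus_pair d) (\<lambda>p. e + C * (\<Sum>k\<in>K. H (pos k p)))"
        by (rule Bochner_Integration.integrable_add[OF M.integrable_const i4])
      fix p
      have "\<bar>f (Z p) - f (factor_map \<psi> \<alpha> d p)\<bar> \<le> e + C * (\<Sum>k\<in>K. norm (Z p k - factor_map \<psi> \<alpha> d p k))"
        by (rule lip[OF Zs \<pi>s])
      also have "\<dots> \<le> e + C * (\<Sum>k\<in>K. H (pos k p))"
        using C FH by (intro add_left_mono mult_left_mono sum_mono)
          (auto simp: Z_def pos_def factor_map_def norm_minus_commute)
      finally show "\<bar>f (Z p) - f (factor_map \<psi> \<alpha> d p)\<bar> \<le> e + C * (\<Sum>k\<in>K. H (pos k p))" .
    qed
    also have "\<dots> = e + C * (\<Sum>k\<in>K. (\<integral>p. H (pos k p) \<partial>torus_pair d))"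
      by (simp only: Bochner_Integration.integral_add[OF M.integrable_const i4] integral_mult_right_zero
          Bochner_Integration.integral_sum[OF i3] lebesgue_integral_const M.prob_space scaleR_one)
    finally show ?thesis using sumH by linarith
  qed
  have "\<forall>\<^sub>F n in sequentially. U n < 3 * e"
    by (rule order_tendstoD(2)[OF Ulim]) (use sumH e in simp)
  moreover have "\<forall>\<^sub>F n in sequentially. norm (avg (\<lambda>m. f (Z (X m))) n - (\<integral>p. f (Z p) \<partial>torus_pair d)) < e"
    using tendstoD[OF limZ e] by (simp add: dist_norm)
  ultimately have "\<forall>\<^sub>F n in sequentially. norm (avg (\<lambda>m. f ((seq_shift ^^ m) \<beta>)) n
      - (\<integral>p. f (factor_map \<psi> \<alpha> d p) \<partial>torus_pair d)) < \<epsilon>"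
    using eventually_ge_at_top[of 1]
  proof eventually_elim
    case (elim n)
    then show ?case using ineq1[of n] ineq2 e unfolding real_norm_def e_def by linarith
  qed
  then show "\<exists>no. \<forall>n\<ge>no. norm (avg (\<lambda>m. f ((seq_shift ^^ m) \<beta>)) n
      - (\<integral>p. f (factor_map \<psi> \<alpha> d p) \<partial>torus_pair d)) < \<epsilon>"
    by (simp add: eventually_sequentially)
qed

theorem theorem1p5:
  fixes a :: "real \<Rightarrow> real" and d :: nat and \<phi> :: "real \<Rightarrow> complex"
    and \<alpha> :: real and b :: "nat \<Rightarrow> complex"
  assumes "hardy_field_function a"
    and "growth_less (\<lambda>t. t ^ d * ln t) a"
    and "growth_less a (\<lambda>t. t ^ (d + 1))"
    and "riemann_integrable_circle \<phi>"
    and "\<alpha> \<notin> \<rat>"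
    and "\<And>n. n \<ge> 1 \<Longrightarrow> b n = \<phi> (of_int \<lfloor>a (real n)\<rfloor> * \<alpha>)"
  shows "bounded (b ` {1..}) \<and>
    (\<forall>c r. b ` {1..} \<subseteq> cball c r \<longrightarrow>
      (\<exists>\<mu>. unique_furstenberg_system (cball c r) b \<mu> \<and>
        is_factor \<mu> seq_shift
          (torus_haar (d + 1) \<Otimes>\<^sub>M torus_haar (d + 1))
          (map_prod (torus_skew d) (torus_skew d))))"
proof (intro conjI allI impI)
  have "b ` {1..} \<subseteq> range \<phi>" using assms(6) by auto
  then show "bounded (b ` {1..})" using riemann_integrable_bounded[OF assms(4)] bounded_subset by blast
next
  fix c :: complex and r :: real assume b: "b ` {1..} \<subseteq> cball c r"
  define Y where "Y = cball c r"
  \<comment> \<open>The radius \<open>r\<close> may be any real; the disc is nonempty because it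
    contains a value of \<open>b\<close>.\<close>
  have "b 1 \<in> Y" using b by (auto simp: Y_def)
  then have "Y \<noteq> {}" by blast
  then have Y: "compact Y" "convex Y" "closed Y" "Y \<noteq> {}" by (auto simp: Y_def)
  obtain HF where HF: "hardy_field HF" "germ_of a \<in> HF"
    using assms(1) by (auto simp: hardy_field_function_def)
  \<comment> \<open>\<open>\<phi>\<close> may leave the disc on a null set.\<close>
  define \<psi> where "\<psi> x = closest_point Y (\<phi> x)" for x
  have \<psi>p: "periodic1 \<psi>"
    using riemann_integrable_periodic1[OF assms(4)] by (simp add: periodic1_def \<psi>_def)
  have \<psi>m: "\<psi> \<in> borel_measurable borel"
    unfolding \<psi>_def
    by (rule measurable_compose[OF riemann_integrable_measurable[OF assms(4)]
        borel_measurable_continuous_onI[OF continuous_on_closest_point[OF Y(2-4)]]])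
  have \<psi>r: "range \<psi> \<subseteq> Y" using closest_point_in_set[OF Y(3,4)] by (auto simp: \<psi>_def)
  have \<psi>d: "dominated_approx Y \<psi>"
    unfolding \<psi>_def
    by (rule dominated_approx_closest_point[OF riemann_integrable_dominated_approx[OF assms(4)] Y(2-4)])
  \<comment> \<open>The values of \<open>b\<close> lie in the disc, where the projection is the
    identity.\<close>
  have b\<psi>: "b n = \<psi> (of_int \<lfloor>a (real n)\<rfloor> * \<alpha>)" if "n \<ge> 1" for n
  proof -
    have "b n \<in> Y" using b that by (auto simp: Y_def)
    then show ?thesis using assms(6)[OF that] by (simp add: \<psi>_def closest_point_self)
  qed
  define \<mu> where "\<mu> = distr (torus_pair d) (seq_measurable Y) (factor_map \<psi> \<alpha> d)"
  have \<pi>m: "factor_map \<psi> \<alpha> d \<in> measurable (torus_pair d) (seq_measurable Y)"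
    by (rule factor_map_measurable[OF \<psi>m \<psi>r])
  have "unique_furstenberg_system Y b \<mu>"
    unfolding unique_furstenberg_system_def
  proof (intro conjI ballI allI impI)
    show "sets \<mu> = sets (restrict_space borel (seq_space Y))" by (simp add: \<mu>_def)
    show "prob_space \<mu>" unfolding \<mu>_def by (rule prob_space.prob_space_distr[OF prob_space_torus_pair \<pi>m])
    fix \<beta> and f :: "(int \<Rightarrow> complex) \<Rightarrow> real"
    assume \<beta>: "\<beta> \<in> seq_space Y" "\<forall>n\<ge>1. \<beta> (int n) = b n" and f: "continuous_on (seq_space Y) f"
    have "avg (\<lambda>m. f ((seq_shift ^^ m) \<beta>)) \<longlonglongrightarrow> (\<integral>p. f (factor_map \<psi> \<alpha> d p) \<partial>torus_pair d)"
      by (rule empirical_measures_converge[OF HF assms(2,3,5) Y(1) \<psi>m \<psi>r \<psi>d \<beta>(1) _ f])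
        (use \<beta>(2) b\<psi> in auto)
    also have "(\<integral>p. f (factor_map \<psi> \<alpha> d p) \<partial>torus_pair d) = (\<integral>x. f x \<partial>\<mu>)"
      unfolding \<mu>_def
      by (rule integral_distr[OF \<pi>m borel_measurable_continuous_on_restrict[OF f], symmetric])
    finally show "(\<lambda>M. (\<Sum>m=1..M. f ((seq_shift ^^ m) \<beta>)) / real M) \<longlonglongrightarrow> (\<integral>x. f x \<partial>\<mu>)"
      by (simp add: avg_real[abs_def])
  qed
  moreover have "is_factor \<mu> seq_shift (torus_pair d) (map_prod (torus_skew d) (torus_skew d))"
    unfolding \<mu>_def by (rule factor_map_is_factor[OF \<psi>p \<psi>m \<psi>r])
  ultimately show "\<exists>\<mu>. unique_furstenberg_system (cball c r) b \<mu> \<and>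
        is_factor \<mu> seq_shift
          (torus_haar (d + 1) \<Otimes>\<^sub>M torus_haar (d + 1))
          (map_prod (torus_skew d) (torus_skew d))"
    unfolding Y_def by blast
qed

end
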